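(* Let $\alpha,\beta,\gamma,\delta\in\mathbb{R}$ with $\gamma\ne0$. Let $C>0$, $T>0$, $\epsilon>0$ be fixed, and for $n=2p-1$, $p\in\mathbb{N}$, let $\tilde u=\mathcal{P}_n[u]$ and let $e$ be the numerical error, governed by the error equation given in the context. Assume that $$\max\{\|\tilde u\|_{L^\infty([0,T]\times\mathbb{R})},\|\tilde u_t\|_{L^\infty([0,T]\times\mathbb{R})}\}<C$$ and $$\|e_0\|_{L^2(\mathbb{R})}+|\mathcal{G}_n(-e_0)|^{\frac12}+|\mathcal{E}_n(e_0,0)|^{\frac12}+|\mathcal{D}_n(e_0,0)|^{\frac12}+\|\nabla_e\mathcal{D}_n(e,t)\|_{L^2([0,T]\times\mathbb{R})}+\|\partial_t\nabla_e\mathcal{D}_n(e,t)\|_{L^2([0,T]\times\mathbb{R})}=\mathcal{O}\Bigl(\bigl(\tfrac{\ell n}{2}\bigr)^{-\frac{1+\epsilon}{4}}\Bigr),$$ uniformly for large values of $n=2p-1>0$. Then there exists $c>0$, depending only on $C$, $T$ and $\alpha,\beta,\gamma,\delta$, such that $$\|e\|_{C([0,T],L^2(\mathbb{R}))}\le c\Bigl(\|e_0\|_{L^2(\mathbb{R})}+|\mathcal{G}_n(-e_0)|^{\frac12}+|\mathcal{E}_n(e_0,0)|^{\frac12}+|\mathcal{D}_n(e_0,0)|^{\frac12}+\|\nabla_e\mathcal{D}_n(e,t)\|_{L^2([0,T]\times\mathbb{R})}+\|\nabla_e\partial_t\mathcal{D}_n(e,t)\|_{L^2([0,T]\times\mathbb{R})}\Bigr)$$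 for all sufficiently large values of $n>0$.
   Context: A scaling parameter $\ell>0$ is fixed. MTC functions: for $k\ge0$, $\phi_{2k}(x)=2\sqrt{\tfrac{\ell}{\pi}}\,\operatorname{Im}\tfrac{(2x+i\ell)^k}{(2x-i\ell)^{k+1}}$, $\phi_{2k+1}(x)=2\sqrt{\tfrac{\ell}{\pi}}\,\operatorname{Re}\tfrac{(2x+i\ell)^k}{(2x-i\ell)^{k+1}}$; they form a complete orthonormal system in $L^2(\mathbb{R})$. $\mathbb{P}_n=\operatorname{span}\{\phi_0,\dots,\phi_n\}$; $\mathcal{P}_n$ is the $L^2(\mathbb{R})$-orthogonal projector onto $\mathbb{P}_n$; $\mathcal{I}$ is the identity. For $n=2p-1$ and $x_m=\tfrac{\ell}{2}\cot\bigl(\tfrac{2m+1}{4p}\pi\bigr)$, the interpolation operator is $\mathcal{I}_n[f]=\sum_{k=0}^n\bar f_k\phi_k$, $\bar f_k=\tfrac{\pi}{4\ell p}\sum_{m=0}^{2p-1}(\ell^2+4x_m^2)\phi_k(x_m)f(x_m)$; it satisfies $\mathcal{I}_n[f](x_m)=f(x_m)$. $\mathcal{J}_n=-\mathcal{P}_n\partial_x\mathcal{P}_n$ (skew-symmetric). $\mathcal{H}[u](x)=\frac{\mathrm{p.v.}}{\pi}\int_{\mathbb{R}}\frac{u(y)}{y-x}dy$ is the Hilbert transform. Benjamin equation: $u_t=-\alpha u_x+\beta\mathcal{H}[u_{xx}]+\gamma u_{xxx}-\delta(u^2)_x$, $u(0)=u_0$, $x\in\mathbb{R}$; $u$ is the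 exact classical real valued solution, assumed globally defined and regular, and $\tilde u=\mathcal{P}_n[u]$. Semi-discretization: $\bar u_t=\mathcal{J}_n\nabla_{\bar u}\mathcal{G}_n(\bar u)$, $\bar u(0)=\mathcal{I}_n[u_0]$, $\bar u\in\mathbb{P}_n$, with $$\mathcal{G}_n(\bar u)=\tfrac12\int_{\mathbb{R}}\Bigl(\alpha|\bar u|^2+\beta\bar u\mathcal{H}[\mathcal{J}_n\bar u]+\gamma|\mathcal{J}_n\bar u|^2+\tfrac{2\delta}{3}\bar u\,\mathcal{I}_n[\bar u^2]\Bigr)dx.$$ The numerical error is $e=\tilde u-\bar u\in\mathbb{P}_n$, $e_0=\tilde u(0)-\bar u(0)$. It is governed by (and is to be understood as the solution of) the error equation $$e_t=\mathcal{J}_n\nabla_e\bigl[\mathcal{G}_n(-e)+\mathcal{E}_n(e,t)+\mathcal{D}_n(e,t)\bigr],\quad e(0)=e_0,$$ $$\mathcal{E}_n(e,t)=\delta\langle\tilde u(t),\mathcal{I}_n[e^2]\rangle_{L^2(\mathbb{R})},$$ $$\mathcal{D}_n(e,t)=\Bigl\langle e,\ \alpha(\mathcal{I}-\mathcal{P}_n)[u](t)-\beta\mathcal{H}\bigl[(\partial_x+\mathcal{J}_n)u\bigr](t)-\gamma(\partial_{xx}-\mathcal{J}_n^2)[u](t)+\delta\bigl(u^2(t)-\mathcal{I}_n[\tilde u^2](t)\bigr)\Bigr\rangle_{L^2(\mathbb{R})}.$$ Gradients are taken with respect to the $L^2(\mathbb{R})$ inner product. Since $\mathcal{D}_n$ is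 linear in $e$, $\nabla_e\mathcal{D}_n(e,t)$ does not depend on $e$ and is identified with the function in the second slot of the inner product defining $\mathcal{D}_n$; $\partial_t\nabla_e\mathcal{D}_n=\nabla_e\partial_t\mathcal{D}_n$ is its time derivative. *)

theory Defs
  imports "HOL-Probability.Essential_Supremum" "HOL-Library.Landau_Symbols"
begin

section \<open>The spaces \<open>L\<^sup>2\<close> and \<open>L\<^sup>\<infinity>\<close>\<close>

definition L2_fun :: "'a measure \<Rightarrow> ('a \<Rightarrow> real) \<Rightarrow> bool" where
  "L2_fun M f \<longleftrightarrow> f \<in> borel_measurable M \<and> integrable M (\<lambda>x. (f x)\<^sup>2)"

definition L2_norm :: "'a measure \<Rightarrow> ('a \<Rightarrow> real) \<Rightarrow> real" where
  "L2_norm M f = sqrt (LINT x|M. (f x)\<^sup>2)"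

definition L2_inner :: "(real \<Rightarrow> real) \<Rightarrow> (real \<Rightarrow> real) \<Rightarrow> real" where
  "L2_inner f g = (LINT x|lborel. f x * g x)"

text \<open>Lebesgue measure on \<open>[0,T] \<times> \<real>\<close>; functions of \<open>(t,x)\<close> are otherwise kept curried.\<close>

definition slab :: "real \<Rightarrow> (real \<times> real) measure" where
  "slab T = restrict_space lborel ({0..T} \<times> UNIV)"

definition Linf_norm :: "'a measure \<Rightarrow> ('a \<Rightarrow> real) \<Rightarrow> ereal" where
  "Linf_norm M f = esssup M (\<lambda>x. ereal \<bar>f x\<bar>)"

text \<open>The gradient at \<open>v\<close> of a functional \<open>F\<close> on a linear space \<open>V\<close> of functions: the Riesz
  representative in \<open>V\<close>, for the \<open>L\<^sup>2\<close> inner product, of the Frechet derivative of \<open>F\<close>.\<close>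

definition has_L2_gradient ::
    "(real \<Rightarrow> real) set \<Rightarrow> ((real \<Rightarrow> real) \<Rightarrow> real) \<Rightarrow> (real \<Rightarrow> real) \<Rightarrow> (real \<Rightarrow> real) \<Rightarrow> bool" where
  "has_L2_gradient V F v g \<longleftrightarrow> g \<in> V \<and>
     (\<forall>\<eta>>0. \<exists>d>0. \<forall>h\<in>V. L2_norm lborel h < d \<longrightarrow>
        \<bar>F (\<lambda>x. v x + h x) - F v - L2_inner g h\<bar> \<le> \<eta> * L2_norm lborel h)"


section \<open>Hilbert transform and derivatives\<close>

definition hilbert :: "(real \<Rightarrow> real) \<Rightarrow> real \<Rightarrow> real" where
  "hilbert f x = Lim (at_right 0)
     (\<lambda>r. (1 / pi) * (LINT y:{y. r < \<bar>y - x\<bar>}|lborel. f y / (y - x)))"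

text \<open>Time lives on \<open>[0,\<infinity>)\<close>, so the time derivative at \<open>0\<close> is one-sided.\<close>

definition dt :: "(real \<Rightarrow> real \<Rightarrow> real) \<Rightarrow> real \<Rightarrow> real \<Rightarrow> real" where
  "dt v t x = vector_derivative (\<lambda>s. v s x) (at t within {0..})"

definition dx :: "nat \<Rightarrow> (real \<Rightarrow> real \<Rightarrow> real) \<Rightarrow> real \<Rightarrow> real \<Rightarrow> real" where
  "dx k v t = (deriv ^^ k) (v t)"


section \<open>MTC functions, projection and interpolation\<close>

definition mtc :: "real \<Rightarrow> nat \<Rightarrow> real \<Rightarrow> real" where
  "mtc l j x = (let k = j div 2; z = Complex (2 * x) l ^ k / Complex (2 * x) (- l) ^ (k + 1)
     in 2 * sqrt (l / pi) * (if even j then Im z else Re z))"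

definition mtc_space :: "real \<Rightarrow> nat \<Rightarrow> (real \<Rightarrow> real) set" where
  "mtc_space l n = {(\<lambda>x. \<Sum>k\<le>n. c k * mtc l k x) | c. True}"

definition proj :: "real \<Rightarrow> nat \<Rightarrow> (real \<Rightarrow> real) \<Rightarrow> real \<Rightarrow> real" where
  "proj l n f = (THE g. g \<in> mtc_space l n \<and>
     (\<forall>v\<in>mtc_space l n. L2_inner (\<lambda>x. f x - g x) v = 0))"

definition node :: "real \<Rightarrow> nat \<Rightarrow> nat \<Rightarrow> real" where
  "node l p m = l / 2 * cot ((2 * real m + 1) / (4 * real p) * pi)"

text \<open>Everything that depends on the interpolation operator is indexed by \<open>p\<close>, where
  \<open>n = 2p - 1\<close> with \<open>p \<ge> 1\<close>.\<close>

definition interp :: "real \<Rightarrow> nat \<Rightarrow> (real \<Rightarrow> real) \<Rightarrow> real \<Rightarrow> real" where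
  "interp l p f x = (\<Sum>k\<le>2 * p - 1.
     (pi / (4 * l * real p) *
       (\<Sum>m\<le>2 * p - 1. (l\<^sup>2 + 4 * (node l p m)\<^sup>2) * mtc l k (node l p m) * f (node l p m)))
     * mtc l k x)"

definition Jop :: "real \<Rightarrow> nat \<Rightarrow> (real \<Rightarrow> real) \<Rightarrow> real \<Rightarrow> real" where
  "Jop l n f = (\<lambda>x. - proj l n (deriv (proj l n f)) x)"


section \<open>The Benjamin equation\<close>

definition C_L2 :: "(real \<Rightarrow> real \<Rightarrow> real) \<Rightarrow> bool" where
  "C_L2 v \<longleftrightarrow> continuous_on ({0..} \<times> UNIV) (\<lambda>(t, x). v t x) \<and>
     (\<forall>t\<ge>0. L2_fun lborel (v t)) \<and>
     (\<forall>t\<ge>0. ((\<lambda>s. L2_norm lborel (\<lambda>x. v s x - v t x)) \<longlongrightarrow> 0) (at t within {0..}))"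

text \<open>Regularity: \<open>u \<in> C([0,\<infinity>); H\<^sup>3) \<inter> C\<^sup>1([0,\<infinity>); H\<^sup>2)\<close>, with all the derivatives involved
  classical and continuous. This is what is needed for the equation and \<open>grad_D\<close> below, together
  with its time derivative, to make sense classically and in \<open>L\<^sup>2\<close>.\<close>

definition regular :: "(real \<Rightarrow> real \<Rightarrow> real) \<Rightarrow> bool" where
  "regular u \<longleftrightarrow>
     (\<forall>k<3. \<forall>t\<ge>0. \<forall>x. dx k u t differentiable at x) \<and>
     (\<forall>k\<le>3. C_L2 (dx k u)) \<and>
     (\<forall>k\<le>2. \<forall>t\<ge>0. \<forall>x. (\<lambda>s. dx k u s x) differentiable at t within {0..}) \<and>
     (\<forall>k\<le>2. C_L2 (dt (dx k u)))"

definition benjamin_solution ::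
    "real \<Rightarrow> real \<Rightarrow> real \<Rightarrow> real \<Rightarrow> (real \<Rightarrow> real) \<Rightarrow> (real \<Rightarrow> real \<Rightarrow> real) \<Rightarrow> bool" where
  "benjamin_solution \<alpha> \<beta> \<gamma> \<delta> u0 u \<longleftrightarrow> regular u \<and> u 0 = u0 \<and>
     (\<forall>t\<ge>0. \<forall>x. dt u t x = - \<alpha> * dx 1 u t x + \<beta> * hilbert (dx 2 u t) x + \<gamma> * dx 3 u t x
        - \<delta> * deriv (\<lambda>y. (u t y)\<^sup>2) x)"


section \<open>The numerical error\<close>

text \<open>\<open>u_proj l p u\<close> is the projected solution.\<close>

definition u_proj :: "real \<Rightarrow> nat \<Rightarrow> (real \<Rightarrow> real \<Rightarrow> real) \<Rightarrow> real \<Rightarrow> real \<Rightarrow> real" where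
  "u_proj l p u t = proj l (2 * p - 1) (u t)"

definition G_fun ::
    "real \<Rightarrow> nat \<Rightarrow> real \<Rightarrow> real \<Rightarrow> real \<Rightarrow> real \<Rightarrow> (real \<Rightarrow> real) \<Rightarrow> real" where
  "G_fun l p \<alpha> \<beta> \<gamma> \<delta> v = 1 / 2 * (LINT x|lborel.
     \<alpha> * \<bar>v x\<bar>\<^sup>2 + \<beta> * v x * hilbert (Jop l (2 * p - 1) v) x + \<gamma> * \<bar>Jop l (2 * p - 1) v x\<bar>\<^sup>2
     + 2 * \<delta> / 3 * v x * interp l p (\<lambda>y. (v y)\<^sup>2) x)"

definition E_fun ::
    "real \<Rightarrow> nat \<Rightarrow> real \<Rightarrow> (real \<Rightarrow> real \<Rightarrow> real) \<Rightarrow> (real \<Rightarrow> real) \<Rightarrow> real \<Rightarrow> real" where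
  "E_fun l p \<delta> u w t = \<delta> * L2_inner (u_proj l p u t) (interp l p (\<lambda>y. (w y)\<^sup>2))"

text \<open>The function representing the linear functional \<open>D_fun\<close>. It is not projected onto the
  discrete space.\<close>

definition grad_D ::
    "real \<Rightarrow> nat \<Rightarrow> real \<Rightarrow> real \<Rightarrow> real \<Rightarrow> real \<Rightarrow> (real \<Rightarrow> real \<Rightarrow> real) \<Rightarrow> real \<Rightarrow> real \<Rightarrow> real" where
  "grad_D l p \<alpha> \<beta> \<gamma> \<delta> u t x = (let J = Jop l (2 * p - 1) in
     \<alpha> * (u t x - u_proj l p u t x)
     - \<beta> * hilbert (\<lambda>y. dx 1 u t y + J (u t) y) x
     - \<gamma> * (dx 2 u t x - J (J (u t)) x)
     + \<delta> * ((u t x)\<^sup>2 - interp l p (\<lambda>y. (u_proj l p u t y)\<^sup>2) x))"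

definition D_fun ::
    "real \<Rightarrow> nat \<Rightarrow> real \<Rightarrow> real \<Rightarrow> real \<Rightarrow> real \<Rightarrow> (real \<Rightarrow> real \<Rightarrow> real) \<Rightarrow> (real \<Rightarrow> real) \<Rightarrow> real \<Rightarrow> real"
  where "D_fun l p \<alpha> \<beta> \<gamma> \<delta> u w t = L2_inner w (grad_D l p \<alpha> \<beta> \<gamma> \<delta> u t)"

text \<open>The semi-discrete solution starts from the interpolant of \<open>u0\<close>.\<close>

definition err0 :: "real \<Rightarrow> nat \<Rightarrow> (real \<Rightarrow> real) \<Rightarrow> real \<Rightarrow> real" where
  "err0 l p u0 x = proj l (2 * p - 1) u0 x - interp l p u0 x"

text \<open>The numerical error is by definition the solution of the error equation, not the difference
  of the projected and the semi-discrete solution: these agree only up to a consistency term,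
  since \<open>Jop\<close> annihilates the orthogonal complement of the discrete space.\<close>

definition error_solution ::
    "real \<Rightarrow> nat \<Rightarrow> real \<Rightarrow> real \<Rightarrow> real \<Rightarrow> real \<Rightarrow> real \<Rightarrow> (real \<Rightarrow> real) \<Rightarrow> (real \<Rightarrow> real \<Rightarrow> real)
     \<Rightarrow> (real \<Rightarrow> real \<Rightarrow> real) \<Rightarrow> bool" where
  "error_solution l p \<alpha> \<beta> \<gamma> \<delta> T u0 u e \<longleftrightarrow>
     e 0 = err0 l p u0 \<and>
     (\<forall>t\<in>{0..T}. e t \<in> mtc_space l (2 * p - 1)) \<and>
     (\<forall>t\<in>{0..T}. \<exists>g.
        has_L2_gradient (mtc_space l (2 * p - 1))
          (\<lambda>w. G_fun l p \<alpha> \<beta> \<gamma> \<delta> (\<lambda>x. - w x) + E_fun l p \<delta> u w t + D_fun l p \<alpha> \<beta> \<gamma> \<delta> u w t)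
          (e t) g \<and>
        (\<forall>x. ((\<lambda>s. e s x) has_real_derivative Jop l (2 * p - 1) g x) (at t within {0..T})))"

definition data_size ::
    "real \<Rightarrow> nat \<Rightarrow> real \<Rightarrow> real \<Rightarrow> real \<Rightarrow> real \<Rightarrow> real \<Rightarrow> (real \<Rightarrow> real) \<Rightarrow> (real \<Rightarrow> real \<Rightarrow> real) \<Rightarrow> real"
  where
  "data_size l p \<alpha> \<beta> \<gamma> \<delta> T u0 u =
     (let e0 = err0 l p u0; g = grad_D l p \<alpha> \<beta> \<gamma> \<delta> u in
       L2_norm lborel e0
       + sqrt \<bar>G_fun l p \<alpha> \<beta> \<gamma> \<delta> (\<lambda>x. - e0 x)\<bar>
       + sqrt \<bar>E_fun l p \<delta> u e0 0\<bar>
       + sqrt \<bar>D_fun l p \<alpha> \<beta> \<gamma> \<delta> u e0 0\<bar>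
       + L2_norm (slab T) (\<lambda>(t, x). g t x)
       + L2_norm (slab T) (\<lambda>(t, x). dt g t x))"

end

theory Submission
  imports Defs "HOL-Probability.Sinc_Integral"
begin

text \<open>
  The error equation is Hamiltonian, \<open>e' = J g\<close>, where \<open>J\<close> is skew and \<open>g\<close> is the gradient at
  \<open>e\<close> of the energy \<open>F = G(-e) + E(e,t) + D(e,t)\<close>. Along the solution the contribution
  \<open>\<langle>g, J g\<rangle>\<close> to the derivative of the energy vanishes, so that the energy changes only through
  the explicit time dependence of \<open>E\<close> and \<open>D\<close> (\<open>energy_increment\<close>). With
  \<open>N = \<parallel>e\<parallel>\<^sup>2\<close> and \<open>X = \<parallel>J e\<parallel>\<^sup>2\<close> this gives two facts.

  Since \<open>\<gamma> \<noteq> 0\<close>, the term \<open>\<gamma> X / 2\<close> of the energy controls \<open>X\<close> by the data, \<open>N\<close> and the time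
  integral of \<open>N\<close>, up to a cubic term (\<open>energy_controls_derivative\<close>). Moreover
  \<open>N' = - 2 \<langle>J e, g\<rangle>\<close>, where the quadratic part of the energy drops out (\<open>Q_J\<close>), because \<open>J\<close> and
  the Hilbert transform commute and are skew on the discrete space. What remains is bounded by
  the data, \<open>N\<close>, \<open>X\<close> and again a cubic term (\<open>derivative_bound\<close>).

  Interpolation is a quadrature rule with nonnegative weights that is exact on products of
  elements of the discrete space (\<open>inner_interp\<close>, \<open>inner_nodes\<close>). Hence the cubic terms cost a
  factor \<open>max \<bar>e\<bar>\<close>. The operator \<open>J\<close> is weaker than the derivative, but only by a factor of order
  \<open>sqrt p\<close>, by a telescoping of its tridiagonal coefficients (\<open>deriv_norm_bound\<close>); therefore
  \<open>e\<^sup>2 \<le> sqrt (1 + p) * (N + X)\<close> pointwise (\<open>pointwise_bound\<close>). As long as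
  \<open>sqrt (1 + p) * N \<le> 1\<close> the cubic terms are then as harmless as the quadratic ones, and Gronwall's
  inequality for \<open>N\<close> plus its integral bounds \<open>N\<close> by a multiple of the squared data. The decay
  assumed for the data beats \<open>sqrt p\<close> exactly because of \<open>\<epsilon> > 0\<close> (\<open>resolution_decay\<close>), so for large
  \<open>p\<close> the condition propagates to all of \<open>[0,T]\<close> (\<open>bootstrap_gronwall\<close>).

  Two analytic points need care. The consistency error contains the Hilbert transform of a
  general function, given only as a principal value. A representation by two \<open>L\<^sup>2\<close> pairings
  (\<open>hilbert_L2_representation\<close>) makes it differentiable in time at every point. Square integrability
  of the consistency error is assumed on the slab only; an envelope in \<open>L\<^sup>2\<close> that holds for all times
  (\<open>slab_envelope\<close>) transfers it to each time.
\<close>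

section \<open>The Hilbert space \<open>L\<^sup>2\<close>\<close>

lemma L2_funD:
  assumes "L2_fun M f"
  shows "f \<in> borel_measurable M" "integrable M (\<lambda>x. (f x)\<^sup>2)"
  using assms by (auto simp: L2_fun_def)

lemma L2_fun_bound:
  assumes "L2_fun M g" "f \<in> borel_measurable M" "AE x in M. \<bar>f x\<bar> \<le> K * \<bar>g x\<bar>"
  shows "L2_fun M f"
proof -
  have a: "integrable M (\<lambda>x. K\<^sup>2 * (g x)\<^sup>2)"
    by (rule integrable_mult_right) (rule L2_funD(2)[OF assms(1)])
  have b: "(\<lambda>x. (f x)\<^sup>2) \<in> borel_measurable M"
    by (rule borel_measurable_power[OF assms(2)])
  have c: "AE x in M. norm ((f x)\<^sup>2) \<le> norm (K\<^sup>2 * (g x)\<^sup>2)"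
    using assms(3)
  proof eventually_elim
    fix x assume "\<bar>f x\<bar> \<le> K * \<bar>g x\<bar>"
    then have "\<bar>f x\<bar>\<^sup>2 \<le> (K * \<bar>g x\<bar>)\<^sup>2" by (intro power_mono) auto
    then show "norm ((f x)\<^sup>2) \<le> norm (K\<^sup>2 * (g x)\<^sup>2)" by (simp add: power_mult_distrib)
  qed
  show ?thesis
    unfolding L2_fun_def using assms(2) Bochner_Integration.integrable_bound[OF a b c] by blast
qed

lemma L2_integrable_mult:
  assumes "L2_fun M f" "L2_fun M g"
  shows "integrable M (\<lambda>x. f x * g x)"
proof (rule Bochner_Integration.integrable_bound)
  show "integrable M (\<lambda>x. (f x)\<^sup>2 + (g x)\<^sup>2)"
    using L2_funD[OF assms(1)] L2_funD[OF assms(2)] by simp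
  show "(\<lambda>x. f x * g x) \<in> borel_measurable M"
    using L2_funD[OF assms(1)] L2_funD[OF assms(2)] by simp
  show "AE x in M. norm (f x * g x) \<le> norm ((f x)\<^sup>2 + (g x)\<^sup>2)"
  proof (rule AE_I2)
    fix x
    have "0 \<le> (\<bar>f x\<bar> - \<bar>g x\<bar>)\<^sup>2" by simp
    then have "2 * (\<bar>f x\<bar> * \<bar>g x\<bar>) \<le> (f x)\<^sup>2 + (g x)\<^sup>2"
      by (simp add: power2_diff algebra_simps)
    moreover have "0 \<le> \<bar>f x\<bar> * \<bar>g x\<bar>" by simp
    ultimately have "\<bar>f x\<bar> * \<bar>g x\<bar> \<le> (f x)\<^sup>2 + (g x)\<^sup>2" by linarith
    then show "norm (f x * g x) \<le> norm ((f x)\<^sup>2 + (g x)\<^sup>2)"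
      by (simp add: abs_mult)
  qed
qed

lemma L2_fun_add:
  assumes "L2_fun M f" "L2_fun M g" shows "L2_fun M (\<lambda>x. f x + g x)"
proof -
  have "(\<lambda>x. (f x + g x)\<^sup>2) = (\<lambda>x. (f x)\<^sup>2 + (g x)\<^sup>2 + 2 * (f x * g x))"
    by (auto simp: power2_sum)
  then show ?thesis
    using L2_funD[OF assms(1)] L2_funD[OF assms(2)] L2_integrable_mult[OF assms]
    unfolding L2_fun_def by simp
qed

lemma L2_fun_cmult: "L2_fun M f \<Longrightarrow> L2_fun M (\<lambda>x. c * f x)"
  by (auto simp: L2_fun_def power_mult_distrib)

lemma L2_fun_minus: "L2_fun M f \<Longrightarrow> L2_fun M (\<lambda>x. - f x)"
  using L2_fun_cmult[of M f "-1"] by simp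

lemma L2_fun_diff: "L2_fun M f \<Longrightarrow> L2_fun M g \<Longrightarrow> L2_fun M (\<lambda>x. f x - g x)"
  using L2_fun_add[OF _ L2_fun_minus, of M f g] by simp

lemma L2_fun_zero: "L2_fun M (\<lambda>x. 0)"
  by (simp add: L2_fun_def)

lemma L2_fun_sum: "(\<And>i. i \<in> I \<Longrightarrow> L2_fun M (f i)) \<Longrightarrow> L2_fun M (\<lambda>x. \<Sum>i\<in>I. f i x)"
  by (induction I rule: infinite_finite_induct) (auto intro: L2_fun_zero L2_fun_add)

lemma L2_norm_nonneg: "0 \<le> L2_norm M f"
  by (simp add: L2_norm_def)

lemma L2_norm_sq: "(L2_norm M f)\<^sup>2 = (LINT x|M. (f x)\<^sup>2)"
  by (simp add: L2_norm_def)

lemma discriminant_nonneg: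
  fixes a b c :: real
  assumes "0 \<le> c" and q: "\<And>t. 0 \<le> a + 2 * t * b + t\<^sup>2 * c"
  shows "b\<^sup>2 \<le> a * c"
proof (cases "c = 0")
  case True
  have "b = 0"
  proof (rule ccontr)
    assume "b \<noteq> 0"
    then have "2 * (- (a + 1) / (2 * b)) * b = - (a + 1)" by simp
    then show False using q[of "- (a + 1) / (2 * b)"] True by simp
  qed
  then show ?thesis using True by simp
next
  case False
  then have "c > 0" using assms(1) by linarith
  have "0 \<le> (a + 2 * (- b / c) * b + (- b / c)\<^sup>2 * c) * c"
    using q[of "- b / c"] \<open>c > 0\<close> by (intro mult_nonneg_nonneg) auto
  also have "\<dots> = a * c - b\<^sup>2"
    using \<open>c > 0\<close> by (simp add: field_simps power2_eq_square)
  finally show ?thesis by simp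
qed

lemma L2_cauchy_schwarz:
  assumes "L2_fun M f" "L2_fun M g"
  shows "\<bar>LINT x|M. f x * g x\<bar> \<le> L2_norm M f * L2_norm M g"
proof -
  let ?a = "LINT x|M. (f x)\<^sup>2" and ?b = "LINT x|M. f x * g x" and ?c = "LINT x|M. (g x)\<^sup>2"
  note i = L2_funD[OF assms(1)] L2_funD[OF assms(2)] L2_integrable_mult[OF assms]
  have q: "0 \<le> ?a + 2 * t * ?b + t\<^sup>2 * ?c" for t
  proof -
    have "0 \<le> (LINT x|M. (f x + t * g x)\<^sup>2)" by simp
    also have "\<dots> = (LINT x|M. (f x)\<^sup>2 + (2 * t) * (f x * g x) + t\<^sup>2 * (g x)\<^sup>2)"
      by (intro Bochner_Integration.integral_cong) (auto simp: power2_eq_square algebra_simps)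
    also have "\<dots> = ?a + 2 * t * ?b + t\<^sup>2 * ?c"
      using i by simp
    finally show ?thesis .
  qed
  have "0 \<le> ?c" by simp
  then have "?b\<^sup>2 \<le> ?a * ?c"
    using q by (rule discriminant_nonneg)
  then have "sqrt (?b\<^sup>2) \<le> sqrt (?a * ?c)" by (rule real_sqrt_le_mono)
  then show ?thesis by (simp add: L2_norm_def real_sqrt_mult)
qed

lemma L2_inner_bound:
  assumes "L2_fun lborel f" "L2_fun lborel g"
  shows "\<bar>L2_inner f g\<bar> \<le> L2_norm lborel f * L2_norm lborel g"
  using L2_cauchy_schwarz[OF assms] by (simp add: L2_inner_def)

lemma L2_inner_commute: "L2_inner f g = L2_inner g f"
  by (simp add: L2_inner_def mult.commute)

lemma L2_inner_self: "L2_inner f f = (L2_norm lborel f)\<^sup>2"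
  by (simp add: L2_inner_def L2_norm_sq flip: power2_eq_square)

lemma L2_inner_add_left:
  assumes "L2_fun lborel f" "L2_fun lborel g" "L2_fun lborel h"
  shows "L2_inner (\<lambda>x. f x + g x) h = L2_inner f h + L2_inner g h"
  using assms by (simp add: L2_inner_def distrib_right L2_integrable_mult)

lemma L2_inner_diff_left:
  assumes "L2_fun lborel f" "L2_fun lborel g" "L2_fun lborel h"
  shows "L2_inner (\<lambda>x. f x - g x) h = L2_inner f h - L2_inner g h"
  using assms by (simp add: L2_inner_def left_diff_distrib L2_integrable_mult)

lemma L2_inner_cmult_left: "L2_inner (\<lambda>x. c * f x) h = c * L2_inner f h"
  by (simp add: L2_inner_def mult.assoc)

lemma L2_inner_sum_left:
  assumes "\<And>i. i \<in> I \<Longrightarrow> L2_fun lborel (f i)" "L2_fun lborel h"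
  shows "L2_inner (\<lambda>x. \<Sum>i\<in>I. c i * f i x) h = (\<Sum>i\<in>I. c i * L2_inner (f i) h)"
proof -
  have "L2_inner (\<lambda>x. \<Sum>i\<in>I. c i * f i x) h = (LINT x|lborel. (\<Sum>i\<in>I. c i * (f i x * h x)))"
    by (simp add: L2_inner_def sum_distrib_right mult.assoc)
  also have "\<dots> = (\<Sum>i\<in>I. (LINT x|lborel. c i * (f i x * h x)))"
    by (intro Bochner_Integration.integral_sum)
       (auto intro!: integrable_mult_right L2_integrable_mult assms)
  finally show ?thesis by (simp add: L2_inner_def)
qed

lemma L2_norm_triangle:
  assumes "L2_fun M f" "L2_fun M g"
  shows "L2_norm M (\<lambda>x. f x + g x) \<le> L2_norm M f + L2_norm M g"
proof (rule power2_le_imp_le)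
  note i = L2_funD[OF assms(1)] L2_funD[OF assms(2)] L2_integrable_mult[OF assms]
  have "(L2_norm M (\<lambda>x. f x + g x))\<^sup>2 = (LINT x|M. (f x)\<^sup>2 + (g x)\<^sup>2 + 2 * (f x * g x))"
    unfolding L2_norm_sq by (intro Bochner_Integration.integral_cong) (auto simp: power2_sum)
  also have "\<dots> = (L2_norm M f)\<^sup>2 + (L2_norm M g)\<^sup>2 + 2 * (LINT x|M. f x * g x)"
    unfolding L2_norm_sq using i by simp
  also have "\<dots> \<le> (L2_norm M f + L2_norm M g)\<^sup>2"
    using L2_cauchy_schwarz[OF assms] by (simp add: power2_sum)
  finally show "(L2_norm M (\<lambda>x. f x + g x))\<^sup>2 \<le> (L2_norm M f + L2_norm M g)\<^sup>2" .
qed (simp add: L2_norm_nonneg)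

lemma L2_norm_minus_commute: "L2_norm M (\<lambda>x. f x - g x) = L2_norm M (\<lambda>x. g x - f x)"
  by (simp add: L2_norm_def power2_commute)

lemma L2_norm_diff_le:
  assumes "L2_fun M f" "L2_fun M g"
  shows "\<bar>L2_norm M f - L2_norm M g\<bar> \<le> L2_norm M (\<lambda>x. f x - g x)"
  using L2_norm_triangle[OF L2_fun_diff[OF assms] assms(2)]
    L2_norm_triangle[OF L2_fun_diff[OF assms(2,1)] assms(1)]
  by (simp add: L2_norm_minus_commute[of M g f])

text \<open>Every \<open>L\<^sup>2\<close> estimate of a rational function, and every integral at infinity, is
  reduced to this weight.\<close>

lemma integrable_weight:
  fixes l :: real assumes "l > 0"
  shows "integrable lborel (\<lambda>x. 1 / (4 * x\<^sup>2 + l\<^sup>2))"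
proof -
  have "integrable lborel (\<lambda>x::real. inverse (1 + x\<^sup>2))"
    using integrable_inverse_1_plus_square by (simp add: set_integrable_def)
  then have "integrable lborel (\<lambda>x::real. inverse (1 + (0 + (2 / l) * x)\<^sup>2))"
    using assms by (intro lborel_integrable_real_affine) auto
  then have "integrable lborel (\<lambda>x::real. inverse (1 + (0 + (2 / l) * x)\<^sup>2) * (1 / l\<^sup>2))"
    by (rule integrable_mult_left)
  moreover have "inverse (1 + (0 + (2 / l) * x)\<^sup>2) * (1 / l\<^sup>2) = 1 / (4 * x\<^sup>2 + l\<^sup>2)" for x
  proof -
    have "1 + (0 + (2 / l) * x)\<^sup>2 = (4 * x\<^sup>2 + l\<^sup>2) / l\<^sup>2"
      using assms by (simp add: power_divide power_mult_distrib add_divide_distrib)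
    then show ?thesis using assms by simp
  qed
  ultimately show ?thesis by simp
qed

section \<open>The rational functions behind the MTC system\<close>

lemma has_integral_line_FTC:
  fixes f F :: "real \<Rightarrow> 'a::euclidean_space"
  assumes "\<And>x. (F has_vector_derivative f x) (at x)" "\<And>x. isCont f x" "integrable lborel f"
    and "(F \<longlongrightarrow> A) at_bot" "(F \<longlongrightarrow> B) at_top"
  shows "(LINT x|lborel. f x) = B - A"
proof -
  have "(LBINT x=-\<infinity>..\<infinity>. f x) = B - A"
    by (rule interval_integral_FTC_integrable[where F=F])
       (use assms in \<open>auto simp: ereal_tendsto_simps set_integrable_def einterval_iff\<close>)
  then show ?thesis
    by (simp add: interval_lebesgue_integral_def set_lebesgue_integral_def)
qed

lemma has_integral_above_FTC:
  fixes f F :: "real \<Rightarrow> 'a::euclidean_space"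
  assumes "\<And>x. x > a \<Longrightarrow> (F has_vector_derivative f x) (at x)" "\<And>x. x > a \<Longrightarrow> isCont f x"
    and "set_integrable lborel {a<..} f" "isCont F a" "(F \<longlongrightarrow> B) at_top"
  shows "(LINT x:{a<..}|lborel. f x) = B - F a"
proof -
  have e: "einterval (ereal a) \<infinity> = {a<..}" by (auto simp: einterval_def)
  have "(F \<longlongrightarrow> F a) (at_right a)"
    using assms(4) by (auto simp: isCont_def intro: tendsto_mono at_le)
  then have "(LBINT x=ereal a..\<infinity>. f x) = B - F a"
    by (intro interval_integral_FTC_integrable[where F=F])
       (use assms in \<open>auto simp: ereal_tendsto_simps e\<close>)
  then show ?thesis
    by (simp add: interval_lebesgue_integral_def e)
qed

lemma has_integral_below_FTC:
  fixes f F :: "real \<Rightarrow> 'a::euclidean_space"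
  assumes "\<And>x. x < a \<Longrightarrow> (F has_vector_derivative f x) (at x)" "\<And>x. x < a \<Longrightarrow> isCont f x"
    and "set_integrable lborel {..<a} f" "isCont F a" "(F \<longlongrightarrow> A) at_bot"
  shows "(LINT x:{..<a}|lborel. f x) = F a - A"
proof -
  have e: "einterval (-\<infinity>) (ereal a) = {..<a}" by (auto simp: einterval_def)
  have "(F \<longlongrightarrow> F a) (at_left a)"
    using assms(4) by (auto simp: isCont_def intro: tendsto_mono at_le)
  then have "(LBINT x=-\<infinity>..ereal a. f x) = F a - A"
    by (intro interval_integral_FTC_integrable[where F=F])
       (use assms in \<open>auto simp: ereal_tendsto_simps e\<close>)
  then show ?thesis
    by (simp add: interval_lebesgue_integral_def e)
qed

text \<open>Kept folded so that the simplifier does not distribute the embedding of the reals.\<close>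

definition weight :: "real \<Rightarrow> real \<Rightarrow> real" where
  "weight l x = 4 * x\<^sup>2 + l\<^sup>2"

definition lower :: "real \<Rightarrow> real \<Rightarrow> complex" where
  "lower l x = Complex (2 * x) (- l)"

text \<open>A Cayley transform of the real line onto the unit circle. In terms of it the MTC functions are
  powers on the circle divided by \<open>lower\<close>; this turns orthogonality, on the
  line and at the nodes, into orthogonality of characters.\<close>

definition unimod :: "real \<Rightarrow> real \<Rightarrow> complex" where
  "unimod l x = Complex (2 * x) l / Complex (2 * x) (- l)"

text \<open>Up to normalisation, \<open>mtc l (2 * k)\<close> and \<open>mtc l (2 * k + 1)\<close> are the imaginary and the real part
  of this function.\<close>

definition psi :: "real \<Rightarrow> nat \<Rightarrow> real \<Rightarrow> complex" where
  "psi l k x = unimod l x ^ k / lower l x"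

definition phase :: "nat \<Rightarrow> complex" where
  "phase j = (if even j then - \<i> else 1)"

lemma mtc_eq_psi: "mtc l j x = 2 * sqrt (l / pi) * Re (phase j * psi l (j div 2) x)"
proof -
  have "Complex (2 * x) l ^ k / Complex (2 * x) (- l) ^ (k + 1) = psi l k x" for k
    by (simp add: psi_def unimod_def lower_def power_divide)
  moreover have "Re (- \<i> * w) = Im w" for w by simp
  ultimately show ?thesis
    unfolding mtc_def Let_def phase_def by simp
qed

lemma lower_nonzero: "l > 0 \<Longrightarrow> lower l x \<noteq> 0"
  by (simp add: lower_def complex_eq_iff)

lemma lower_norm_sq: "(cmod (lower l x))\<^sup>2 = weight l x"
  by (simp add: weight_def lower_def cmod_def power_mult_distrib)

lemma lower_mult_cnj: "lower l x * cnj (lower l x) = of_real (weight l x)"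
  by (simp add: complex_norm_square[symmetric] lower_norm_sq del: of_real_power flip: of_real_power)

lemma unimod_cnj: "unimod l x = cnj (lower l x) / lower l x"
  by (simp add: unimod_def lower_def cnj.ctr)

lemma unimod_norm: "l > 0 \<Longrightarrow> cmod (unimod l x) = 1"
  using lower_nonzero[of l x] by (simp add: unimod_cnj norm_divide)

lemma unimod_mult_cnj: "l > 0 \<Longrightarrow> unimod l x * cnj (unimod l x) = 1"
  using lower_nonzero[of l x] by (simp add: unimod_cnj)

lemma unimod_eq: "l > 0 \<Longrightarrow> unimod l x = 1 + 2 * \<i> * l / lower l x"
  using lower_nonzero[of l x]
  by (simp add: unimod_cnj divide_simps) (simp add: lower_def complex_eq_iff)

lemma psi_mult_psi:
  assumes "l > 0"
  shows "psi l k x * psi l j x = unimod l x ^ (k + j + 1) / of_real (weight l x)"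
  using lower_nonzero[OF assms, of x] lower_mult_cnj[of l x, symmetric]
  by (simp add: psi_def unimod_cnj power_divide power_add field_simps)

lemma psi_mult_cnj_psi:
  assumes "l > 0" "j \<le> k"
  shows "psi l k x * cnj (psi l j x) = unimod l x ^ (k - j) / of_real (weight l x)"
proof -
  have "unimod l x ^ k * cnj (unimod l x) ^ j = unimod l x ^ (k - j)"
  proof -
    have "unimod l x ^ k = unimod l x ^ (k - j) * unimod l x ^ j"
      using assms(2) by (simp flip: power_add)
    then show ?thesis
      by (simp add: mult.assoc unimod_mult_cnj[OF assms(1)] flip: power_mult_distrib)
  qed
  moreover have "psi l k x * cnj (psi l j x)
      = (unimod l x ^ k * cnj (unimod l x) ^ j) / (lower l x * cnj (lower l x))"
    by (simp only: psi_def complex_cnj_divide complex_cnj_power times_divide_times_eq)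
  ultimately show ?thesis by (simp only: lower_mult_cnj)
qed

lemma lower_vector_derivative: "(lower l has_vector_derivative 2) (at x within S)"
proof -
  have "lower l = (\<lambda>x. of_real (2 * x) - \<i> * l)"
    by (auto simp: lower_def complex_eq_iff)
  moreover have "((\<lambda>x. of_real (2 * x) - \<i> * l) has_vector_derivative 2) (at x within S)"
    by (auto intro!: derivative_eq_intros simp: has_vector_derivative_def fun_eq_iff scaleR_conv_of_real)
  ultimately show ?thesis by simp
qed

lemma inverse_lower_vector_derivative:
  assumes "l > 0"
  shows "((\<lambda>x. 1 / lower l x) has_vector_derivative - 2 / (lower l x)\<^sup>2) (at x within S)"
proof -
  have "(inverse has_field_derivative - (inverse (lower l x) * inverse (lower l x))) (at (lower l x) within lower l ` S)"
    using DERIV_inverse'[OF DERIV_ident lower_nonzero[OF assms]] by simp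
  from field_vector_diff_chain_within[OF lower_vector_derivative this]
  show ?thesis by (simp add: o_def divide_inverse power2_eq_square)
qed

lemma unimod_vector_derivative:
  assumes "l > 0"
  shows "(unimod l has_vector_derivative - 4 * \<i> * l / (lower l x)\<^sup>2) (at x within S)"
proof -
  have e: "unimod l = (\<lambda>x. 1 + 2 * \<i> * l * (1 / lower l x))"
    using unimod_eq[OF assms] by auto
  show ?thesis unfolding e
    by (rule has_vector_derivative_add[THEN has_vector_derivative_eq_rhs],
        rule has_vector_derivative_const,
        rule has_vector_derivative_mult_right[OF inverse_lower_vector_derivative[OF assms]]) simp
qed

lemma unimod_pow_vector_derivative:
  assumes "l > 0"
  shows "((\<lambda>x. unimod l x ^ m) has_vector_derivative
     - 4 * \<i> * l * of_nat m * (unimod l x ^ m / of_real (weight l x))) (at x within S)"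
proof -
  have "((\<lambda>z. z ^ m) has_field_derivative of_nat m * unimod l x ^ (m - 1)) (at (unimod l x) within unimod l ` S)"
    by (auto intro!: derivative_eq_intros)
  from field_vector_diff_chain_within[OF unimod_vector_derivative[OF assms] this]
  have "((\<lambda>x. unimod l x ^ m) has_vector_derivative
      - 4 * \<i> * l / (lower l x)\<^sup>2 * (of_nat m * unimod l x ^ (m - 1))) (at x within S)"
    by (simp add: o_def)
  moreover have "- 4 * \<i> * l / (lower l x)\<^sup>2 * (of_nat m * unimod l x ^ (m - 1))
      = - 4 * \<i> * l * of_nat m * (unimod l x ^ m / of_real (weight l x))"
  proof (cases m)
    case (Suc k)
    have "unimod l x / of_real (weight l x) = 1 / (lower l x)\<^sup>2"
      using lower_nonzero[OF assms, of x]
      by (simp add: unimod_cnj power2_eq_square flip: lower_mult_cnj)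
    then have "unimod l x ^ m / of_real (weight l x) = unimod l x ^ k * (1 / (lower l x)\<^sup>2)"
      using Suc by (metis power_Suc2 times_divide_eq_right)
    then show ?thesis using Suc by simp
  qed simp
  ultimately show ?thesis by simp
qed

text \<open>Differentiating produces the factors \<open>1 / lower\<close>, which are affine in \<open>unimod\<close>. Hence the
  derivative is again a combination of neighbouring powers, with the coefficients of the
  three-term recurrence of the Laguerre polynomials.\<close>

lemma psi_vector_derivative:
  assumes "l > 0"
  shows "(psi l k has_vector_derivative
     - (\<i> / l) * ((2 * of_nat k + 1) * psi l k x - of_nat k * psi l (k - 1) x - (of_nat k + 1) * psi l (k + 1) x)) (at x within S)"
proof -
  have e: "psi l k = (\<lambda>x. unimod l x ^ k * (1 / lower l x))" by (auto simp: psi_def)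
  have d: "(psi l k has_vector_derivative
     (unimod l x ^ k * (- 2 / (lower l x)\<^sup>2)
      + - 4 * \<i> * l * of_nat k * (unimod l x ^ k / of_real (weight l x)) * (1 / lower l x))) (at x within S)"
    unfolding e
    by (rule has_vector_derivative_mult[OF unimod_pow_vector_derivative[OF assms] inverse_lower_vector_derivative[OF assms]])
  let ?z = "unimod l x" and ?b = "lower l x" and ?L = "complex_of_real l"
  have nz: "?b \<noteq> 0" "?z \<noteq> 0" "?L \<noteq> 0"
    using lower_nonzero[OF assms] unimod_norm[OF assms, of x] assms by auto
  have b: "1 / ?b = (?z - 1) / (2 * \<i> * ?L)"
    using unimod_eq[OF assms, of x] nz by simp
  have w: "?z / of_real (weight l x) = 1 / ?b\<^sup>2"
    using nz by (simp add: unimod_cnj power2_eq_square flip: lower_mult_cnj)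
  have "unimod l x ^ k * (- 2 / (lower l x)\<^sup>2)
      + - 4 * \<i> * l * of_nat k * (unimod l x ^ k / of_real (weight l x)) * (1 / lower l x)
    = - (\<i> / l) * ((2 * of_nat k + 1) * psi l k x - of_nat k * psi l (k - 1) x - (of_nat k + 1) * psi l (k + 1) x)"
  proof -
    let ?W = "(1::complex) / of_real (weight l x)"
    have z1: "?z \<noteq> 1" using b nz by auto
    have "?b = 1 / (1 / ?b)" by simp
    then have b': "?b = 2 * \<i> * ?L / (?z - 1)" unfolding b by simp
    have W: "?W = 1 / (?b\<^sup>2 * ?z)" using w nz by (simp add: field_simps)
    show ?thesis
    proof (cases k)
      case 0
      then show ?thesis
        using nz z1 unfolding psi_def b' by (simp add: field_simps power2_eq_square)
    next
      case (Suc m)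
      have "unimod l x ^ k * (- 2 / ?b\<^sup>2)
          + - 4 * \<i> * l * of_nat k * (unimod l x ^ k * ?W) * (1 / ?b)
        = ?z ^ m * (?z * (- 2 / ?b\<^sup>2) + - 4 * \<i> * ?L * of_nat k * (1 / ?b\<^sup>2) * (1 / ?b))"
        unfolding W using nz Suc by (simp add: field_simps)
      also have "\<dots> = ?z ^ m / ?b * (?z * (- 2 / ?b) + - 4 * \<i> * ?L * of_nat k * (1 / ?b\<^sup>2))"
        using nz by (simp add: field_simps power2_eq_square)
      also have "?z * (- 2 / ?b) + - 4 * \<i> * ?L * of_nat k * (1 / ?b\<^sup>2)
         = - (\<i> / ?L) * ((2 * of_nat k + 1) * ?z - of_nat k - (of_nat k + 1) * ?z\<^sup>2)"
        using nz z1 unfolding b' by (simp add: field_simps power2_eq_square)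
      also have "?z ^ m / ?b * \<dots> = - (\<i> / l) * ((2 * of_nat k + 1) * psi l k x - of_nat k * psi l (k - 1) x - (of_nat k + 1) * psi l (k + 1) x)"
        using nz Suc unfolding psi_def by (simp add: field_simps power2_eq_square)
      finally show ?thesis by simp
    qed
  qed
  from has_vector_derivative_eq_rhs[OF d this] show ?thesis .
qed

lemma continuous_on_lower: "continuous_on S (lower l)"
  by (intro differentiable_imp_continuous_on)
     (auto simp: differentiable_on_def intro!: differentiableI_vector lower_vector_derivative)

lemma continuous_on_unimod: "l > 0 \<Longrightarrow> continuous_on S (unimod l)"
  by (intro differentiable_imp_continuous_on)
     (auto simp: differentiable_on_def intro!: differentiableI_vector unimod_vector_derivative)

lemma continuous_on_psi: "l > 0 \<Longrightarrow> continuous_on S (psi l k)"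
  unfolding psi_def[abs_def]
  by (intro continuous_intros continuous_on_unimod continuous_on_lower) (auto simp: lower_nonzero)

lemma weight_pos: "l > 0 \<Longrightarrow> 0 < weight l x"
  by (simp add: weight_def add_nonneg_pos)

lemma psi_norm_sq: "l > 0 \<Longrightarrow> (cmod (psi l k x))\<^sup>2 = 1 / (weight l x)"
  by (simp add: psi_def norm_divide norm_power unimod_norm power_divide lower_norm_sq)

lemma psi_tendsto_zero:
  assumes "l > 0"
  shows "(psi l k \<longlongrightarrow> 0) at_top" "(psi l k \<longlongrightarrow> 0) at_bot"
proof -
  have n: "norm (psi l k x) \<le> norm (1 / (2 * x))" if "x \<noteq> 0" for x
  proof -
    have "(cmod (psi l k x))\<^sup>2 \<le> (1 / (2 * \<bar>x\<bar>))\<^sup>2"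
      unfolding psi_norm_sq[OF assms] using that assms
      by (simp add: power_divide power_mult_distrib frac_le weight_def)
    then have "cmod (psi l k x) \<le> 1 / (2 * \<bar>x\<bar>)"
      by (rule power2_le_imp_le) simp
    then show ?thesis by (simp add: abs_mult)
  qed
  have e: "\<forall>\<^sub>F x in at_top. norm (psi l k x) \<le> norm (1 / (2 * x))"
    "\<forall>\<^sub>F x in at_bot. norm (psi l k x) \<le> norm (1 / (2 * x))"
    by (rule eventually_mono[OF eventually_gt_at_top[of 0]], rule n, simp)
       (rule eventually_mono[OF eventually_gt_at_bot[of 0]], rule n, simp)
  have l: "((\<lambda>x::real. 1 / (2 * x)) \<longlongrightarrow> 0) at_top" "((\<lambda>x::real. 1 / (2 * x)) \<longlongrightarrow> 0) at_bot"
    by real_asymp+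
  show "(psi l k \<longlongrightarrow> 0) at_top"
    by (rule Lim_null_comparison[OF e(1) tendsto_norm_zero[OF l(1)]])
  show "(psi l k \<longlongrightarrow> 0) at_bot"
    by (rule Lim_null_comparison[OF e(2) tendsto_norm_zero[OF l(2)]])
qed

lemma integrable_inverse_weight: "l > 0 \<Longrightarrow> integrable lborel (\<lambda>x. 1 / weight l x)"
  using integrable_weight by (simp add: weight_def)

lemma integral_inverse_weight:
  assumes "l > 0"
  shows "(LINT x|lborel. 1 / weight l x) = pi / (2 * l)"
proof -
  have "(LINT x|lborel. 1 / weight l x) = \<bar>l / 2\<bar> *\<^sub>R (LINT x|lborel. 1 / weight l (0 + (l / 2) * x))"
    using assms by (intro lborel_integral_real_affine) auto
  also have "(\<lambda>x. 1 / weight l (0 + (l / 2) * x)) = (\<lambda>x. 1 / l\<^sup>2 * inverse (1 + x\<^sup>2))"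
  proof
    fix x
    have "weight l (0 + (l / 2) * x) = l\<^sup>2 * (1 + x\<^sup>2)"
      by (simp add: weight_def power_divide power_mult_distrib distrib_left)
    then show "1 / weight l (0 + (l / 2) * x) = 1 / l\<^sup>2 * inverse (1 + x\<^sup>2)"
      by (simp only: inverse_eq_divide times_divide_times_eq mult_1_left)
  qed
  also have "(LINT x|lborel. 1 / l\<^sup>2 * inverse (1 + x\<^sup>2)) = 1 / l\<^sup>2 * pi"
  proof -
    have "(LINT x|lborel. inverse (1 + x\<^sup>2)) = pi"
      using LBINT_inverse_1_plus_square
      by (simp add: interval_lebesgue_integral_def set_lebesgue_integral_def)
    then show ?thesis by (simp only: integral_mult_right_zero)
  qed
  finally have "(LINT x|lborel. 1 / weight l x) = \<bar>l / 2\<bar> *\<^sub>R (1 / l\<^sup>2 * pi)" .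
  also have "\<dots> = pi / (2 * l)"
    using assms by (simp add: power2_eq_square)
  finally show ?thesis .
qed

lemma unimod_tendsto_one:
  assumes "l > 0"
  shows "(unimod l \<longlongrightarrow> 1) at_top" "(unimod l \<longlongrightarrow> 1) at_bot"
proof -
  have e: "unimod l = (\<lambda>x. 1 + 2 * \<i> * l * psi l 0 x)"
    using unimod_eq[OF assms] by (auto simp: psi_def)
  have "((\<lambda>x. 1 + 2 * \<i> * l * psi l 0 x) \<longlongrightarrow> 1 + 2 * \<i> * l * 0) at_top"
    by (intro tendsto_intros psi_tendsto_zero assms)
  then show "(unimod l \<longlongrightarrow> 1) at_top" unfolding e by simp
  have "((\<lambda>x. 1 + 2 * \<i> * l * psi l 0 x) \<longlongrightarrow> 1 + 2 * \<i> * l * 0) at_bot"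
    by (intro tendsto_intros psi_tendsto_zero assms)
  then show "(unimod l \<longlongrightarrow> 1) at_bot" unfolding e by simp
qed

lemma continuous_on_weight: "continuous_on S (weight l)"
  unfolding weight_def[abs_def] by (intro continuous_intros)

lemma continuous_on_unimod_weight:
  "l > 0 \<Longrightarrow> continuous_on S (\<lambda>x. unimod l x ^ m / of_real (weight l x))"
  using weight_pos[of l]
  by (intro continuous_intros continuous_on_unimod continuous_on_weight)
     (auto simp: less_le)

lemma integrable_unimod_pow:
  assumes "l > 0"
  shows "integrable lborel (\<lambda>x. unimod l x ^ m / of_real (weight l x))"
proof (rule Bochner_Integration.integrable_bound[OF integrable_inverse_weight[OF assms]])
  show "(\<lambda>x. unimod l x ^ m / of_real (weight l x)) \<in> borel_measurable lborel"
    using borel_measurable_continuous_onI[OF continuous_on_unimod_weight[OF assms]] by simp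
  show "AE x in lborel. norm (unimod l x ^ m / of_real (weight l x)) \<le> norm (1 / weight l x)"
    by (simp add: norm_divide norm_power unimod_norm[OF assms])
qed

text \<open>Up to a factor, the integrand is the derivative of a power of the unimodular quotient,
  and that quotient has the same limit at both ends of the line.\<close>

lemma integral_unimod_pow:
  assumes "l > 0" "m > 0"
  shows "(LINT x|lborel. unimod l x ^ m / of_real (weight l x)) = 0"
proof -
  let ?c = "- 4 * \<i> * l * of_nat m"
  have c: "?c \<noteq> 0" using assms by simp
  have "(LINT x|lborel. unimod l x ^ m / of_real (weight l x)) = 1 / ?c - 1 / ?c"
  proof (rule has_integral_line_FTC[where F = "\<lambda>x. 1 / ?c * unimod l x ^ m"])
    show "((\<lambda>x. 1 / ?c * unimod l x ^ m) has_vector_derivative unimod l x ^ m / of_real (weight l x)) (at x)" for x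
      by (rule has_vector_derivative_eq_rhs[OF has_vector_derivative_mult_right[OF unimod_pow_vector_derivative[OF assms(1)]]])
         (use c in simp)
    show "isCont (\<lambda>x. unimod l x ^ m / of_real (weight l x)) x" for x
      using continuous_on_unimod_weight[OF assms(1), of UNIV m] by (simp add: continuous_on_eq_continuous_at)
    show "integrable lborel (\<lambda>x. unimod l x ^ m / of_real (weight l x))"
      by (rule integrable_unimod_pow[OF assms(1)])
    have "((\<lambda>x. 1 / ?c * unimod l x ^ m) \<longlongrightarrow> 1 / ?c * 1 ^ m) at_bot"
      by (intro tendsto_intros unimod_tendsto_one assms)
    then show "((\<lambda>x. 1 / ?c * unimod l x ^ m) \<longlongrightarrow> 1 / ?c) at_bot" by simp
    have "((\<lambda>x. 1 / ?c * unimod l x ^ m) \<longlongrightarrow> 1 / ?c * 1 ^ m) at_top"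
      by (intro tendsto_intros unimod_tendsto_one assms)
    then show "((\<lambda>x. 1 / ?c * unimod l x ^ m) \<longlongrightarrow> 1 / ?c) at_top" by simp
  qed
  then show ?thesis by simp
qed

lemma psi_psi_integral:
  assumes "l > 0"
  shows "integrable lborel (\<lambda>x. psi l k x * psi l j x)" "(LINT x|lborel. psi l k x * psi l j x) = 0"
  unfolding psi_mult_psi[OF assms]
  by (rule integrable_unimod_pow[OF assms], rule integral_unimod_pow[OF assms]) simp

lemma psi_cnj_psi_integral:
  assumes "l > 0"
  shows "integrable lborel (\<lambda>x. psi l k x * cnj (psi l j x)) \<and>
    (LINT x|lborel. psi l k x * cnj (psi l j x)) = (if k = j then of_real (pi / (2 * l)) else 0)"
proof -
  have ge: "integrable lborel (\<lambda>x. psi l k x * cnj (psi l j x)) \<and>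
    (LINT x|lborel. psi l k x * cnj (psi l j x)) = (if k = j then of_real (pi / (2 * l)) else 0)"
    if "j \<le> k" for j k
  proof (cases "k = j")
    case True
    have "(\<lambda>x. psi l k x * cnj (psi l j x)) = (\<lambda>x. of_real (1 / weight l x))"
      using psi_mult_cnj_psi[OF assms that] True by auto
    moreover have "integrable lborel (\<lambda>x. complex_of_real (1 / weight l x))"
      using integrable_inverse_weight[OF assms] by (rule integrable_of_real)
    moreover have "(LINT x|lborel. complex_of_real (1 / weight l x)) = of_real (pi / (2 * l))"
      using integral_inverse_weight[OF assms] by (simp only: integral_complex_of_real)
    ultimately show ?thesis using True by simp
  next
    case False
    then have "0 < k - j" using that by simp
    then show ?thesis
      unfolding psi_mult_cnj_psi[OF assms that]
      using integrable_unimod_pow[OF assms] integral_unimod_pow[OF assms] False by simp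
  qed
  show ?thesis
  proof (cases "j \<le> k")
    case True then show ?thesis by (rule ge)
  next
    case False
    then have "k \<le> j" by simp
    have e: "(\<lambda>x. psi l k x * cnj (psi l j x)) = (\<lambda>x. cnj (psi l j x * cnj (psi l k x)))"
      by (simp add: mult.commute)
    show ?thesis
      unfolding e complex_integrable_cnj Bochner_Integration.integral_cnj
      using ge[OF \<open>k \<le> j\<close>] False by auto
  qed
qed

lemma mtc_mult_mtc:
  assumes "l > 0"
  shows "mtc l i x * mtc l j x = 2 * l / pi *
    Re (phase i * phase j * (psi l (i div 2) x * psi l (j div 2) x)
      + phase i * cnj (phase j) * (psi l (i div 2) x * cnj (psi l (j div 2) x)))"
proof -
  have "Re a * Re b = Re (a * b + a * cnj b) / 2" for a b by simp
  then have "mtc l i x * mtc l j x = (2 * sqrt (l / pi))\<^sup>2 *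
     (Re (phase i * psi l (i div 2) x * (phase j * psi l (j div 2) x)
       + phase i * psi l (i div 2) x * cnj (phase j * psi l (j div 2) x)) / 2)"
    by (simp only: mtc_eq_psi power2_eq_square) (simp only: mult.assoc mult.left_commute)
  also have "(2 * sqrt (l / pi))\<^sup>2 = 4 * l / pi"
    using assms by (simp add: power_mult_distrib)
  finally have "mtc l i x * mtc l j x = 4 * l / pi *
     (Re (phase i * psi l (i div 2) x * (phase j * psi l (j div 2) x)
       + phase i * psi l (i div 2) x * cnj (phase j * psi l (j div 2) x)) / 2)" .
  moreover have "4 * l / pi * (r / 2) = 2 * l / pi * r" for r by simp
  ultimately show ?thesis by (simp only: complex_cnj_mult mult.assoc mult.left_commute)
qed

lemma Re_mult_real: "Re (z * complex_of_real r) = Re z * r"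
  by simp

lemma phase_orthogonal:
  "i div 2 = j div 2 \<Longrightarrow> Re (phase i * cnj (phase j)) = (if i = j then 1 else 0)"
proof -
  assume "i div 2 = j div 2"
  then have "i = j \<longleftrightarrow> (even i \<longleftrightarrow> even j)"
    by (metis even_iff_mod_2_eq_zero mod_div_mult_eq not_mod_2_eq_0_eq_1)
  then show ?thesis by (auto simp: phase_def)
qed

text \<open>Writing real parts as means of a number and its conjugate leaves integrals of powers of
  \<open>unimod\<close> against the weight; only the power zero survives, and it occurs exactly when the two
  functions belong to the same pair.\<close>

lemma mtc_orthonormal:
  assumes "l > 0"
  shows "integrable lborel (\<lambda>x. mtc l i x * mtc l j x)"
    and "L2_inner (mtc l i) (mtc l j) = (if i = j then 1 else 0)"
proof -
  let ?k = "i div 2" and ?m = "j div 2"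
  let ?f = "\<lambda>x. phase i * phase j * (psi l ?k x * psi l ?m x)
      + phase i * cnj (phase j) * (psi l ?k x * cnj (psi l ?m x))"
  note i1 = psi_psi_integral[OF assms, of ?k ?m]
  note i2 = psi_cnj_psi_integral[OF assms, of ?k ?m, THEN conjunct1]
    psi_cnj_psi_integral[OF assms, of ?k ?m, THEN conjunct2]
  have f: "integrable lborel ?f"
    using i1(1) i2(1) by (intro Bochner_Integration.integrable_add integrable_mult_right)
  have fi: "(LINT x|lborel. ?f x) = phase i * cnj (phase j) * (if ?k = ?m then of_real (pi / (2 * l)) else 0)"
    by (subst Bochner_Integration.integral_add)
       (use i1 i2 in \<open>auto intro!: integrable_mult_right\<close>)
  show "integrable lborel (\<lambda>x. mtc l i x * mtc l j x)"
    unfolding mtc_mult_mtc[OF assms] by (intro integrable_mult_right integrable_Re f)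
  have "L2_inner (mtc l i) (mtc l j) = 2 * l / pi * Re (LINT x|lborel. ?f x)"
    unfolding L2_inner_def mtc_mult_mtc[OF assms] integral_mult_right_zero integral_Re[OF f] ..
  also have "\<dots> = (if i = j then 1 else 0)"
  proof (cases "?k = ?m")
    case True
    then have "Re (LINT x|lborel. ?f x) = Re (phase i * cnj (phase j)) * (pi / (2 * l))"
      unfolding fi if_P[OF True] by (simp only: Re_mult_real)
    then show ?thesis using phase_orthogonal[OF True] assms by simp
  next
    case False
    then have "i \<noteq> j" by auto
    with False fi show ?thesis by simp
  qed
  finally show "L2_inner (mtc l i) (mtc l j) = (if i = j then 1 else 0)" .
qed

section \<open>The Hilbert transform\<close>

lemma outside_ball_split: "{y. r < \<bar>y - x\<bar>} = {..<x - r} \<union> {x + r<..}" if "r > 0" for r x :: real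
  using that by auto

text \<open>The complement of the excluded interval exhausts the line, so for an absolutely integrable
  function the principal value is the integral.\<close>

lemma tendsto_integral_outside_ball:
  fixes g :: "real \<Rightarrow> 'a::{banach, second_countable_topology}"
  assumes "integrable lborel g"
  shows "((\<lambda>r. LINT y:{y. r < \<bar>y - x\<bar>}|lborel. g y) \<longlongrightarrow> (LINT y|lborel. g y)) (at_right 0)"
  unfolding set_lebesgue_integral_def
proof (rule tendsto_at_right_sequentially[where b = 1])
  fix S :: "nat \<Rightarrow> real"
  assume S: "\<And>n. 0 < S n" "\<And>n. S n < 1" "decseq S" "S \<longlonglongrightarrow> 0"
  show "(\<lambda>n. LINT y|lborel. indicat_real {y. S n < \<bar>y - x\<bar>} y *\<^sub>R g y) \<longlonglongrightarrow> (LINT y|lborel. g y)"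
  proof (rule integral_dominated_convergence[where w = "\<lambda>y. norm (g y)"])
    show "g \<in> borel_measurable lborel" using assms by (rule borel_measurable_integrable)
    then show "(\<lambda>y. indicat_real {y. S n < \<bar>y - x\<bar>} y *\<^sub>R g y) \<in> borel_measurable lborel" for n
      by measurable
    show "integrable lborel (\<lambda>y. norm (g y))" using assms by (rule integrable_norm)
    show "AE y in lborel. norm (indicat_real {y. S n < \<bar>y - x\<bar>} y *\<^sub>R g y) \<le> norm (g y)" for n
      by (simp add: indicator_def)
    have "AE y in lborel. y \<noteq> x"
      using AE_lborel_singleton by auto
    then show "AE y in lborel. (\<lambda>n. indicat_real {y. S n < \<bar>y - x\<bar>} y *\<^sub>R g y) \<longlonglongrightarrow> g y"
    proof eventually_elim
      fix y assume "y \<noteq> x"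
      then have "\<forall>\<^sub>F n in sequentially. S n < \<bar>y - x\<bar>"
        using order_tendstoD(2)[OF S(4), of "\<bar>y - x\<bar>"] by simp
      then have "\<forall>\<^sub>F n in sequentially. indicat_real {y. S n < \<bar>y - x\<bar>} y *\<^sub>R g y = g y"
        by eventually_elim simp
      then show "(\<lambda>n. indicat_real {y. S n < \<bar>y - x\<bar>} y *\<^sub>R g y) \<longlonglongrightarrow> g y"
        by (rule tendsto_eventually)
    qed
  qed
qed simp

text \<open>Away from the singularity \<open>1 / \<bar>y - x\<bar>\<close> decays like \<open>1 / \<bar>lower\<bar>\<close>, so that the quotient is
  bounded by the inverse weight.\<close>

lemma psi_quotient_integrable:
  assumes "l > 0" "r > 0"
  shows "set_integrable lborel {y. r < \<bar>y - x\<bar>} (\<lambda>y. psi l k y / of_real (y - x))"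
  unfolding set_integrable_def
proof (rule Bochner_Integration.integrable_bound)
  let ?K = "2 + cmod (lower l x) / r"
  show "integrable lborel (\<lambda>y. ?K * (1 / weight l y))"
    by (rule integrable_mult_right[OF integrable_inverse_weight[OF assms(1)]])
  have "psi l k \<in> borel_measurable lborel"
    using borel_measurable_continuous_onI[OF continuous_on_psi[OF assms(1)]] by simp
  then show "(\<lambda>y. indicat_real {y. r < \<bar>y - x\<bar>} y *\<^sub>R (psi l k y / of_real (y - x))) \<in> borel_measurable lborel"
    by measurable
  show "AE y in lborel. norm (indicat_real {y. r < \<bar>y - x\<bar>} y *\<^sub>R (psi l k y / of_real (y - x)))
     \<le> norm (?K * (1 / weight l y))"
  proof (rule AE_I2)
    fix y
    show "norm (indicat_real {y. r < \<bar>y - x\<bar>} y *\<^sub>R (psi l k y / of_real (y - x)))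
     \<le> norm (?K * (1 / weight l y))"
    proof (cases "r < \<bar>y - x\<bar>")
      case True
      have K: "0 \<le> ?K" using assms(2) by simp
      have w: "0 < weight l y" by (rule weight_pos[OF assms(1)])
      have "lower l y = 2 * of_real (y - x) + lower l x"
        by (simp add: lower_def complex_eq_iff)
      then have "cmod (lower l y) \<le> 2 * \<bar>y - x\<bar> + cmod (lower l x)"
        by (metis norm_mult norm_numeral norm_of_real norm_triangle_ineq)
      also have "\<dots> \<le> ?K * \<bar>y - x\<bar>"
      proof -
        have "r * cmod (lower l x) \<le> \<bar>y - x\<bar> * cmod (lower l x)"
          using True by (intro mult_right_mono) auto
        then have "cmod (lower l x) \<le> cmod (lower l x) / r * \<bar>y - x\<bar>"
          using assms(2) by (simp add: pos_le_divide_eq mult.commute)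
        then show ?thesis by (simp only: distrib_right)
      qed
      finally have b: "cmod (lower l y) \<le> ?K * \<bar>y - x\<bar>" .
      have "cmod (psi l k y) = 1 / cmod (lower l y)"
        by (simp add: psi_def norm_divide norm_power unimod_norm[OF assms(1)])
      also have "\<dots> = cmod (lower l y) / weight l y"
        using lower_nonzero[OF assms(1), of y] by (simp add: power2_eq_square flip: lower_norm_sq)
      also have "\<dots> \<le> (?K * \<bar>y - x\<bar>) / weight l y"
        using b w by (intro divide_right_mono) auto
      finally have "cmod (psi l k y) / \<bar>y - x\<bar> \<le> ?K * (1 / weight l y)"
        using True assms(2) by (simp add: pos_divide_le_eq)
      then show ?thesis
        using True K w by (simp add: norm_divide del: of_real_diff)
    qed simp
  qed
qed

lemma ln_abs_diff_derivative:
  fixes x y :: real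
  assumes "y \<noteq> x"
  shows "((\<lambda>y. ln \<bar>y - x\<bar>) has_real_derivative 1 / (y - x)) (at y within S)"
proof -
  have "((\<lambda>y. ln \<bar>y - x\<bar>) has_real_derivative 1 / (y - x)) (at y)"
  proof (cases "y > x")
    case True
    have "((\<lambda>y. ln (y - x)) has_real_derivative 1 / (y - x)) (at y)"
      using True by (auto intro!: derivative_eq_intros)
    moreover have "\<forall>\<^sub>F z in nhds y. z > x" using True by (rule eventually_nhds_in_open[of "{x<..}", simplified])
    then have "\<forall>\<^sub>F z in nhds y. ln (z - x) = ln \<bar>z - x\<bar>" by eventually_elim simp
    ultimately show ?thesis by (subst (asm) DERIV_cong_ev[OF refl _ refl])
  next
    case False
    then have "y < x" using assms by simp
    have "((\<lambda>y. ln (x - y)) has_real_derivative 1 / (y - x)) (at y)"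
      using \<open>y < x\<close> by (auto intro!: derivative_eq_intros simp: divide_simps)
    moreover have "\<forall>\<^sub>F z in nhds y. z < x" using \<open>y < x\<close> by (rule eventually_nhds_in_open[of "{..<x}", simplified])
    then have "\<forall>\<^sub>F z in nhds y. ln (x - z) = ln \<bar>z - x\<bar>" by eventually_elim simp
    ultimately show ?thesis by (subst (asm) DERIV_cong_ev[OF refl _ refl])
  qed
  then show ?thesis by (rule has_field_derivative_at_within)
qed

text \<open>A primitive of \<open>psi l 0 y / (y - x)\<close> in \<open>y\<close>, found by partial fractions: a multiple of the complex
  logarithm of the quotient of \<open>y - x\<close> and \<open>lower l y\<close>, written with real functions to avoid branch cuts.\<close>

definition psi_log :: "real \<Rightarrow> real \<Rightarrow> real \<Rightarrow> complex" where
  "psi_log l x y = (1 / lower l x) *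
     (of_real (ln \<bar>y - x\<bar> - ln (weight l y) / 2) - \<i> * of_real (arctan (2 * y / l)))"

lemma psi_log_vector_derivative:
  assumes "l > 0" "y \<noteq> x"
  shows "(psi_log l x has_vector_derivative psi l 0 y / of_real (y - x)) (at y)"
proof -
  have w: "0 < weight l y" by (rule weight_pos[OF assms(1)])
  have d1: "((\<lambda>y. ln \<bar>y - x\<bar>) has_real_derivative 1 / (y - x)) (at y)"
    by (rule ln_abs_diff_derivative[OF assms(2)])
  have d2: "((\<lambda>y. ln (weight l y) / 2) has_real_derivative 4 * y / weight l y) (at y)"
  proof -
    have "(weight l has_real_derivative 8 * y) (at y)"
      unfolding weight_def[abs_def] by (auto intro!: derivative_eq_intros)
    then show ?thesis using w by (auto intro!: derivative_eq_intros simp: divide_simps)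
  qed
  have d3: "((\<lambda>y. arctan (2 * y / l)) has_real_derivative 2 * l / weight l y) (at y)"
  proof -
    have "1 + (2 * y / l)\<^sup>2 = weight l y / l\<^sup>2"
      using assms(1) by (simp add: weight_def power_divide power_mult_distrib add_divide_distrib)
    then have "inverse (1 + (2 * y / l)\<^sup>2) * (2 / l) = 2 * l / weight l y"
      using assms(1) by (simp add: power2_eq_square)
    then show ?thesis
      using assms(1) by (auto intro!: derivative_eq_intros simp: mult.commute)
  qed
  have d: "(psi_log l x has_vector_derivative (1 / lower l x) *
     (of_real (1 / (y - x) - 4 * y / weight l y) - \<i> * of_real (2 * l / weight l y))) (at y)"
    unfolding psi_log_def[abs_def]
    by (intro has_vector_derivative_mult_right has_vector_derivative_diff has_vector_derivative_of_real
         DERIV_diff d1 d2 d3)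
  have "of_real (1 / (y - x) - 4 * y / weight l y) - \<i> * of_real (2 * l / weight l y)
      = 1 / of_real (y - x) - 2 / lower l y"
  proof -
    have "2 / lower l y = 2 * cnj (lower l y) / of_real (weight l y)"
      using lower_nonzero[OF assms(1), of y] by (simp flip: lower_mult_cnj)
    also have "2 * cnj (lower l y) = of_real (4 * y) + \<i> * of_real (2 * l)"
      by (simp add: lower_def complex_eq_iff)
    finally show ?thesis by (simp add: add_divide_distrib)
  qed
  also have "(1 / lower l x) * \<dots> = psi l 0 y / of_real (y - x)"
  proof -
    have "lower l y - 2 * of_real (y - x) = lower l x"
      by (simp add: lower_def complex_eq_iff)
    moreover have "complex_of_real (y - x) \<noteq> 0" using assms(2) by simp
    ultimately show ?thesis
      using lower_nonzero[OF assms(1), of y] lower_nonzero[OF assms(1), of x]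
      by (simp add: psi_def divide_simps del: of_real_diff)
  qed
  finally show ?thesis using d by simp
qed

lemma psi_log_limits:
  assumes "l > 0"
  shows "(psi_log l x \<longlongrightarrow> (1 / lower l x) * (of_real (- ln 2) - \<i> * of_real (pi / 2))) at_top"
    and "(psi_log l x \<longlongrightarrow> (1 / lower l x) * (of_real (- ln 2) - \<i> * of_real (- pi / 2))) at_bot"
proof -
  have ln2: "ln (2::real) = ln 4 / 2"
    using ln_realpow[of "2::real" 2] by simp
  have 1: "((\<lambda>y. ln \<bar>y - x\<bar> - ln (weight l y) / 2) \<longlongrightarrow> - ln 2) at_top"
    unfolding weight_def ln2 by real_asymp
  have 2: "((\<lambda>y. ln \<bar>y - x\<bar> - ln (weight l y) / 2) \<longlongrightarrow> - ln 2) at_bot"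
    unfolding weight_def ln2 by real_asymp
  have 3: "((\<lambda>y. arctan (2 * y / l)) \<longlongrightarrow> pi / 2) at_top"
    using assms by real_asymp
  have 4: "((\<lambda>y. arctan (2 * y / l)) \<longlongrightarrow> - pi / 2) at_bot"
    using assms by real_asymp
  show "(psi_log l x \<longlongrightarrow> (1 / lower l x) * (of_real (- ln 2) - \<i> * of_real (pi / 2))) at_top"
    unfolding psi_log_def[abs_def] by (intro tendsto_intros tendsto_of_real 1 3)
  show "(psi_log l x \<longlongrightarrow> (1 / lower l x) * (of_real (- ln 2) - \<i> * of_real (- pi / 2))) at_bot"
    unfolding psi_log_def[abs_def] by (intro tendsto_intros tendsto_of_real 2 4)
qed

text \<open>The logarithmic singularity of the primitive is even about \<open>x\<close> and cancels between the two sides.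
  What is left is the jump of the argument between the two ends of the line.\<close>

lemma psi_zero_principal_value:
  assumes "l > 0"
  shows "((\<lambda>r. LINT y:{y. r < \<bar>y - x\<bar>}|lborel. psi l 0 y / of_real (y - x))
     \<longlongrightarrow> - \<i> * pi * psi l 0 x) (at_right 0)"
proof -
  let ?A = "(1 / lower l x) * (of_real (- ln 2) - \<i> * of_real (- pi / 2))"
  let ?B = "(1 / lower l x) * (of_real (- ln 2) - \<i> * of_real (pi / 2))"
  let ?f = "\<lambda>y. psi l 0 y / of_real (y - x)"
  let ?g = "\<lambda>y. (1 / lower l x) * (of_real (ln (weight l y) / 2) + \<i> * of_real (arctan (2 * y / l)))"
  have c: "isCont ?f y" if "y \<noteq> x" for y
    using that continuous_on_psi[OF assms, of UNIV 0]
    by (intro continuous_intros) (auto simp: continuous_on_eq_continuous_at)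
  have cl: "isCont (psi_log l x) y" if "y \<noteq> x" for y
    using psi_log_vector_derivative[OF assms that] has_vector_derivative_continuous by blast
  have eq: "(LINT y:{y. r < \<bar>y - x\<bar>}|lborel. ?f y) = ?B - ?A + (?g (x + r) - ?g (x - r))"
    if r: "r > 0" for r
  proof -
    have i: "set_integrable lborel {x + r<..} ?f" "set_integrable lborel {..<x - r} ?f"
      by (rule set_integrable_subset[OF psi_quotient_integrable[OF assms r, of x 0]]; use r in force)+
    have "(LINT y:{y. r < \<bar>y - x\<bar>}|lborel. ?f y)
        = (LINT y:{..<x - r}|lborel. ?f y) + (LINT y:{x + r<..}|lborel. ?f y)"
      unfolding outside_ball_split[OF r] by (rule set_integral_Un[OF _ i(2) i(1)]) (use r in auto)
    also have "(LINT y:{..<x - r}|lborel. ?f y) = psi_log l x (x - r) - ?A"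
      by (rule has_integral_below_FTC[OF _ _ i(2) _ psi_log_limits(2)[OF assms]])
         (use r in \<open>auto intro!: psi_log_vector_derivative[OF assms] c cl simp del: of_real_diff\<close>)
    also have "(LINT y:{x + r<..}|lborel. ?f y) = ?B - psi_log l x (x + r)"
      by (rule has_integral_above_FTC[OF _ _ i(1) _ psi_log_limits(1)[OF assms]])
         (use r in \<open>auto intro!: psi_log_vector_derivative[OF assms] c cl simp del: of_real_diff\<close>)
    finally show ?thesis
      using r by (simp add: psi_log_def algebra_simps)
  qed
  have "isCont ?g x"
    using weight_pos[OF assms, of x] assms unfolding weight_def
    by (intro continuous_intros) auto
  then have "((\<lambda>r. ?g (x + r)) \<longlongrightarrow> ?g x) (at_right 0)" "((\<lambda>r. ?g (x - r)) \<longlongrightarrow> ?g x) (at_right 0)"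
    by (rule isCont_tendsto_compose; auto intro!: tendsto_eq_intros)+
  then have "((\<lambda>r. ?B - ?A + (?g (x + r) - ?g (x - r))) \<longlongrightarrow> ?B - ?A + (?g x - ?g x)) (at_right 0)"
    by (intro tendsto_add tendsto_diff tendsto_const)
  moreover have "?B - ?A + (?g x - ?g x) = - \<i> * pi * psi l 0 x"
  proof -
    have "?B - ?A = (1 / lower l x) * (- \<i> * pi)"
      by (simp only: right_diff_distrib[symmetric]) simp
    then show ?thesis by (simp add: psi_def)
  qed
  ultimately have "((\<lambda>r. ?B - ?A + (?g (x + r) - ?g (x - r))) \<longlongrightarrow> - \<i> * pi * psi l 0 x) (at_right 0)"
    by simp
  then show ?thesis
    by (rule Lim_transform_eventually)
       (use eq in \<open>auto simp: eventually_at_filter intro!: always_eventually\<close>)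
qed

text \<open>Passing from \<open>psi l k\<close> to \<open>psi l (k + 1)\<close> adds a multiple of \<open>psi l k\<close> over its own
  denominator. Dividing by \<open>y - x\<close> and splitting into partial fractions leaves the previous
  case and an absolutely integrable function of integral zero.\<close>

lemma psi_principal_value:
  assumes "l > 0"
  shows "((\<lambda>r. LINT y:{y. r < \<bar>y - x\<bar>}|lborel. psi l k y / of_real (y - x))
     \<longlongrightarrow> - \<i> * pi * psi l k x) (at_right 0)"
proof (induction k)
  case 0
  show ?case by (rule psi_zero_principal_value[OF assms])
next
  case (Suc k)
  let ?q = "\<lambda>y. unimod l y ^ Suc k / of_real (weight l y)"
  let ?I = "\<lambda>k r. LINT y:{y. r < \<bar>y - x\<bar>}|lborel. psi l k y / of_real (y - x)"
  let ?c = "4 * \<i> * l / lower l x"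
  have step: "psi l (Suc k) y / of_real (y - x) = unimod l x * (psi l k y / of_real (y - x)) - ?c * ?q y"
    if "y \<noteq> x" for y
  proof -
    let ?b = "lower l y" and ?a = "lower l x" and ?L = "complex_of_real l"
    have nz: "?b \<noteq> 0" "?a \<noteq> 0" using lower_nonzero[OF assms] by auto
    have d: "complex_of_real (y - x) = (?b - ?a) / 2" by (simp add: lower_def complex_eq_iff)
    have ne: "?b \<noteq> ?a" using that by (simp add: lower_def)
    have "?q y = unimod l y ^ k * (unimod l y / of_real (weight l y))" by simp
    also have "unimod l y / of_real (weight l y) = 1 / ?b\<^sup>2"
      using nz by (simp add: unimod_cnj power2_eq_square flip: lower_mult_cnj)
    finally have q: "?q y = unimod l y ^ k / ?b\<^sup>2" by simp
    have "psi l (Suc k) y / of_real (y - x) = unimod l y ^ k * (2 * unimod l y / (?b * (?b - ?a)))"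
      unfolding d psi_def by simp
    also have "2 * unimod l y / (?b * (?b - ?a)) = unimod l x * (2 / (?b * (?b - ?a))) - ?c / ?b\<^sup>2"
      using nz ne unfolding unimod_eq[OF assms]
      by (simp add: divide_simps power2_eq_square) (simp add: algebra_simps)
    finally show ?thesis
      unfolding q d psi_def by (simp add: algebra_simps)
  qed
  have eq: "?I (Suc k) r = unimod l x * ?I k r - ?c * (LINT y:{y. r < \<bar>y - x\<bar>}|lborel. ?q y)"
    if r: "r > 0" for r
  proof -
    let ?S = "{y. r < \<bar>y - x\<bar>}"
    have S: "?S \<in> sets lborel" by measurable
    have iq: "set_integrable lborel ?S ?q"
      using integrable_unimod_pow[OF assms, of "Suc k"] S
      by (simp add: set_integrable_def integrable_mult_indicator)
    have "?I (Suc k) r = (LINT y:?S|lborel. unimod l x * (psi l k y / of_real (y - x)) - ?c * ?q y)"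
      by (rule set_lebesgue_integral_cong[OF S]) (use step r in auto)
    also have "\<dots> = (LINT y:?S|lborel. unimod l x * (psi l k y / of_real (y - x)))
        - (LINT y:?S|lborel. ?c * ?q y)"
      by (rule set_integral_diff(2))
         (intro set_integrable_mult_right psi_quotient_integrable[OF assms r] iq impI)+
    finally show ?thesis by (simp only: set_integral_mult_right)
  qed
  have "((\<lambda>r. unimod l x * ?I k r - ?c * (LINT y:{y. r < \<bar>y - x\<bar>}|lborel. ?q y))
     \<longlongrightarrow> unimod l x * (- \<i> * pi * psi l k x) - ?c * (LINT y|lborel. ?q y)) (at_right 0)"
    by (intro tendsto_diff tendsto_mult tendsto_const Suc.IH
        tendsto_integral_outside_ball[OF integrable_unimod_pow[OF assms]])
  moreover have "unimod l x * (- \<i> * pi * psi l k x) - ?c * (LINT y|lborel. ?q y)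
      = - \<i> * pi * psi l (Suc k) x"
    using integral_unimod_pow[OF assms, of "Suc k"] by (simp add: psi_def)
  ultimately have "((\<lambda>r. unimod l x * ?I k r - ?c * (LINT y:{y. r < \<bar>y - x\<bar>}|lborel. ?q y))
     \<longlongrightarrow> - \<i> * pi * psi l (Suc k) x) (at_right 0)"
    by simp
  then show ?case
    by (rule Lim_transform_eventually)
       (use eq in \<open>auto simp: eventually_at_filter intro!: always_eventually\<close>)
qed

lemma hilbertI:
  assumes "((\<lambda>r. (1 / pi) * (LINT y:{y. r < \<bar>y - x\<bar>}|lborel. f y / (y - x))) \<longlongrightarrow> v) (at_right 0)"
  shows "hilbert f x = v"
  unfolding hilbert_def by (rule tendsto_Lim[OF _ assms]) simp

lemma hilbert_mtc:
  assumes "l > 0"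
  shows "hilbert (mtc l j) x = (if even j then - mtc l (j + 1) x else mtc l (j - 1) x)"
proof (rule hilbertI)
  let ?A = "2 * sqrt (l / pi)" and ?k = "j div 2"
  let ?I = "\<lambda>r. LINT y:{y. r < \<bar>y - x\<bar>}|lborel. psi l ?k y / of_real (y - x)"
  have eq: "(LINT y:{y. r < \<bar>y - x\<bar>}|lborel. mtc l j y / (y - x)) = ?A * Re (phase j * ?I r)"
    if r: "r > 0" for r
  proof -
    let ?S = "{y. r < \<bar>y - x\<bar>}"
    let ?h = "\<lambda>y. indicat_real ?S y *\<^sub>R (psi l ?k y / of_real (y - x))"
    have i: "integrable lborel ?h"
      using psi_quotient_integrable[OF assms r] by (simp add: set_integrable_def)
    have "(LINT y:?S|lborel. mtc l j y / (y - x)) = (LINT y|lborel. ?A * Re (phase j * ?h y))"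
      unfolding set_lebesgue_integral_def
    proof (intro Bochner_Integration.integral_cong refl)
      fix y
      have "phase j * ?h y = of_real (indicat_real ?S y / (y - x)) * (phase j * psi l ?k y)"
        by (simp add: scaleR_conv_of_real)
      then have "Re (phase j * ?h y) = indicat_real ?S y / (y - x) * Re (phase j * psi l ?k y)"
        by (simp only: Re_complex_of_real Im_complex_of_real times_complex.simps)
      then show "indicat_real ?S y *\<^sub>R (mtc l j y / (y - x)) = ?A * Re (phase j * ?h y)"
        by (simp add: mtc_eq_psi)
    qed
    also have "\<dots> = ?A * Re (phase j * (LINT y|lborel. ?h y))"
      using i by (simp only: integral_mult_right_zero integral_Re integrable_mult_right)
    finally show ?thesis by (simp add: set_lebesgue_integral_def)
  qed
  have "((\<lambda>r. (1 / pi) * (?A * Re (phase j * ?I r)))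
     \<longlongrightarrow> (1 / pi) * (?A * Re (phase j * (- \<i> * pi * psi l ?k x)))) (at_right 0)"
    by (intro tendsto_intros psi_principal_value[OF assms])
  moreover have "(1 / pi) * (?A * Re (phase j * (- \<i> * pi * psi l ?k x)))
      = (if even j then - mtc l (j + 1) x else mtc l (j - 1) x)"
  proof (cases "even j")
    case True
    then show ?thesis by (simp add: mtc_eq_psi phase_def)
  next
    case False
    then obtain m where "j = 2 * m + 1" by (elim oddE)
    then show ?thesis by (simp add: mtc_eq_psi phase_def)
  qed
  ultimately have "((\<lambda>r. (1 / pi) * (?A * Re (phase j * ?I r)))
     \<longlongrightarrow> (if even j then - mtc l (j + 1) x else mtc l (j - 1) x)) (at_right 0)"
    by simp
  then show "((\<lambda>r. (1 / pi) * (LINT y:{y. r < \<bar>y - x\<bar>}|lborel. mtc l j y / (y - x)))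
     \<longlongrightarrow> (if even j then - mtc l (j + 1) x else mtc l (j - 1) x)) (at_right 0)"
    by (rule Lim_transform_eventually)
       (use eq in \<open>auto simp: eventually_at_filter intro!: always_eventually\<close>)
qed

definition far_kernel :: "real \<Rightarrow> real \<Rightarrow> real" where
  "far_kernel x y = indicat_real {y. 1 < \<bar>y - x\<bar>} y / (y - x)"

definition near_kernel :: "real \<Rightarrow> real \<Rightarrow> real" where
  "near_kernel x y = indicat_real {y. \<bar>y - x\<bar> < 1} y * ln \<bar>y - x\<bar>"

lemma far_kernel_L2: "L2_fun lborel (far_kernel x)"
  unfolding L2_fun_def
proof
  show m: "far_kernel x \<in> borel_measurable lborel"
    unfolding far_kernel_def[abs_def] by measurable
  have "integrable lborel (\<lambda>y. 1 / weight 1 (- x + 1 * y))"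
    by (rule lborel_integrable_real_affine[OF integrable_inverse_weight]) auto
  then have "integrable lborel (\<lambda>y. 5 * (1 / weight 1 (- x + 1 * y)))"
    by (rule integrable_mult_right)
  then show "integrable lborel (\<lambda>y. (far_kernel x y)\<^sup>2)"
  proof (rule Bochner_Integration.integrable_bound)
    show "(\<lambda>y. (far_kernel x y)\<^sup>2) \<in> borel_measurable lborel" by (rule borel_measurable_power[OF m])
    show "AE y in lborel. norm ((far_kernel x y)\<^sup>2) \<le> norm (5 * (1 / weight 1 (- x + 1 * y)))"
    proof (rule AE_I2)
      fix y
      show "norm ((far_kernel x y)\<^sup>2) \<le> norm (5 * (1 / weight 1 (- x + 1 * y)))"
      proof (cases "1 < \<bar>y - x\<bar>")
        case True
        then have "1 \<le> (y - x)\<^sup>2" by (metis abs_square_le_1 less_imp_le linorder_not_le nle_le)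
        then have "4 * (y - x)\<^sup>2 + 1\<^sup>2 \<le> 5 * (y - x)\<^sup>2" by simp
        moreover have "weight 1 (- x + 1 * y) = 4 * (y - x)\<^sup>2 + 1\<^sup>2"
          by (simp add: weight_def power2_commute)
        moreover have "0 < weight 1 (- x + 1 * y)" by (rule weight_pos) simp
        ultimately have "1 / (y - x)\<^sup>2 \<le> 5 * (1 / weight 1 (- x + 1 * y))"
          using \<open>1 \<le> (y - x)\<^sup>2\<close> by (simp add: divide_simps)
        then show ?thesis using True \<open>0 < weight 1 (- x + 1 * y)\<close> by (simp add: far_kernel_def power_divide)
      qed (simp add: far_kernel_def)
    qed
  qed
qed

lemma integrable_ln_square: "set_integrable lborel {0<..<1} (\<lambda>s::real. (ln s)\<^sup>2)"
proof -
  have e: "einterval 0 1 = {0<..<1::real}"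
    using einterval_eq(1)[of 0 1] by (simp add: zero_ereal_def one_ereal_def)
  have "set_integrable lborel (einterval 0 1) (\<lambda>s::real. (ln s)\<^sup>2)"
  proof (rule interval_integral_FTC_nonneg(1)[where F = "\<lambda>s. s * (ln s)\<^sup>2 - 2 * s * ln s + 2 * s"])
    show "((\<lambda>s. s * (ln s)\<^sup>2 - 2 * s * ln s + 2 * s) has_real_derivative (ln s)\<^sup>2) (at s)"
      if "0 < ereal s" for s
      using that by (auto intro!: derivative_eq_intros simp: field_simps power2_eq_square)
    show "isCont (\<lambda>s. (ln s)\<^sup>2) s" if "0 < ereal s" for s
      using that by (intro continuous_intros) auto
    have "((\<lambda>s::real. s * (ln s)\<^sup>2 - 2 * s * ln s + 2 * s) \<longlongrightarrow> 0) (at_right 0)" by real_asymp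
    then show "(((\<lambda>s::real. s * (ln s)\<^sup>2 - 2 * s * ln s + 2 * s) \<circ> real_of_ereal) \<longlongrightarrow> 0) (at_right 0)"
      by (simp add: ereal_tendsto_simps zero_ereal_def)
    have "((\<lambda>s::real. s * (ln s)\<^sup>2 - 2 * s * ln s + 2 * s) \<longlongrightarrow> 2) (at_left 1)" by real_asymp
    then show "(((\<lambda>s::real. s * (ln s)\<^sup>2 - 2 * s * ln s + 2 * s) \<circ> real_of_ereal) \<longlongrightarrow> 2) (at_left 1)"
      by (simp add: ereal_tendsto_simps one_ereal_def)
  qed auto
  then show ?thesis by (simp add: e)
qed

text \<open>The square of the logarithm is integrable at the singularity, which is why the representation
  below works in \<open>L\<^sup>2\<close>.\<close>

lemma near_kernel_L2: "L2_fun lborel (near_kernel x)"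
  unfolding L2_fun_def
proof
  show m: "near_kernel x \<in> borel_measurable lborel"
    unfolding near_kernel_def[abs_def] by measurable
  let ?h = "\<lambda>s. indicat_real {0<..<1} s * (ln s)\<^sup>2"
  have h: "integrable lborel ?h" using integrable_ln_square by (simp add: set_integrable_def)
  have "integrable lborel (\<lambda>y. ?h (- x + 1 * y) + ?h (x + (- 1) * y))"
    by (intro Bochner_Integration.integrable_add lborel_integrable_real_affine h) auto
  moreover have "(\<lambda>y. ?h (- x + 1 * y) + ?h (x + (- 1) * y)) = (\<lambda>y. (near_kernel x y)\<^sup>2)"
  proof
    fix y
    consider "y = x" | "y > x" | "y < x" by linarith
    then show "?h (- x + 1 * y) + ?h (x + (- 1) * y) = (near_kernel x y)\<^sup>2"
      by cases (auto simp: near_kernel_def indicator_def)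
  qed
  ultimately show "integrable lborel (\<lambda>y. (near_kernel x y)\<^sup>2)" by simp
qed

text \<open>Integrating by parts against the logarithm turns the principal value into two absolutely
  convergent pairings. As functionals of \<open>f\<close> and \<open>f'\<close> they are bounded on \<open>L\<^sup>2\<close>, so that
  the Hilbert transform at a point can be differentiated with respect to a parameter.\<close>

lemma hilbert_L2_representation:
  assumes D: "\<And>y. (f has_real_derivative f' y) (at y)" and c: "continuous_on UNIV f'"
    and f: "L2_fun lborel f" and f': "L2_fun lborel f'"
  shows "hilbert f x = (1 / pi) * (L2_inner f (far_kernel x) - L2_inner f' (near_kernel x))"
proof (rule hilbertI)
  let ?g = "\<lambda>y. f' y * ln \<bar>y - x\<bar> + f y * (1 / (y - x))"
  have cf: "continuous_on S f" for S
    using D by (meson DERIV_isCont continuous_at_imp_continuous_on)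
  have Dg: "((\<lambda>y. f y * ln \<bar>y - x\<bar>) has_real_derivative ?g y) (at y within S)" if "y \<noteq> x" for y S
    using DERIV_mult[OF has_field_derivative_at_within[OF D] ln_abs_diff_derivative[OF that]]
    by (simp add: add.commute mult.commute)
  have Dgv: "((\<lambda>y. f y * ln \<bar>y - x\<bar>) has_vector_derivative ?g y) (at y within S)" if "y \<noteq> x" for y S
    unfolding has_real_derivative_iff_has_vector_derivative[symmetric] by (rule Dg[OF that])
  have cg: "continuous_on S ?g" if "x \<notin> S" for S
    using that by (intro continuous_intros cf continuous_on_subset[OF c]) auto
  have iff: "integrable lborel (\<lambda>y. f y * far_kernel x y)" by (rule L2_integrable_mult[OF f far_kernel_L2])
  have ifn: "integrable lborel (\<lambda>y. f' y * near_kernel x y)" by (rule L2_integrable_mult[OF f' near_kernel_L2])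
  have eq: "(LINT y:{y. r < \<bar>y - x\<bar>}|lborel. f y / (y - x))
     = L2_inner f (far_kernel x) + (f (x - r) - f (x + r)) * ln r
       - (LINT y:{y. r < \<bar>y - x\<bar>}|lborel. f' y * near_kernel x y)" if r: "0 < r" "r < 1" for r
  proof -
    let ?L = "{x - 1..x - r}" and ?R = "{x + r..x + 1}"
    have L: "has_bochner_integral lborel (\<lambda>y. indicat_real ?L y *\<^sub>R ?g y)
        (f (x - r) * ln \<bar>x - r - x\<bar> - f (x - 1) * ln \<bar>x - 1 - x\<bar>)"
      by (rule has_bochner_integral_FTC_Icc[OF _ Dgv cg]) (use r in auto)
    have R: "has_bochner_integral lborel (\<lambda>y. indicat_real ?R y *\<^sub>R ?g y)
        (f (x + 1) * ln \<bar>x + 1 - x\<bar> - f (x + r) * ln \<bar>x + r - x\<bar>)"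
      by (rule has_bochner_integral_FTC_Icc[OF _ Dgv cg]) (use r in auto)
    have N: "integrable lborel (\<lambda>y. indicat_real {y. r < \<bar>y - x\<bar>} y *\<^sub>R (f' y * near_kernel x y))"
      by (rule integrable_mult_indicator[OF _ ifn]) simp
    have "AE y in lborel. y \<notin> {x - 1, x + 1, x - r, x + r}"
      by (rule AE_not_in) (auto intro: countable_imp_null_set_lborel)
    then have "AE y in lborel. indicat_real {y. r < \<bar>y - x\<bar>} y *\<^sub>R (f y / (y - x))
       = f y * far_kernel x y + indicat_real ?L y *\<^sub>R ?g y + indicat_real ?R y *\<^sub>R ?g y
         - indicat_real {y. r < \<bar>y - x\<bar>} y *\<^sub>R (f' y * near_kernel x y)"
    proof eventually_elim
      fix y assume y: "y \<notin> {x - 1, x + 1, x - r, x + r}"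
      consider "y < x - 1" | "x - 1 < y" "y < x - r" | "x - r < y" "y < x + r" | "x + r < y" "y < x + 1" | "x + 1 < y"
        using y by fastforce
      then show "indicat_real {y. r < \<bar>y - x\<bar>} y *\<^sub>R (f y / (y - x))
       = f y * far_kernel x y + indicat_real ?L y *\<^sub>R ?g y + indicat_real ?R y *\<^sub>R ?g y
         - indicat_real {y. r < \<bar>y - x\<bar>} y *\<^sub>R (f' y * near_kernel x y)"
        by cases (use r in \<open>auto simp: far_kernel_def near_kernel_def indicator_def abs_if\<close>)
    qed
    then have "(LINT y:{y. r < \<bar>y - x\<bar>}|lborel. f y / (y - x)) = (LINT y|lborel.
         f y * far_kernel x y + indicat_real ?L y *\<^sub>R ?g y + indicat_real ?R y *\<^sub>R ?g y
         - indicat_real {y. r < \<bar>y - x\<bar>} y *\<^sub>R (f' y * near_kernel x y))"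
      unfolding set_lebesgue_integral_def
    proof (rule integral_cong_AE[rotated 2])
      show "(\<lambda>y. indicat_real {y. r < \<bar>y - x\<bar>} y *\<^sub>R (f y / (y - x))) \<in> borel_measurable lborel"
        using L2_funD(1)[OF f] by measurable
      show "(\<lambda>y. f y * far_kernel x y + indicat_real ?L y *\<^sub>R ?g y + indicat_real ?R y *\<^sub>R ?g y
         - indicat_real {y. r < \<bar>y - x\<bar>} y *\<^sub>R (f' y * near_kernel x y)) \<in> borel_measurable lborel"
        using L2_funD(1)[OF f] L2_funD(1)[OF f'] L2_funD(1)[OF far_kernel_L2] L2_funD(1)[OF near_kernel_L2]
        by measurable
    qed
    also have "\<dots> = (LINT y|lborel. f y * far_kernel x y)
        + (f (x - r) * ln \<bar>x - r - x\<bar> - f (x - 1) * ln \<bar>x - 1 - x\<bar>)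
        + (f (x + 1) * ln \<bar>x + 1 - x\<bar> - f (x + r) * ln \<bar>x + r - x\<bar>)
        - (LINT y|lborel. indicat_real {y. r < \<bar>y - x\<bar>} y *\<^sub>R (f' y * near_kernel x y))"
      by (rule has_bochner_integral_integral_eq)
         (intro has_bochner_integral_diff has_bochner_integral_add L R
            has_bochner_integral_integrable[OF iff] has_bochner_integral_integrable[OF N])
    finally show ?thesis
      using r by (simp add: L2_inner_def set_lebesgue_integral_def algebra_simps)
  qed
  have lim1: "((\<lambda>r. (f (x - r) - f (x + r)) * ln r) \<longlongrightarrow> 0) (at_right 0)"
  proof -
    have D0: "((\<lambda>r. f (x - r) - f (x + r)) has_real_derivative - 2 * f' x) (at 0)"
    proof -
      have "((\<lambda>r. f (x - r)) has_real_derivative f' (x - 0) * (- 1)) (at 0)"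
        by (rule DERIV_chain2[OF D]) (auto intro!: derivative_eq_intros)
      moreover have "((\<lambda>r. f (x + r)) has_real_derivative f' (x + 0) * 1) (at 0)"
        by (rule DERIV_chain2[OF D]) (auto intro!: derivative_eq_intros)
      ultimately show ?thesis using DERIV_diff by fastforce
    qed
    then have "((\<lambda>r. (f (x - r) - f (x + r)) / r) \<longlongrightarrow> - 2 * f' x) (at_right 0)"
      by (auto simp: has_field_derivative_iff intro: filterlim_at_split[THEN iffD1, THEN conjunct2])
    moreover have "((\<lambda>r::real. r * ln r) \<longlongrightarrow> 0) (at_right 0)" by real_asymp
    ultimately have "((\<lambda>r. (f (x - r) - f (x + r)) / r * (r * ln r)) \<longlongrightarrow> - 2 * f' x * 0) (at_right 0)"
      by (rule tendsto_mult)
    then have "((\<lambda>r. (f (x - r) - f (x + r)) / r * (r * ln r)) \<longlongrightarrow> 0) (at_right 0)" by simp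
    then show ?thesis
      by (rule Lim_transform_eventually) (auto simp: eventually_at_filter intro!: always_eventually)
  qed
  have "((\<lambda>r. (1 / pi) * (L2_inner f (far_kernel x) + (f (x - r) - f (x + r)) * ln r
       - (LINT y:{y. r < \<bar>y - x\<bar>}|lborel. f' y * near_kernel x y)))
     \<longlongrightarrow> (1 / pi) * (L2_inner f (far_kernel x) + 0 - (LINT y|lborel. f' y * near_kernel x y))) (at_right 0)"
    by (intro tendsto_diff tendsto_mult tendsto_add tendsto_const lim1 tendsto_integral_outside_ball ifn)
  then have l: "((\<lambda>r. (1 / pi) * (L2_inner f (far_kernel x) + (f (x - r) - f (x + r)) * ln r
       - (LINT y:{y. r < \<bar>y - x\<bar>}|lborel. f' y * near_kernel x y)))
     \<longlongrightarrow> (1 / pi) * (L2_inner f (far_kernel x) - L2_inner f' (near_kernel x))) (at_right 0)"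
    by (simp add: L2_inner_def)
  have "\<forall>\<^sub>F r in at_right 0. (r::real) < 1" "\<forall>\<^sub>F r in at_right 0. (0::real) < r"
    by (auto simp: eventually_at_right_less intro!: eventually_at_rightI[of 0 1])
  then have ev: "\<forall>\<^sub>F r in at_right 0. (1 / pi) * (L2_inner f (far_kernel x) + (f (x - r) - f (x + r)) * ln r
       - (LINT y:{y. r < \<bar>y - x\<bar>}|lborel. f' y * near_kernel x y))
     = (1 / pi) * (LINT y:{y. r < \<bar>y - x\<bar>}|lborel. f y / (y - x))"
    by eventually_elim (simp only: eq)
  show "((\<lambda>r. (1 / pi) * (LINT y:{y. r < \<bar>y - x\<bar>}|lborel. f y / (y - x)))
     \<longlongrightarrow> (1 / pi) * (L2_inner f (far_kernel x) - L2_inner f' (near_kernel x))) (at_right 0)"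
    by (rule Lim_transform_eventually[OF l ev])
qed

section \<open>Integration over a time slab\<close>

lemma slab_set: "{0..T} \<times> UNIV \<in> sets (borel :: (real \<times> real) measure)"
  by (intro borel_closed closed_Times) auto

lemma slab_integrable_iff:
  fixes f :: "real \<times> real \<Rightarrow> real"
  shows "integrable (slab T) f \<longleftrightarrow>
    integrable (lborel \<Otimes>\<^sub>M lborel) (\<lambda>z. indicat_real ({0..T} \<times> UNIV) z *\<^sub>R f z)"
  unfolding slab_def lborel_prod
  by (rule integrable_restrict_space) (simp add: slab_set)

lemma slab_integral_eq:
  fixes f :: "real \<times> real \<Rightarrow> real"
  shows "integral\<^sup>L (slab T) f =
    integral\<^sup>L (lborel \<Otimes>\<^sub>M lborel) (\<lambda>z. indicat_real ({0..T} \<times> UNIV) z *\<^sub>R f z)"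
  unfolding slab_def lborel_prod
  by (rule integral_restrict_space) (simp add: slab_set)

lemma slab_measurable_iff:
  fixes f :: "real \<times> real \<Rightarrow> real"
  shows "f \<in> borel_measurable (slab T) \<longleftrightarrow>
    (\<lambda>z. indicat_real ({0..T} \<times> UNIV) z *\<^sub>R f z) \<in> borel_measurable (lborel \<Otimes>\<^sub>M lborel)"
  unfolding slab_def lborel_prod
  by (rule borel_measurable_restrict_space_iff) (simp add: slab_set)

lemma slab_measurable_section:
  fixes f :: "real \<Rightarrow> real \<Rightarrow> real"
  assumes "(\<lambda>(t, x). f t x) \<in> borel_measurable (slab T)" "t \<in> {0..T}"
  shows "f t \<in> borel_measurable lborel"
proof -
  have "(\<lambda>x. indicat_real ({0..T} \<times> UNIV) (t, x) *\<^sub>R f t x) \<in> borel_measurable lborel"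
    using measurable_Pair2[OF assms(1)[unfolded slab_measurable_iff], of t] by simp
  then show ?thesis using assms(2) by simp
qed

lemma slab_measurable_time_section:
  fixes f :: "real \<Rightarrow> real \<Rightarrow> real"
  assumes "(\<lambda>(t, x). f t x) \<in> borel_measurable (slab T)"
  shows "(\<lambda>t. indicat_real {0..T} t * f t x) \<in> borel_measurable lborel"
  using measurable_Pair1[OF assms[unfolded slab_measurable_iff], of x]
  by (simp add: indicator_times)

lemma slab_integrable_sections:
  fixes f :: "real \<Rightarrow> real \<Rightarrow> real"
  assumes "integrable (slab T) (\<lambda>(t, x). f t x)"
  shows "AE x in lborel. integrable lborel (\<lambda>t. indicat_real {0..T} t * f t x)"
    and "AE t in lborel. t \<in> {0..T} \<longrightarrow> integrable lborel (f t)"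
    and "integrable lborel (\<lambda>x. LINT t|lborel. indicat_real {0..T} t * f t x)"
    and "(LINT x|lborel. (LINT t|lborel. indicat_real {0..T} t * f t x)) = integral\<^sup>L (slab T) (\<lambda>(t, x). f t x)"
    and "integrable lborel (\<lambda>t. indicat_real {0..T} t * (LINT x|lborel. f t x))"
    and "(LINT t|lborel. indicat_real {0..T} t * (LINT x|lborel. f t x)) = integral\<^sup>L (slab T) (\<lambda>(t, x). f t x)"
proof -
  let ?g = "\<lambda>t x. indicat_real {0..T} t * f t x"
  have g: "integrable (lborel \<Otimes>\<^sub>M lborel) (case_prod ?g)"
    using assms unfolding slab_integrable_iff
    by (rule back_subst[of "integrable (lborel \<Otimes>\<^sub>M lborel)"]) (auto simp: indicator_times)
  have v: "integral\<^sup>L (slab T) (\<lambda>(t, x). f t x) = integral\<^sup>L (lborel \<Otimes>\<^sub>M lborel) (case_prod ?g)"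
    unfolding slab_integral_eq
    by (rule arg_cong[where f = "integral\<^sup>L (lborel \<Otimes>\<^sub>M lborel)"]) (auto simp: indicator_times)
  show "AE x in lborel. integrable lborel (\<lambda>t. ?g t x)"
    by (rule lborel_pair.AE_integrable_snd[OF g])
  have "AE t in lborel. integrable lborel (\<lambda>x. ?g t x)"
    by (rule lborel_pair.AE_integrable_fst[OF g])
  then show "AE t in lborel. t \<in> {0..T} \<longrightarrow> integrable lborel (f t)"
    by eventually_elim auto
  show "integrable lborel (\<lambda>x. LINT t|lborel. ?g t x)"
    by (rule lborel_pair.integrable_snd[OF g])
  show "(LINT x|lborel. (LINT t|lborel. ?g t x)) = integral\<^sup>L (slab T) (\<lambda>(t, x). f t x)"
    unfolding v by (rule lborel_pair.integral_snd[OF g])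
  have e: "(LINT x|lborel. ?g t x) = indicat_real {0..T} t * (LINT x|lborel. f t x)" for t
    by (rule integral_mult_right_zero)
  show "integrable lborel (\<lambda>t. indicat_real {0..T} t * (LINT x|lborel. f t x))"
    using lborel_pair.integrable_fst[OF g] unfolding e .
  show "(LINT t|lborel. indicat_real {0..T} t * (LINT x|lborel. f t x)) = integral\<^sup>L (slab T) (\<lambda>(t, x). f t x)"
    using lborel_pair.integral_fst[OF g] unfolding e v .
qed

text \<open>The gauge integral of a derivative that exists everywhere is the increment, and on a Lebesgue
  integrable derivative the two integrals agree.\<close>

lemma integral_derivative_eq:
  fixes g g' :: "real \<Rightarrow> real"
  assumes "a \<le> b" "{a..b} \<subseteq> S"
    and D: "\<And>t. t \<in> S \<Longrightarrow> (g has_real_derivative g' t) (at t within S)"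
    and i: "integrable lborel (\<lambda>t. indicat_real S t * g' t)" "S \<in> sets lborel"
  shows "(LINT t:{a..b}|lborel. g' t) = g b - g a"
proof -
  have "(g' has_integral (g b - g a)) {a..b}"
  proof (rule fundamental_theorem_of_calculus[OF assms(1)])
    fix t assume "t \<in> {a..b}"
    then have "(g has_real_derivative g' t) (at t within {a..b})"
      using D assms(2) by (blast intro: has_field_derivative_subset)
    then show "(g has_vector_derivative g' t) (at t within {a..b})"
      by (simp add: has_real_derivative_iff_has_vector_derivative)
  qed
  moreover have "set_integrable lborel {a..b} g'"
  proof (rule set_integrable_subset)
    show "set_integrable lborel S g'" using i(1) by (simp add: set_integrable_def)
  qed (use assms(2) in auto)
  ultimately show ?thesis
    using set_borel_integral_eq_integral(2) by (metis integral_unique)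
qed

lemma slab_integrable_restrict:
  fixes f :: "real \<Rightarrow> real \<Rightarrow> real"
  assumes "integrable (slab T) (\<lambda>(t, x). f t x)" "T' \<le> T"
  shows "integrable (slab T') (\<lambda>(t, x). f t x)"
proof -
  have "integrable (lborel \<Otimes>\<^sub>M lborel) (\<lambda>z. indicat_real ({0..T'} \<times> UNIV) z *\<^sub>R
      (indicat_real ({0..T} \<times> UNIV) z *\<^sub>R (case z of (t, x) \<Rightarrow> f t x)))"
    by (rule integrable_mult_indicator[OF _ assms(1)[unfolded slab_integrable_iff]])
       (auto simp: lborel_prod)
  then show ?thesis
    unfolding slab_integrable_iff
    by (rule back_subst[of "integrable (lborel \<Otimes>\<^sub>M lborel)"])
       (use assms(2) in \<open>auto simp: indicator_def\<close>)
qed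

text \<open>Pointwise in \<open>x\<close> this is the fundamental theorem of calculus, and Fubini exchanges the two
  integrals. It replaces differentiation under the integral sign where no time-uniform dominating
  function for the derivative is known.\<close>

lemma slab_FTC:
  fixes f f' :: "real \<Rightarrow> real \<Rightarrow> real"
  assumes b: "b \<in> {0..T}"
    and D: "\<And>t x. t \<in> {0..T} \<Longrightarrow> ((\<lambda>s. f s x) has_real_derivative f' t x) (at t within {0..T})"
    and I: "integrable (slab T) (\<lambda>(t, x). f' t x)"
    and i: "integrable lborel (f 0)" "integrable lborel (f b)"
  shows "(LINT x|lborel. f b x) - (LINT x|lborel. f 0 x) = (LINT t:{0..b}|lborel. (LINT x|lborel. f' t x))"
proof -
  have Ib: "integrable (slab b) (\<lambda>(t, x). f' t x)"
    using slab_integrable_restrict[OF I] b by simp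
  have "AE x in lborel. f b x - f 0 x = (LINT t|lborel. indicat_real {0..b} t * f' t x)"
    using slab_integrable_sections(1)[OF I]
  proof eventually_elim
    fix x assume "integrable lborel (\<lambda>t. indicat_real {0..T} t * f' t x)"
    then have "(LINT t:{0..b}|lborel. f' t x) = f b x - f 0 x"
      using b by (intro integral_derivative_eq[where S = "{0..T}" and g = "\<lambda>s. f s x"] D) auto
    then show "f b x - f 0 x = (LINT t|lborel. indicat_real {0..b} t * f' t x)"
      by (simp add: set_lebesgue_integral_def)
  qed
  then have "(LINT x|lborel. f b x - f 0 x) = (LINT x|lborel. (LINT t|lborel. indicat_real {0..b} t * f' t x))"
    by (rule integral_cong_AE[rotated 2])
       (use i slab_integrable_sections(3)[OF Ib] in \<open>auto intro: borel_measurable_integrable\<close>)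
  also have "\<dots> = (LINT t|lborel. indicat_real {0..b} t * (LINT x|lborel. f' t x))"
    using slab_integrable_sections(4,6)[OF Ib] by simp
  finally show ?thesis using i by (simp add: set_lebesgue_integral_def)
qed

text \<open>A one-dimensional Sobolev inequality in time, uniform in space: at every time the function
  is below a fixed square-integrable envelope, whose norm is controlled by the slab norms.\<close>

lemma slab_envelope:
  fixes f f' :: "real \<Rightarrow> real \<Rightarrow> real"
  assumes T: "T > 0"
    and D: "\<And>t x. t \<in> {0..T} \<Longrightarrow> ((\<lambda>s. f s x) has_real_derivative f' t x) (at t within {0..T})"
    and f: "L2_fun (slab T) (\<lambda>(t, x). f t x)" and f': "L2_fun (slab T) (\<lambda>(t, x). f' t x)"
  obtains M where "L2_fun lborel M" "AE x in lborel. \<forall>t\<in>{0..T}. \<bar>f t x\<bar> \<le> M x"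
    "(L2_norm lborel M)\<^sup>2 \<le> 2 / T * (L2_norm (slab T) (\<lambda>(t, x). f t x))\<^sup>2
       + 2 * T * (L2_norm (slab T) (\<lambda>(t, x). f' t x))\<^sup>2"
proof -
  have sq: "(\<lambda>(t, x). (f t x)\<^sup>2) = (\<lambda>z. ((\<lambda>(t, x). f t x) z)\<^sup>2)"
    "(\<lambda>(t, x). (f' t x)\<^sup>2) = (\<lambda>z. ((\<lambda>(t, x). f' t x) z)\<^sup>2)" by auto
  have I: "integrable (slab T) (\<lambda>(t, x). (f t x)\<^sup>2)" "integrable (slab T) (\<lambda>(t, x). (f' t x)\<^sup>2)"
    unfolding sq by (rule L2_funD(2)[OF f], rule L2_funD(2)[OF f'])
  let ?A = "\<lambda>x. LINT t|lborel. indicat_real {0..T} t * (f t x)\<^sup>2"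
  let ?B = "\<lambda>x. LINT t|lborel. indicat_real {0..T} t * (f' t x)\<^sup>2"
  let ?M = "\<lambda>x. sqrt (2 / T * ?A x + 2 * T * ?B x)"
  have nn: "0 \<le> ?A x" "0 \<le> ?B x" for x by (auto intro!: integral_nonneg_AE)
  have M2: "(?M x)\<^sup>2 = 2 / T * ?A x + 2 * T * ?B x" for x
    using nn[of x] T by simp
  note iA = slab_integrable_sections(3)[OF I(1)] and iB = slab_integrable_sections(3)[OF I(2)]
  have L2M: "L2_fun lborel ?M"
    unfolding L2_fun_def M2
    using iA iB borel_measurable_integrable[OF iA] borel_measurable_integrable[OF iB]
    by (intro conjI Bochner_Integration.integrable_add integrable_mult_right
          borel_measurable_sqrt[THEN measurable_compose_rev] borel_measurable_add borel_measurable_times borel_measurable_const)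
  have "(L2_norm lborel ?M)\<^sup>2 = 2 / T * (LINT x|lborel. ?A x) + 2 * T * (LINT x|lborel. ?B x)"
    unfolding L2_norm_sq M2 using iA iB
    by (subst Bochner_Integration.integral_add) (auto intro!: integrable_mult_right)
  also have "(LINT x|lborel. ?A x) = (L2_norm (slab T) (\<lambda>(t, x). f t x))\<^sup>2"
    unfolding slab_integrable_sections(4)[OF I(1)] L2_norm_sq sq ..
  also have "(LINT x|lborel. ?B x) = (L2_norm (slab T) (\<lambda>(t, x). f' t x))\<^sup>2"
    unfolding slab_integrable_sections(4)[OF I(2)] L2_norm_sq sq ..
  finally have bound: "(L2_norm lborel ?M)\<^sup>2 \<le> 2 / T * (L2_norm (slab T) (\<lambda>(t, x). f t x))\<^sup>2
       + 2 * T * (L2_norm (slab T) (\<lambda>(t, x). f' t x))\<^sup>2" by simp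
  have "AE x in lborel. \<forall>t\<in>{0..T}. \<bar>f t x\<bar> \<le> ?M x"
    using slab_integrable_sections(1)[OF I(1)] slab_integrable_sections(1)[OF I(2)]
  proof eventually_elim
    fix x
    assume ix: "integrable lborel (\<lambda>t. indicat_real {0..T} t * (f t x)\<^sup>2)"
      "integrable lborel (\<lambda>t. indicat_real {0..T} t * (f' t x)\<^sup>2)"
    let ?c = "\<lambda>t. indicat_real {0..T} t" and ?g = "\<lambda>t. indicat_real {0..T} t * f' t x"
    have isq: "(?g t)\<^sup>2 = indicat_real {0..T} t * (f' t x)\<^sup>2" "(?c t)\<^sup>2 = ?c t" for t
      by (auto simp: indicator_def)
    have c: "L2_fun lborel ?c"
      unfolding L2_fun_def isq by (auto simp: integrable_indicator_iff emeasure_lborel_Icc_eq)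
    have g: "L2_fun lborel ?g"
      unfolding L2_fun_def isq using ix(2) slab_measurable_time_section[OF L2_funD(1)[OF f']] by simp
    have ag: "L2_fun lborel (\<lambda>t. \<bar>?g t\<bar>)"
      using L2_funD[OF g] unfolding L2_fun_def power2_abs by (intro conjI borel_measurable_abs)
    have ig: "integrable lborel ?g"
      using L2_integrable_mult[OF c g] by (simp flip: mult.assoc indicator_inter_arith)
    have nc: "(L2_norm lborel ?c)\<^sup>2 = T" and ng: "(L2_norm lborel (\<lambda>t. \<bar>?g t\<bar>))\<^sup>2 = ?B x"
      unfolding L2_norm_sq power2_abs isq using T by simp_all
    \<comment> \<open>Cauchy-Schwarz in time against the constant function on \<open>[0,T]\<close>.\<close>
    have inc: "(f t x - f s x)\<^sup>2 \<le> T * ?B x" if ts: "t \<in> {0..T}" "s \<in> {0..T}" "s \<le> t" for s t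
    proof -
      have "f t x - f s x = (LINT r:{s..t}|lborel. f' r x)"
        by (rule integral_derivative_eq[where S = "{0..T}" and g = "\<lambda>s. f s x", OF ts(3) _ D ig, symmetric])
           (use ts in auto)
      also have "\<bar>\<dots>\<bar> \<le> (LINT r|lborel. ?c r * \<bar>?g r\<bar>)"
        unfolding set_lebesgue_integral_def
      proof (rule order_trans[OF integral_abs_bound], rule integral_mono)
        show "integrable lborel (\<lambda>r. \<bar>indicat_real {s..t} r *\<^sub>R f' r x\<bar>)"
        proof -
          have "(\<lambda>r. \<bar>indicat_real {s..t} r *\<^sub>R f' r x\<bar>) = (\<lambda>r. indicat_real {s..t} r *\<^sub>R \<bar>?g r\<bar>)"
            using ts by (auto simp: indicator_def)
          then show ?thesis using integrable_mult_indicator[OF _ integrable_abs[OF ig], of "{s..t}"] by simp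
        qed
        show "integrable lborel (\<lambda>r. ?c r * \<bar>?g r\<bar>)" by (rule L2_integrable_mult[OF c ag])
        show "\<bar>indicat_real {s..t} r *\<^sub>R f' r x\<bar> \<le> ?c r * \<bar>?g r\<bar>" for r
          using ts by (auto simp: indicator_def)
      qed
      also have "\<dots> \<le> L2_norm lborel ?c * L2_norm lborel (\<lambda>t. \<bar>?g t\<bar>)"
        using L2_cauchy_schwarz[OF c ag] by linarith
      finally have "\<bar>f t x - f s x\<bar>\<^sup>2 \<le> (L2_norm lborel ?c * L2_norm lborel (\<lambda>t. \<bar>?g t\<bar>))\<^sup>2"
        by (rule power_mono) simp
      then show ?thesis by (simp add: power_mult_distrib nc ng)
    qed
    have inc': "(f t x - f s x)\<^sup>2 \<le> T * ?B x" if ts: "t \<in> {0..T}" "s \<in> {0..T}" for s t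
      using inc[OF ts] inc[OF ts(2,1)] by (cases "s \<le> t") (auto simp: power2_commute)
    show "\<forall>t\<in>{0..T}. \<bar>f t x\<bar> \<le> ?M x"
    proof
      fix t assume t: "t \<in> {0..T}"
      have p: "(f t x)\<^sup>2 \<le> 2 * (f s x)\<^sup>2 + 2 * (T * ?B x)" if "s \<in> {0..T}" for s
      proof -
        have "0 \<le> (2 * f s x - f t x)\<^sup>2" by simp
        then have "(f t x)\<^sup>2 \<le> 2 * (f s x)\<^sup>2 + 2 * (f t x - f s x)\<^sup>2"
          by (simp add: power2_eq_square algebra_simps)
        then show ?thesis using inc'[OF t that] by linarith
      qed
      \<comment> \<open>Averaging the increment bound \<open>p\<close> over the base point \<open>s\<close> removes the dependence on it.\<close>
      have "T * (f t x)\<^sup>2 = (LINT s|lborel. ?c s * (f t x)\<^sup>2)" using T by simp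
      also have "\<dots> \<le> (LINT s|lborel. 2 * (?c s * (f s x)\<^sup>2) + ?c s * (2 * (T * ?B x)))"
      proof (rule integral_mono)
        show "integrable lborel (\<lambda>s. ?c s * (f t x)\<^sup>2)"
          "integrable lborel (\<lambda>s. 2 * (?c s * (f s x)\<^sup>2) + ?c s * (2 * (T * ?B x)))"
          using ix(1) by (auto intro!: integrable_mult_left Bochner_Integration.integrable_add integrable_mult_right
             simp: integrable_indicator_iff emeasure_lborel_Icc_eq)
        show "?c s * (f t x)\<^sup>2 \<le> 2 * (?c s * (f s x)\<^sup>2) + ?c s * (2 * (T * ?B x))" for s
          using p[of s] by (cases "s \<in> {0..T}") auto
      qed
      also have "\<dots> = 2 * ?A x + T * (2 * (T * ?B x))"
        using ix(1) T by (subst Bochner_Integration.integral_add)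
          (auto intro!: integrable_mult_left integrable_mult_right simp: integrable_indicator_iff emeasure_lborel_Icc_eq)
      finally have "(f t x)\<^sup>2 \<le> 2 / T * ?A x + 2 * T * ?B x"
        using T by (simp add: field_simps)
      then have "sqrt ((f t x)\<^sup>2) \<le> ?M x" by (rule real_sqrt_le_mono)
      then show "\<bar>f t x\<bar> \<le> ?M x" by simp
    qed
  qed
  from that[OF L2M this bound] show ?thesis .
qed

section \<open>Continuous and differentiable curves in \<open>L\<^sup>2\<close>\<close>

lemma C_L2D:
  assumes "C_L2 v" "t \<ge> 0"
  shows "L2_fun lborel (v t)"
    "((\<lambda>s. L2_norm lborel (\<lambda>x. v s x - v t x)) \<longlongrightarrow> 0) (at t within {0..})"
  using assms by (auto simp: C_L2_def)

lemma C_L2_norm_continuous: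
  assumes "C_L2 v" shows "continuous_on {0..} (\<lambda>t. L2_norm lborel (v t))"
  unfolding continuous_on_def
proof
  fix t :: real assume "t \<in> {0..}"
  then have t: "t \<ge> 0" by simp
  have "((\<lambda>s. L2_norm lborel (v s) - L2_norm lborel (v t)) \<longlongrightarrow> 0) (at t within {0..})"
  proof (rule Lim_null_comparison[OF _ C_L2D(2)[OF assms t]])
    show "\<forall>\<^sub>F s in at t within {0..}. norm (L2_norm lborel (v s) - L2_norm lborel (v t))
        \<le> L2_norm lborel (\<lambda>x. v s x - v t x)"
      unfolding eventually_at_filter
      using L2_norm_diff_le[OF C_L2D(1)[OF assms] C_L2D(1)[OF assms t]]
      by (intro always_eventually) auto
  qed
  then show "((\<lambda>s. L2_norm lborel (v s)) \<longlongrightarrow> L2_norm lborel (v t)) (at t within {0..})"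
    by (simp add: LIM_zero_iff)
qed

lemma C_L2_pairing_continuous:
  assumes "C_L2 v" "L2_fun lborel \<phi>"
  shows "continuous_on {0..} (\<lambda>t. L2_inner (v t) \<phi>)"
  unfolding continuous_on_def
proof
  fix t :: real assume "t \<in> {0..}"
  then have t: "t \<ge> 0" by simp
  have "((\<lambda>s. L2_norm lborel (\<lambda>x. v s x - v t x) * L2_norm lborel \<phi>) \<longlongrightarrow> 0 * L2_norm lborel \<phi>) (at t within {0..})"
    by (intro tendsto_mult tendsto_const C_L2D(2)[OF assms(1) t])
  then have l: "((\<lambda>s. L2_norm lborel (\<lambda>x. v s x - v t x) * L2_norm lborel \<phi>) \<longlongrightarrow> 0) (at t within {0..})"
    by simp
  have "((\<lambda>s. L2_inner (v s) \<phi> - L2_inner (v t) \<phi>) \<longlongrightarrow> 0) (at t within {0..})"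
  proof (rule Lim_null_comparison[OF _ l])
    show "\<forall>\<^sub>F s in at t within {0..}. norm (L2_inner (v s) \<phi> - L2_inner (v t) \<phi>)
        \<le> L2_norm lborel (\<lambda>x. v s x - v t x) * L2_norm lborel \<phi>"
      unfolding eventually_at_filter
    proof (intro always_eventually allI impI)
      fix s :: real assume "s \<in> {0..}"
      then have s: "s \<ge> 0" by simp
      note v = C_L2D(1)[OF assms(1) s] C_L2D(1)[OF assms(1) t]
      show "norm (L2_inner (v s) \<phi> - L2_inner (v t) \<phi>)
        \<le> L2_norm lborel (\<lambda>x. v s x - v t x) * L2_norm lborel \<phi>"
        using L2_inner_bound[OF L2_fun_diff[OF v] assms(2)] L2_inner_diff_left[OF v assms(2)] by simp
    qed
  qed
  then show "((\<lambda>s. L2_inner (v s) \<phi>) \<longlongrightarrow> L2_inner (v t) \<phi>) (at t within {0..})"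
    by (simp add: LIM_zero_iff)
qed

lemma slab_measurable_continuous:
  assumes "continuous_on ({0..T} \<times> UNIV) (\<lambda>(t, x). v t x :: real)"
  shows "(\<lambda>(t, x). v t x) \<in> borel_measurable (slab T)"
  unfolding slab_def
proof -
  have "(\<lambda>(t, x). v t x) \<in> borel_measurable (restrict_space borel ({0..T} \<times> UNIV))"
    by (rule borel_measurable_continuous_on_restrict[OF assms])
  then show "(\<lambda>(t, x). v t x) \<in> borel_measurable (restrict_space lborel ({0..T} \<times> UNIV))"
    by (rule subst[of "borel_measurable _", rotated]) (auto intro!: measurable_cong_sets sets_restrict_space_cong)
qed

lemma slab_L2I:
  fixes v :: "real \<Rightarrow> real \<Rightarrow> real"
  assumes m: "(\<lambda>(t, x). v t x) \<in> borel_measurable (slab T)"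
    and v: "\<And>t. t \<in> {0..T} \<Longrightarrow> L2_fun lborel (v t)"
    and c: "continuous_on {0..T} (\<lambda>t. L2_norm lborel (v t))"
  shows "L2_fun (slab T) (\<lambda>(t, x). v t x)"
  unfolding L2_fun_def slab_integrable_iff
proof
  show "(\<lambda>(t, x). v t x) \<in> borel_measurable (slab T)" by (rule m)
  let ?h = "\<lambda>z. indicat_real ({0..T} \<times> UNIV) z *\<^sub>R (case z of (t, x) \<Rightarrow> v t x)\<^sup>2"
  have hs: "?h (t, x) = indicat_real {0..T} t * (v t x)\<^sup>2" for t x
    by (simp add: indicator_times)
  have hm: "?h \<in> borel_measurable (lborel \<Otimes>\<^sub>M lborel)"
    using borel_measurable_power[OF m, of 2] unfolding slab_measurable_iff .
  have "continuous_on {0..T} (\<lambda>t. (L2_norm lborel (v t))\<^sup>2)" by (intro continuous_intros c)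
  then have i: "integrable lborel (\<lambda>t. indicat_real {0..T} t *\<^sub>R (L2_norm lborel (v t))\<^sup>2)"
    by (rule borel_integrable_compact[OF compact_Icc])
  show "integrable (lborel \<Otimes>\<^sub>M lborel) ?h"
  proof (rule lborel_pair.Fubini_integrable[OF hm])
    have e: "(\<lambda>t. LINT x|lborel. norm (?h (t, x))) = (\<lambda>t. indicat_real {0..T} t *\<^sub>R (L2_norm lborel (v t))\<^sup>2)"
    proof
      fix t
      have "(\<lambda>x. norm (?h (t, x))) = (\<lambda>x. indicat_real {0..T} t * (v t x)\<^sup>2)"
        unfolding hs by (auto simp: abs_mult)
      then show "(LINT x|lborel. norm (?h (t, x))) = indicat_real {0..T} t *\<^sub>R (L2_norm lborel (v t))\<^sup>2"
        by (simp add: L2_norm_sq)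
    qed
    show "integrable lborel (\<lambda>t. LINT x|lborel. norm (?h (t, x)))" unfolding e by (rule i)
    show "AE t in lborel. integrable lborel (\<lambda>x. ?h (t, x))"
      unfolding hs using L2_funD(2)[OF v] by (intro AE_I2) (auto simp: indicator_def)
  qed
qed

lemma C_L2_slab:
  assumes "C_L2 v"
  shows "L2_fun (slab T) (\<lambda>(t, x). v t x)"
proof (rule slab_L2I)
  have "continuous_on ({0..} \<times> UNIV) (\<lambda>(t, x). v t x)" using assms by (simp add: C_L2_def)
  then have "continuous_on ({0..T} \<times> UNIV) (\<lambda>(t, x). v t x)" by (rule continuous_on_subset) auto
  then show "(\<lambda>(t, x). v t x) \<in> borel_measurable (slab T)" by (rule slab_measurable_continuous)
  show "continuous_on {0..T} (\<lambda>t. L2_norm lborel (v t))"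
    by (rule continuous_on_subset[OF C_L2_norm_continuous[OF assms]]) auto
qed (use C_L2D(1)[OF assms] in auto)

lemma slab_L2_constant:
  assumes "L2_fun lborel \<phi>"
  shows "L2_fun (slab T) (\<lambda>(t, x). \<phi> x)"
proof (rule slab_L2I)
  have "(\<lambda>z. indicat_real ({0..T} \<times> UNIV) z *\<^sub>R (\<phi> (snd z))) \<in> borel_measurable (lborel \<Otimes>\<^sub>M lborel)"
    using L2_funD(1)[OF assms] slab_set[of T]
    by (intro borel_measurable_scaleR borel_measurable_indicator measurable_compose[OF measurable_snd])
       (auto simp: lborel_prod)
  then show "(\<lambda>(t, x). \<phi> x) \<in> borel_measurable (slab T)"
    unfolding slab_measurable_iff by (simp add: case_prod_beta')
qed (use assms in auto)

text \<open>At time zero the derivative is one-sided, as for \<open>dt\<close>.\<close>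

definition time_differentiable :: "(real \<Rightarrow> real \<Rightarrow> real) \<Rightarrow> bool" where
  "time_differentiable v \<longleftrightarrow> (\<forall>t\<ge>0. \<forall>x. (\<lambda>s. v s x) differentiable at t within {0..})"

lemma time_derivative:
  assumes "time_differentiable v" "t \<ge> 0"
  shows "((\<lambda>s. v s x) has_real_derivative dt v t x) (at t within {0..})"
  using assms unfolding time_differentiable_def dt_def has_real_derivative_iff_has_vector_derivative
  by (simp flip: vector_derivative_works)

text \<open>The increments of the pairing are time integrals of the pairing with the derivative, and the
  latter is continuous because the derivative is a continuous curve in \<open>L\<^sup>2\<close>.\<close>

lemma C_L2_pairing_derivative:
  assumes v: "C_L2 v" "time_differentiable v" "C_L2 (dt v)" and \<phi>: "L2_fun lborel \<phi>" and t: "t \<ge> 0"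
  shows "((\<lambda>s. L2_inner (v s) \<phi>) has_real_derivative L2_inner (dt v t) \<phi>) (at t within {0..})"
proof -
  define T where "T = t + 1"
  let ?h = "\<lambda>r. L2_inner (dt v r) \<phi>"
  have ch: "continuous_on {0..T} ?h"
    by (rule continuous_on_subset[OF C_L2_pairing_continuous[OF v(3) \<phi>]]) auto
  have I: "integrable (slab T) (\<lambda>(t, x). dt v t x * \<phi> x)"
    using L2_integrable_mult[OF C_L2_slab[OF v(3)] slab_L2_constant[OF \<phi>], of T]
    by (rule back_subst[of "integrable (slab T)"]) auto
  have eq: "L2_inner (v s) \<phi> = L2_inner (v 0) \<phi> + integral {0..s} ?h" if s: "s \<in> {0..T}" for s
  proof -
    have "(LINT x|lborel. v s x * \<phi> x) - (LINT x|lborel. v 0 x * \<phi> x) = (LINT r:{0..s}|lborel. (LINT x|lborel. dt v r x * \<phi> x))"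
    proof (rule slab_FTC[OF s _ I])
      fix r x assume "r \<in> {0..T}"
      then have "((\<lambda>s. v s x * \<phi> x) has_real_derivative dt v r x * \<phi> x) (at r within {0..})"
        using DERIV_mult[OF time_derivative[OF v(2), of r x] DERIV_const] by simp
      then show "((\<lambda>s. v s x * \<phi> x) has_real_derivative dt v r x * \<phi> x) (at r within {0..T})"
        by (rule has_field_derivative_subset) auto
    qed (use s in \<open>auto intro!: L2_integrable_mult C_L2D(1)[OF v(1)] \<phi>\<close>)
    moreover have "set_integrable lborel {0..s} ?h"
      unfolding set_integrable_def
      by (rule borel_integrable_compact[OF compact_Icc continuous_on_subset[OF ch]]) (use s in auto)
    ultimately show ?thesis
      using set_borel_integral_eq_integral(2)[of "{0..s}" ?h] by (simp add: L2_inner_def)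
  qed
  have "((\<lambda>s. integral {0..s} ?h) has_real_derivative ?h t) (at t within {0..T})"
    unfolding has_real_derivative_iff_has_vector_derivative
    by (rule integral_has_vector_derivative[OF ch]) (use t in \<open>auto simp: T_def\<close>)
  then have "((\<lambda>s. L2_inner (v 0) \<phi> + integral {0..s} ?h) has_real_derivative ?h t) (at t within {0..T})"
    using DERIV_add[OF DERIV_const] by fastforce
  then have "((\<lambda>s. L2_inner (v s) \<phi>) has_real_derivative ?h t) (at t within {0..T})"
  proof (rule has_field_derivative_transform_within[where d = 1])
    show "t \<in> {0..T}" using t by (simp add: T_def)
    show "L2_inner (v 0) \<phi> + integral {0..s} ?h = L2_inner (v s) \<phi>" if "s \<in> {0..T}" for s
      by (rule eq[OF that, symmetric])
  qed simp
  moreover have "at t within {0..T} = at t within {0..}"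
    by (rule at_within_nhd[where S = "{..<T}"]) (auto simp: T_def)
  ultimately show ?thesis by simp
qed

text \<open>An essential bound of a continuous function holds everywhere: an open set of violations inside
  the slab would have positive measure, and the boundary times follow by closure.\<close>

lemma slab_bound:
  fixes f :: "real \<times> real \<Rightarrow> real"
  assumes T: "T > 0" and c: "continuous_on ({0..T} \<times> UNIV) f"
    and b: "Linf_norm (slab T) f < ereal C" and z: "z \<in> {0..T} \<times> UNIV"
  shows "\<bar>f z\<bar> \<le> C"
proof -
  have AE: "AE z in slab T. \<bar>f z\<bar> \<le> C"
    using esssup_AE[of "\<lambda>z. ereal \<bar>f z\<bar>" "slab T"]
  proof eventually_elim
    fix z assume "ereal \<bar>f z\<bar> \<le> esssup (slab T) (\<lambda>z. ereal \<bar>f z\<bar>)"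
    then have "ereal \<bar>f z\<bar> < ereal C" using b unfolding Linf_norm_def by (rule le_less_trans)
    then show "\<bar>f z\<bar> \<le> C" by simp
  qed
  then have "AE z in lborel. z \<in> {0..T} \<times> UNIV \<longrightarrow> \<bar>f z\<bar> \<le> C"
    unfolding slab_def by (subst (asm) AE_restrict_space_iff) (auto simp: slab_set)
  then have AE': "AE z in lebesgue. z \<in> {0..T} \<times> UNIV \<longrightarrow> \<bar>f z\<bar> \<le> C"
    by (rule AE_completion)
  let ?I = "{0<..<T} \<times> (UNIV :: real set)"
  let ?U = "{z \<in> ?I. C < \<bar>f z\<bar>}"
  have oI: "open ?I" by (intro open_Times) auto
  have cI: "continuous_on ?I (\<lambda>z. \<bar>f z\<bar>)"
    by (intro continuous_intros continuous_on_subset[OF c]) auto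
  have "open ?U"
  proof -
    have "open ((\<lambda>z. \<bar>f z\<bar>) -` {C<..} \<inter> ?I)"
      using cI oI by (simp add: continuous_on_open_vimage[OF oI])
    moreover have "(\<lambda>z. \<bar>f z\<bar>) -` {C<..} \<inter> ?I = ?U" by auto
    ultimately show ?thesis by simp
  qed
  moreover have "negligible ?U"
    unfolding negligible_iff_null_sets
  proof (rule AE_iff_null_sets[THEN iffD2])
    show "?U \<in> sets lebesgue" using \<open>open ?U\<close> by (simp add: borel_open)
    show "AE z in lebesgue. z \<notin> ?U" using AE' by eventually_elim auto
  qed
  ultimately have "?U = {}" using open_not_negligible by blast
  have le: "\<bar>f z\<bar> \<le> C" if "z \<in> ?I" for z
  proof (rule ccontr)
    assume "\<not> \<bar>f z\<bar> \<le> C"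
    then have "z \<in> ?U" using that by auto
    then show False using \<open>?U = {}\<close> by blast
  qed
  have cl: "closure ?I = {0..T} \<times> UNIV" using T by (simp add: closure_Times)
  show ?thesis
    by (rule continuous_le_on_closure[where S = ?I and f = "\<lambda>z. \<bar>f z\<bar>"])
       (use le z cl in \<open>auto intro!: continuous_intros c\<close>)
qed

section \<open>The discrete space\<close>

locale mtc_system =
  fixes l :: real
  assumes l_pos: "l > 0"
begin

lemma psi_has_Re_derivative:
  "((\<lambda>x. Re (c * psi l k x)) has_real_derivative
     Re (c * (- (\<i> / l) * ((2 * of_nat k + 1) * psi l k x - of_nat k * psi l (k - 1) x
        - (of_nat k + 1) * psi l (k + 1) x)))) (at x)"
  unfolding has_real_derivative_iff_has_vector_derivative
  by (rule bounded_linear.has_vector_derivative[OF bounded_linear_Re]) (rule has_vector_derivative_mult_right[OF psi_vector_derivative[OF l_pos]])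

lemma Re_of_real_mult: "Re (complex_of_real r * z) = r * Re z"
  by simp

text \<open>On the MTC functions both the derivative and the Hilbert transform exchange the two
  functions of a pair. In complex notation they are multiplication by \<open>- \<i>\<close>, up to a real
  tridiagonal factor for the derivative.\<close>

definition partner :: "nat \<Rightarrow> nat" where
  "partner j = (if even j then j + 1 else j - 1)"

definition psign :: "nat \<Rightarrow> real" where
  "psign j = (if even j then - 1 else 1)"

definition dmtc :: "nat \<Rightarrow> real \<Rightarrow> real" where
  "dmtc j x = psign j / l * ((2 * real (j div 2) + 1) * mtc l (partner j) x
     - real (j div 2) * mtc l (partner j - 2) x - (real (j div 2) + 1) * mtc l (partner j + 2) x)"

lemma partner_partner [simp]: "partner (partner j) = j"
  by (auto simp: partner_def)

lemma psign_partner [simp]: "psign (partner j) = - psign j"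
  by (auto simp: partner_def psign_def)

lemma psign_sq [simp]: "psign j * psign j = 1"
  by (auto simp: psign_def)

lemma partner_less: "partner j < 2 * p \<longleftrightarrow> j < 2 * p"
  by (auto simp: partner_def; presburger)

lemma mtc_has_derivative: "(mtc l j has_real_derivative dmtc j x) (at x)"
proof -
  let ?A = "2 * sqrt (l / pi)" and ?k = "j div 2"
  let ?S = "(2 * of_nat ?k + 1) * psi l ?k x - of_nat ?k * psi l (?k - 1) x - (of_nat ?k + 1) * psi l (?k + 1) x"
  have "((\<lambda>x. ?A * Re (phase j * psi l ?k x)) has_real_derivative
      ?A * Re (phase j * (- (\<i> / l) * ?S))) (at x)"
    by (rule DERIV_cmult[OF psi_has_Re_derivative])
  moreover have "?A * Re (phase j * (- (\<i> / l) * ?S)) = dmtc j x"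
  proof -
    have ph: "phase j * (- \<i>) = of_real (psign j) * phase (partner j)"
      by (auto simp: phase_def psign_def partner_def)
    have "phase j * (- (\<i> / l) * ?S) = of_real (1 / l) * ((phase j * (- \<i>)) * ?S)" by simp
    also have "\<dots> = of_real (psign j / l) * (phase (partner j) * ?S)" unfolding ph by simp
    also have "Re \<dots> = psign j / l * Re (phase (partner j) * ?S)" by (rule Re_of_real_mult)
    also have "Re (phase (partner j) * ?S) = (2 * real ?k + 1) * Re (phase (partner j) * psi l ?k x)
       - real ?k * Re (phase (partner j) * psi l (?k - 1) x)
       - (real ?k + 1) * Re (phase (partner j) * psi l (?k + 1) x)"
    proof -
      have "phase (partner j) * ?S = of_real (2 * real ?k + 1) * (phase (partner j) * psi l ?k x)
       - of_real (real ?k) * (phase (partner j) * psi l (?k - 1) x)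
       - of_real (real ?k + 1) * (phase (partner j) * psi l (?k + 1) x)"
        by (simp add: algebra_simps)
      then show ?thesis by (simp only: minus_complex.sel Re_of_real_mult)
    qed
    finally have r: "Re (phase j * (- (\<i> / l) * ?S)) = psign j / l * \<dots>" .
    have d: "partner j div 2 = ?k" "(partner j + 2) div 2 = ?k + 1" "(partner j - 2) div 2 = ?k - 1"
      "phase (partner j + 2) = phase (partner j)"
      by (auto simp: partner_def phase_def elim!: oddE)
    have z: "real ?k * mtc l (partner j - 2) x = real ?k * (?A * Re (phase (partner j) * psi l (?k - 1) x))"
    proof (cases "?k = 0")
      case False
      then have "phase (partner j - 2) = phase (partner j)"
        by (auto simp: partner_def phase_def)
      then show ?thesis by (simp add: mtc_eq_psi d)
    qed simp
    show ?thesis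
      unfolding r dmtc_def z mtc_eq_psi[of l "partner j"] mtc_eq_psi[of l "partner j + 2"] d
      by (simp add: algebra_simps)
  qed
  ultimately show ?thesis by (simp add: mtc_eq_psi[abs_def])
qed

lemma mtc_continuous: "continuous_on S (mtc l j)"
  using mtc_has_derivative by (meson DERIV_isCont continuous_at_imp_continuous_on)

lemma mtc_L2: "L2_fun lborel (mtc l j)"
  unfolding L2_fun_def power2_eq_square
  using mtc_orthonormal(1)[OF l_pos, of j j] borel_measurable_continuous_onI[OF mtc_continuous] by simp

lemma mtc_tendsto_zero: "(mtc l j \<longlongrightarrow> 0) at_top" "(mtc l j \<longlongrightarrow> 0) at_bot"
proof -
  have "((\<lambda>x. 2 * sqrt (l / pi) * Re (phase j * psi l (j div 2) x)) \<longlongrightarrow> 2 * sqrt (l / pi) * Re (phase j * 0)) at_top"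
    by (intro tendsto_intros psi_tendsto_zero l_pos)
  then show "(mtc l j \<longlongrightarrow> 0) at_top" by (simp add: mtc_eq_psi[abs_def])
  have "((\<lambda>x. 2 * sqrt (l / pi) * Re (phase j * psi l (j div 2) x)) \<longlongrightarrow> 2 * sqrt (l / pi) * Re (phase j * 0)) at_bot"
    by (intro tendsto_intros psi_tendsto_zero l_pos)
  then show "(mtc l j \<longlongrightarrow> 0) at_bot" by (simp add: mtc_eq_psi[abs_def])
qed

definition cf :: "(real \<Rightarrow> real) \<Rightarrow> nat \<Rightarrow> real" where
  "cf f k = L2_inner f (mtc l k)"

lemma mtc_space_L2: "v \<in> mtc_space l n \<Longrightarrow> L2_fun lborel v"
  unfolding mtc_space_def by (auto intro!: L2_fun_sum L2_fun_cmult mtc_L2)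

lemma cf_sum: "cf (\<lambda>x. \<Sum>k\<le>n. c k * mtc l k x) j = (if j \<le> n then c j else 0)"
proof -
  have "cf (\<lambda>x. \<Sum>k\<le>n. c k * mtc l k x) j = (\<Sum>k\<le>n. c k * (if k = j then 1 else 0))"
    unfolding cf_def by (subst L2_inner_sum_left) (auto intro: mtc_L2 simp: mtc_orthonormal(2)[OF l_pos])
  also have "\<dots> = (\<Sum>k\<le>n. if k = j then c k else 0)"
    by (intro sum.cong) auto
  also have "\<dots> = (if j \<le> n then c j else 0)" by (simp add: sum.delta)
  finally show ?thesis .
qed

lemma mtc_space_expand: "v \<in> mtc_space l n \<Longrightarrow> v = (\<lambda>x. \<Sum>k\<le>n. cf v k * mtc l k x)"
  unfolding mtc_space_def using cf_sum[where n = n] by (auto intro!: ext sum.cong)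

lemma cf_zero: "v \<in> mtc_space l n \<Longrightarrow> n < j \<Longrightarrow> cf v j = 0"
  unfolding mtc_space_def by (auto simp: cf_sum)

lemma mtc_space_sumI: "(\<lambda>x. \<Sum>k\<le>n. c k * mtc l k x) \<in> mtc_space l n"
  by (auto simp: mtc_space_def)

lemma mtc_in_space: "j \<le> n \<Longrightarrow> mtc l j \<in> mtc_space l n"
proof -
  assume "j \<le> n"
  have "(\<Sum>k\<le>n. (if k = j then 1 else 0) * mtc l k x) = mtc l j x" for x
  proof -
    have "(\<Sum>k\<le>n. (if k = j then 1 else 0) * mtc l k x) = (\<Sum>k\<le>n. if k = j then mtc l k x else 0)"
      by (intro sum.cong) auto
    then show ?thesis using \<open>j \<le> n\<close> by (simp add: sum.delta)
  qed
  then show ?thesis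
    using mtc_space_sumI[of "\<lambda>k. if k = j then 1 else 0" n] by simp
qed

lemma mtc_space_add:
  assumes "v \<in> mtc_space l n" "w \<in> mtc_space l n"
  shows "(\<lambda>x. v x + w x) \<in> mtc_space l n"
proof -
  obtain c d where "v = (\<lambda>x. \<Sum>k\<le>n. c k * mtc l k x)" "w = (\<lambda>x. \<Sum>k\<le>n. d k * mtc l k x)"
    using assms by (auto simp: mtc_space_def)
  then have "(\<lambda>x. v x + w x) = (\<lambda>x. \<Sum>k\<le>n. (c k + d k) * mtc l k x)"
    by (simp add: sum.distrib distrib_right)
  then show ?thesis by (simp add: mtc_space_sumI)
qed

lemma mtc_space_cmult:
  assumes "v \<in> mtc_space l n" shows "(\<lambda>x. a * v x) \<in> mtc_space l n"
proof -
  obtain c where "v = (\<lambda>x. \<Sum>k\<le>n. c k * mtc l k x)"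
    using assms by (auto simp: mtc_space_def)
  then have "(\<lambda>x. a * v x) = (\<lambda>x. \<Sum>k\<le>n. (a * c k) * mtc l k x)"
    by (simp add: sum_distrib_left mult.assoc)
  then show ?thesis by (simp add: mtc_space_sumI)
qed

lemma mtc_space_zero: "(\<lambda>x. 0) \<in> mtc_space l n"
  using mtc_space_sumI[of "\<lambda>_. 0" n] by simp

lemma mtc_space_sum: "(\<And>i. i \<in> I \<Longrightarrow> f i \<in> mtc_space l n) \<Longrightarrow> (\<lambda>x. \<Sum>i\<in>I. f i x) \<in> mtc_space l n"
  by (induction I rule: infinite_finite_induct) (auto intro: mtc_space_zero mtc_space_add)

lemma mtc_space_minus: "v \<in> mtc_space l n \<Longrightarrow> (\<lambda>x. - v x) \<in> mtc_space l n"
  using mtc_space_cmult[of v n "- 1"] by simp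

lemma mtc_space_diff:
  "v \<in> mtc_space l n \<Longrightarrow> w \<in> mtc_space l n \<Longrightarrow> (\<lambda>x. v x - w x) \<in> mtc_space l n"
  using mtc_space_add[OF _ mtc_space_minus, of v n w] by simp

lemma parseval:
  assumes "L2_fun lborel f" "w \<in> mtc_space l n"
  shows "L2_inner f w = (\<Sum>k\<le>n. cf f k * cf w k)"
proof -
  have "L2_inner w f = (\<Sum>k\<le>n. cf w k * L2_inner (mtc l k) f)"
    by (subst mtc_space_expand[OF assms(2)], rule L2_inner_sum_left) (auto intro: mtc_L2 assms)
  then show ?thesis
    unfolding L2_inner_commute[of f w]
    by (simp add: cf_def mult.commute L2_inner_commute[of f])
qed

lemma mtc_space_eqI:
  assumes "v \<in> mtc_space l n" "w \<in> mtc_space l n" "\<And>k. k \<le> n \<Longrightarrow> cf v k = cf w k"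
  shows "v = w"
  by (subst mtc_space_expand[OF assms(1)], subst mtc_space_expand[OF assms(2)])
     (auto intro!: ext sum.cong simp: assms(3))

lemma cf_add: "L2_fun lborel f \<Longrightarrow> L2_fun lborel g \<Longrightarrow> cf (\<lambda>x. f x + g x) k = cf f k + cf g k"
  by (simp add: cf_def L2_inner_add_left mtc_L2)

lemma cf_diff: "L2_fun lborel f \<Longrightarrow> L2_fun lborel g \<Longrightarrow> cf (\<lambda>x. f x - g x) k = cf f k - cf g k"
  by (simp add: cf_def L2_inner_diff_left mtc_L2)

lemma cf_cmult: "cf (\<lambda>x. a * f x) k = a * cf f k"
  by (simp add: cf_def L2_inner_cmult_left)

lemma proj_eq:
  assumes "L2_fun lborel f"
  shows "proj l n f = (\<lambda>x. \<Sum>k\<le>n. cf f k * mtc l k x)"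
  unfolding proj_def
proof (rule the_equality)
  let ?g = "\<lambda>x. \<Sum>k\<le>n. cf f k * mtc l k x"
  have g: "?g \<in> mtc_space l n" by (rule mtc_space_sumI)
  show "?g \<in> mtc_space l n \<and> (\<forall>v\<in>mtc_space l n. L2_inner (\<lambda>x. f x - ?g x) v = 0)"
  proof (intro conjI ballI g)
    fix v assume v: "v \<in> mtc_space l n"
    show "L2_inner (\<lambda>x. f x - ?g x) v = 0"
      using parseval[OF assms v] parseval[OF mtc_space_L2[OF g] v]
        L2_inner_diff_left[OF assms mtc_space_L2[OF g] mtc_space_L2[OF v]]
      by (simp add: cf_sum)
  qed
  fix h assume h: "h \<in> mtc_space l n \<and> (\<forall>v\<in>mtc_space l n. L2_inner (\<lambda>x. f x - h x) v = 0)"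
  show "h = ?g"
  proof (rule mtc_space_eqI[OF _ g])
    fix k assume "k \<le> n"
    then have "cf (\<lambda>x. f x - h x) k = 0" using h mtc_in_space by (auto simp: cf_def)
    moreover have "L2_fun lborel h" using h mtc_space_L2 by blast
    ultimately show "cf h k = cf ?g k"
      using assms \<open>k \<le> n\<close> by (simp add: cf_diff cf_sum)
  qed (use h in auto)
qed

lemma proj_in_space: "L2_fun lborel f \<Longrightarrow> proj l n f \<in> mtc_space l n"
  by (simp add: proj_eq mtc_space_sumI)

lemma cf_proj: "L2_fun lborel f \<Longrightarrow> k \<le> n \<Longrightarrow> cf (proj l n f) k = cf f k"
  by (simp add: proj_eq cf_sum)

lemma proj_id: "v \<in> mtc_space l n \<Longrightarrow> proj l n v = v"
  using proj_eq[OF mtc_space_L2] mtc_space_expand by metis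

lemma dmtc_in_space: "j < 2 * q \<Longrightarrow> dmtc j \<in> mtc_space l (2 * q + 1)"
proof -
  assume "j < 2 * q"
  then have p: "partner j < 2 * q" by (simp add: partner_less)
  have "(\<lambda>x. psign j / l * (((2 * real (j div 2) + 1) * mtc l (partner j) x
     - real (j div 2) * mtc l (partner j - 2) x) - (real (j div 2) + 1) * mtc l (partner j + 2) x))
     \<in> mtc_space l (2 * q + 1)"
    by (intro mtc_space_cmult mtc_space_diff mtc_in_space) (use p in auto)
  then show ?thesis by (simp add: dmtc_def[abs_def])
qed

lemma dmtc_L2: "L2_fun lborel (dmtc j)"
  by (rule mtc_space_L2[OF dmtc_in_space[of j "j + 1"]]) simp

lemma mtc_space_has_derivative:
  assumes "v \<in> mtc_space l n"
  shows "(v has_real_derivative (\<Sum>k\<le>n. cf v k * dmtc k x)) (at x)"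
  by (subst mtc_space_expand[OF assms]) (intro DERIV_sum DERIV_cmult mtc_has_derivative)

lemma deriv_mtc_space:
  "v \<in> mtc_space l n \<Longrightarrow> deriv v = (\<lambda>x. \<Sum>k\<le>n. cf v k * dmtc k x)"
  using mtc_space_has_derivative by (auto intro!: DERIV_imp_deriv)

lemma deriv_has: "v \<in> mtc_space l n \<Longrightarrow> (v has_real_derivative deriv v x) (at x)"
  using mtc_space_has_derivative by (metis DERIV_imp_deriv)

lemma deriv_L2: "v \<in> mtc_space l n \<Longrightarrow> L2_fun lborel (deriv v)"
  by (simp add: deriv_mtc_space) (intro L2_fun_sum L2_fun_cmult dmtc_L2)

lemma deriv_in_space:
  assumes "v \<in> mtc_space l (2 * q - 1)" "q > 0"
  shows "deriv v \<in> mtc_space l (2 * q + 1)"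
  unfolding deriv_mtc_space[OF assms(1)]
  by (intro mtc_space_sum mtc_space_cmult dmtc_in_space) (use assms(2) in auto)

lemma mtc_space_continuous: "v \<in> mtc_space l n \<Longrightarrow> continuous_on S v"
  using deriv_has by (meson DERIV_isCont continuous_at_imp_continuous_on)

lemma deriv_continuous: "v \<in> mtc_space l n \<Longrightarrow> continuous_on S (deriv v)"
proof -
  assume v: "v \<in> mtc_space l n"
  have "continuous_on S (dmtc k)" for k
    by (rule mtc_space_continuous[OF dmtc_in_space[of k "k + 1"]]) simp
  then show ?thesis unfolding deriv_mtc_space[OF v] by (intro continuous_intros)
qed

lemma mtc_space_tendsto_zero:
  assumes "v \<in> mtc_space l n" shows "(v \<longlongrightarrow> 0) at_top" "(v \<longlongrightarrow> 0) at_bot"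
proof -
  have "((\<lambda>x. \<Sum>k\<le>n. cf v k * mtc l k x) \<longlongrightarrow> (\<Sum>k\<le>n. cf v k * 0)) at_top"
    by (intro tendsto_intros mtc_tendsto_zero)
  then show "(v \<longlongrightarrow> 0) at_top" using mtc_space_expand[OF assms] by simp
  have "((\<lambda>x. \<Sum>k\<le>n. cf v k * mtc l k x) \<longlongrightarrow> (\<Sum>k\<le>n. cf v k * 0)) at_bot"
    by (intro tendsto_intros mtc_tendsto_zero)
  then show "(v \<longlongrightarrow> 0) at_bot" using mtc_space_expand[OF assms] by simp
qed

text \<open>Integration by parts; the boundary terms vanish because MTC functions decay at infinity.\<close>

lemma deriv_skew:
  assumes v: "v \<in> mtc_space l n" and w: "w \<in> mtc_space l m"
  shows "L2_inner (deriv v) w = - L2_inner v (deriv w)"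
proof -
  let ?f = "\<lambda>x. deriv v x * w x + deriv w x * v x"
  note i = L2_integrable_mult[OF deriv_L2[OF v] mtc_space_L2[OF w]]
    L2_integrable_mult[OF deriv_L2[OF w] mtc_space_L2[OF v]]
  have "(LINT x|lborel. ?f x) = 0 - 0"
  proof (rule has_integral_line_FTC[where F = "\<lambda>x. v x * w x"])
    show "((\<lambda>x. v x * w x) has_vector_derivative ?f x) (at x)" for x
      unfolding has_real_derivative_iff_has_vector_derivative[symmetric]
      using DERIV_mult[OF deriv_has[OF v] deriv_has[OF w], of x] by simp
    have "continuous_on UNIV ?f"
      by (intro continuous_intros deriv_continuous[OF v] deriv_continuous[OF w]
          mtc_space_continuous[OF v] mtc_space_continuous[OF w])
    then show "isCont ?f x" for x by (simp add: continuous_on_eq_continuous_at)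
    show "integrable lborel ?f" using i by simp
    show "((\<lambda>x. v x * w x) \<longlongrightarrow> 0) at_bot"
      using tendsto_mult[OF mtc_space_tendsto_zero(2)[OF v] mtc_space_tendsto_zero(2)[OF w]] by simp
    show "((\<lambda>x. v x * w x) \<longlongrightarrow> 0) at_top"
      using tendsto_mult[OF mtc_space_tendsto_zero(1)[OF v] mtc_space_tendsto_zero(1)[OF w]] by simp
  qed
  then show ?thesis using i by (simp add: L2_inner_def mult.commute)
qed

lemma deriv_mtc: "deriv (mtc l j) = dmtc j"
  using mtc_has_derivative by (auto intro!: DERIV_imp_deriv)

text \<open>The derivative is moved to the basis function. Coefficients beyond the degree vanish
  automatically, so the formula also covers the truncation at the end of the space.\<close>

lemma cf_deriv: "v \<in> mtc_space l n \<Longrightarrow> cf (deriv v) j = - (psign j / l *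
    ((2 * real (j div 2) + 1) * cf v (partner j) - real (j div 2) * cf v (partner j - 2)
     - (real (j div 2) + 1) * cf v (partner j + 2)))"
proof -
  assume v: "v \<in> mtc_space l n"
  have "cf (deriv v) j = - L2_inner v (dmtc j)"
    using deriv_skew[OF v mtc_in_space[OF order_refl], of j] by (simp add: cf_def deriv_mtc)
  also have "L2_inner v (dmtc j) = L2_inner (dmtc j) v" by (rule L2_inner_commute)
  also have "\<dots> = psign j / l *
    ((2 * real (j div 2) + 1) * cf v (partner j) - real (j div 2) * cf v (partner j - 2)
     - (real (j div 2) + 1) * cf v (partner j + 2))"
    unfolding dmtc_def[abs_def] L2_inner_cmult_left cf_def
    by (subst L2_inner_diff_left L2_inner_cmult_left; (intro L2_fun_diff L2_fun_cmult mtc_L2 mtc_space_L2[OF v])?)+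
       (simp add: L2_inner_commute[of v])
  finally show ?thesis .
qed

lemma hilbert_mtc_space:
  assumes "v \<in> mtc_space l n"
  shows "hilbert v = (\<lambda>x. \<Sum>k\<le>n. cf v k * (psign k * mtc l (partner k) x))"
proof
  fix x
  have hb: "hilbert (mtc l k) x = psign k * mtc l (partner k) x" for k
    using hilbert_mtc[OF l_pos, of k x] by (simp add: psign_def partner_def)
  have hr: "hilbert w x = (1 / pi) * (L2_inner w (far_kernel x) - L2_inner (deriv w) (near_kernel x))"
    if "w \<in> mtc_space l m" for w m
    by (rule hilbert_L2_representation)
       (use that in \<open>auto intro: deriv_has deriv_continuous mtc_space_L2 deriv_L2\<close>)
  have "hilbert v x = (1 / pi) * ((\<Sum>k\<le>n. cf v k * L2_inner (mtc l k) (far_kernel x))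
      - (\<Sum>k\<le>n. cf v k * L2_inner (dmtc k) (near_kernel x)))"
    unfolding hr[OF assms] deriv_mtc_space[OF assms]
    by (subst mtc_space_expand[OF assms], subst (1 2) L2_inner_sum_left)
       (auto intro: mtc_L2 dmtc_L2 far_kernel_L2 near_kernel_L2)
  also have "\<dots> = (\<Sum>k\<le>n. cf v k * hilbert (mtc l k) x)"
    unfolding hr[OF mtc_in_space[OF order_refl]] deriv_mtc
    by (simp add: sum_distrib_left sum_subtractf right_diff_distrib algebra_simps)
  finally show "hilbert v x = (\<Sum>k\<le>n. cf v k * (psign k * mtc l (partner k) x))"
    unfolding hb .
qed

end

lemma sum_even_odd: "(\<Sum>k<2 * m. f k) = (\<Sum>k<m. f (2 * k)) + (\<Sum>k<m. f (2 * k + 1))"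
  for f :: "nat \<Rightarrow> real"
  by (induction m) (auto simp: algebra_simps)

locale mtc_method = mtc_system +
  fixes p :: nat
  assumes p_pos: "p > 0"
begin

(* The degree of the discrete space is written 2 * p - 1; rewriting 1 to Suc 0 would make the
   folded and the simplified form of the same space clash. *)
declare One_nat_def [simp del]

abbreviation V :: "(real \<Rightarrow> real) set" where "V \<equiv> mtc_space l (2 * p - 1)"

abbreviation J :: "(real \<Rightarrow> real) \<Rightarrow> real \<Rightarrow> real" where "J \<equiv> Jop l (2 * p - 1)"

lemma atMost_dim: "{..2 * p - 1} = {..<2 * p}"
  using p_pos by auto

lemma le_dim: "k \<le> 2 * p - 1 \<longleftrightarrow> k < 2 * p"
  using p_pos by auto

lemma V_L2: "v \<in> V \<Longrightarrow> L2_fun lborel v"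
  by (rule mtc_space_L2)

lemma inner_V: "v \<in> V \<Longrightarrow> w \<in> V \<Longrightarrow> L2_inner v w = (\<Sum>k<2 * p. cf v k * cf w k)"
  using parseval[OF V_L2, of v w "2 * p - 1"] unfolding atMost_dim by simp

lemma J_in: "L2_fun lborel f \<Longrightarrow> J f \<in> V"
proof -
  assume f: "L2_fun lborel f"
  have "L2_fun lborel (deriv (proj l (2 * p - 1) f))" by (rule deriv_L2[OF proj_in_space[OF f]])
  then show ?thesis unfolding Jop_def by (intro mtc_space_minus proj_in_space)
qed

lemma J_V_in: "v \<in> V \<Longrightarrow> J v \<in> V"
  by (intro J_in V_L2)

lemma cf_J: "v \<in> V \<Longrightarrow> k < 2 * p \<Longrightarrow> cf (J v) k = - cf (deriv v) k"
proof -
  assume v: "v \<in> V" and k: "k < 2 * p"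
  have "J v = (\<lambda>x. (- 1) * proj l (2 * p - 1) (deriv v) x)"
    by (simp add: Jop_def proj_id[OF v])
  then have "cf (J v) k = - cf (proj l (2 * p - 1) (deriv v)) k"
    by (simp only: cf_cmult)
  then show ?thesis using cf_proj[OF deriv_L2[OF v]] k by (simp add: le_dim)
qed

lemma V_eqI: "v \<in> V \<Longrightarrow> w \<in> V \<Longrightarrow> (\<And>k. k < 2 * p \<Longrightarrow> cf v k = cf w k) \<Longrightarrow> v = w"
  by (rule mtc_space_eqI) (auto simp: le_dim)

lemma J_inner: "v \<in> V \<Longrightarrow> w \<in> V \<Longrightarrow> L2_inner (J v) w = - L2_inner (deriv v) w"
proof -
  assume v: "v \<in> V" and w: "w \<in> V"
  have "L2_inner (deriv v) w = (\<Sum>k<2 * p. cf (deriv v) k * cf w k)"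
    using parseval[OF deriv_L2[OF v] w] unfolding atMost_dim .
  then show ?thesis
    using inner_V[OF J_V_in[OF v] w] by (simp add: cf_J[OF v] sum_negf)
qed

lemma J_skew: "v \<in> V \<Longrightarrow> w \<in> V \<Longrightarrow> L2_inner (J v) w = - L2_inner v (J w)"
  using J_inner[of v w] J_inner[of w v] deriv_skew[of v "2 * p - 1" w "2 * p - 1"]
  by (simp add: L2_inner_commute)

lemma V_lin: "v \<in> V \<Longrightarrow> w \<in> V \<Longrightarrow> (\<lambda>x. a * v x + b * w x) \<in> V"
  by (intro mtc_space_add mtc_space_cmult)

lemma cf_lin: "v \<in> V \<Longrightarrow> w \<in> V \<Longrightarrow> cf (\<lambda>x. a * v x + b * w x) k = a * cf v k + b * cf w k"
  by (simp add: cf_add cf_cmult V_L2 L2_fun_cmult)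

lemma J_lin:
  assumes v: "v \<in> V" and w: "w \<in> V"
  shows "J (\<lambda>x. a * v x + b * w x) = (\<lambda>x. a * J v x + b * J w x)"
proof (rule V_eqI[OF J_V_in[OF V_lin[OF v w]] V_lin[OF J_V_in[OF v] J_V_in[OF w]]])
  fix k assume k: "k < 2 * p"
  show "cf (J (\<lambda>x. a * v x + b * w x)) k = cf (\<lambda>x. a * J v x + b * J w x) k"
    unfolding cf_lin[OF J_V_in[OF v] J_V_in[OF w]] cf_J[OF v k] cf_J[OF w k] cf_J[OF V_lin[OF v w] k]
      cf_deriv[OF v] cf_deriv[OF w] cf_deriv[OF V_lin[OF v w]] cf_lin[OF v w]
    by (simp add: algebra_simps)
qed

lemma H_in: "v \<in> V \<Longrightarrow> hilbert v \<in> V"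
  unfolding hilbert_mtc_space
  by (intro mtc_space_sum mtc_space_cmult mtc_in_space) (simp add: le_dim partner_less)

lemma cf_H: "v \<in> V \<Longrightarrow> cf (hilbert v) k = - psign k * cf v (partner k)"
proof -
  assume v: "v \<in> V"
  have "cf (hilbert v) k = (\<Sum>j<2 * p. cf v j * psign j * L2_inner (mtc l (partner j)) (mtc l k))"
    unfolding hilbert_mtc_space[OF v] cf_def[of _ k] mult.assoc[symmetric] atMost_dim
    by (rule L2_inner_sum_left) (auto intro: mtc_L2)
  also have "\<dots> = (\<Sum>j<2 * p. if j = partner k then cf v j * psign j else 0)"
    by (intro sum.cong) (auto simp: mtc_orthonormal(2)[OF l_pos])
  also have "\<dots> = (if k < 2 * p then - psign k * cf v (partner k) else 0)"
    by (simp add: sum.delta partner_less)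
  also have "\<dots> = - psign k * cf v (partner k)"
  proof (cases "k < 2 * p")
    case False
    then have "2 * p - 1 < partner k" using partner_less[of k p] p_pos by linarith
    then show ?thesis using False cf_zero[OF v] by simp
  qed simp
  finally show ?thesis .
qed

lemma sum_partner: "(\<Sum>k<2 * p. f (partner k)) = (\<Sum>k<2 * p. f k)" for f :: "nat \<Rightarrow> real"
  by (rule sum.reindex_bij_witness[of _ partner partner]) (auto simp: partner_less)

lemma H_skew:
  assumes v: "v \<in> V" and w: "w \<in> V"
  shows "L2_inner (hilbert v) w = - L2_inner v (hilbert w)"
proof -
  have "L2_inner (hilbert v) w = (\<Sum>k<2 * p. - psign k * cf v (partner k) * cf w k)"
    by (simp add: inner_V[OF H_in[OF v] w] cf_H[OF v])
  also have "\<dots> = (\<Sum>k<2 * p. psign k * cf v k * cf w (partner k))"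
    using sum_partner[of "\<lambda>k. - psign k * cf v (partner k) * cf w k"] by simp
  also have "\<dots> = - L2_inner v (hilbert w)"
    by (simp add: inner_V[OF v H_in[OF w]] cf_H[OF w] sum_negf[symmetric] mult.commute mult.left_commute)
  finally show ?thesis .
qed

lemma H_isometry:
  assumes v: "v \<in> V"
  shows "L2_norm lborel (hilbert v) = L2_norm lborel v"
proof -
  have "L2_inner (hilbert v) (hilbert v) = (\<Sum>k<2 * p. (cf v (partner k))\<^sup>2)"
    unfolding inner_V[OF H_in[OF v] H_in[OF v]] cf_H[OF v]
    by (intro sum.cong refl) (simp add: psign_def power2_eq_square)
  also have "\<dots> = L2_inner v v"
    using sum_partner[of "\<lambda>k. (cf v k)\<^sup>2"] by (simp add: inner_V[OF v v] power2_eq_square)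
  finally show ?thesis by (simp add: L2_inner_self L2_norm_nonneg)
qed

text \<open>Both operators exchange the functions of a pair, and the tridiagonal factor of \<open>J\<close> is the same
  on both, so it commutes with the exchange.\<close>

lemma HJ_commute:
  assumes v: "v \<in> V"
  shows "hilbert (J v) = J (hilbert v)"
proof (rule V_eqI[OF H_in[OF J_V_in[OF v]] J_V_in[OF H_in[OF v]]])
  fix k assume k: "k < 2 * p"
  have pk: "partner k < 2 * p" using k by (simp add: partner_less)
  have d: "partner k div 2 = k div 2" "psign (partner k + 2) = psign (partner k)" "partner (partner k + 2) = k + 2"
    by (cases "even k"; auto simp: psign_def partner_def elim!: oddE)+
  have z: "real (k div 2) * cf (hilbert v) (partner k - 2) = real (k div 2) * (psign k * cf v (k - 2))"
  proof (cases "k div 2 = 0")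
    case False
    then have "2 \<le> k" by (cases "k < 2") auto
    then obtain i where "k = i + 2" using le_Suc_ex by (metis add.commute)
    then have "psign (partner k - 2) = - psign k" "partner (partner k - 2) = k - 2"
      by (auto simp: psign_def partner_def elim!: oddE)
    then show ?thesis by (simp add: cf_H[OF v])
  qed simp
  have "cf (J (hilbert v)) k = psign k / l * ((2 * real (k div 2) + 1) * cf (hilbert v) (partner k)
       - real (k div 2) * cf (hilbert v) (partner k - 2)
       - (real (k div 2) + 1) * cf (hilbert v) (partner k + 2))"
    unfolding cf_J[OF H_in[OF v] k] cf_deriv[OF H_in[OF v]] by simp
  also have "\<dots> = (psign k * psign k) / l * ((2 * real (k div 2) + 1) * cf v k
       - real (k div 2) * cf v (k - 2) - (real (k div 2) + 1) * cf v (k + 2))"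
    unfolding z by (simp add: cf_H[OF v] d del: psign_sq add_2_eq_Suc' add_2_eq_Suc) (simp add: algebra_simps del: psign_sq add_2_eq_Suc' add_2_eq_Suc)
  also have "\<dots> = cf (hilbert (J v)) k"
    unfolding cf_H[OF J_V_in[OF v]] cf_J[OF v pk] cf_deriv[OF v] by (simp add: d)
  finally show "cf (hilbert (J v)) k = cf (J (hilbert v)) k" by simp
qed

lemma HJ_sym:
  assumes v: "v \<in> V" and w: "w \<in> V"
  shows "L2_inner v (hilbert (J w)) = L2_inner (hilbert (J v)) w"
  using H_skew[OF v J_V_in[OF w]] J_skew[OF H_in[OF v] w] HJ_commute[OF v] by simp

lemma H_lin:
  assumes v: "v \<in> V" and w: "w \<in> V"
  shows "hilbert (\<lambda>x. a * v x + b * w x) = (\<lambda>x. a * hilbert v x + b * hilbert w x)"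
  by (rule V_eqI[OF H_in[OF V_lin[OF v w]] V_lin[OF H_in[OF v] H_in[OF w]]])
     (unfold cf_lin[OF H_in[OF v] H_in[OF w]] cf_H[OF V_lin[OF v w]] cf_H[OF v] cf_H[OF w] cf_lin[OF v w],
      simp add: algebra_simps)

text \<open>\<open>J v\<close> loses the two coefficients of \<open>deriv v\<close> that lie outside the discrete space. The
  tridiagonal structure makes the coefficients of each parity telescope to zero, so that each
  lost one is a sum of \<open>p\<close> coefficients of \<open>J v\<close>.\<close>

lemma deriv_norm_bound:
  assumes v: "v \<in> V"
  shows "(L2_norm lborel (deriv v))\<^sup>2 \<le> (1 + real p) * (L2_norm lborel (J v))\<^sup>2"
proof -
  let ?d = "cf (deriv v)"
  have vz: "cf v j = 0" if "2 * p \<le> j" for j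
    using cf_zero[OF v, of j] that p_pos by simp
  have even: "(\<Sum>k<m. ?d (2 * k)) = real m / l * (cf v (2 * m - 1) - cf v (2 * m + 1))" for m
  proof (induction m)
    case (Suc m)
    have "?d (2 * m) = 1 / l * ((2 * real m + 1) * cf v (2 * m + 1) - real m * cf v (2 * m - 1)
        - (real m + 1) * cf v (2 * m + 3))"
      unfolding cf_deriv[OF v] by (simp add: psign_def partner_def One_nat_def numeral_3_eq_3)
    then show ?case using Suc l_pos by (simp add: field_simps One_nat_def numeral_3_eq_3)
  qed simp
  have odd: "(\<Sum>k<m. ?d (2 * k + 1)) = - real m / l * (cf v (2 * m - 2) - cf v (2 * m))" for m
  proof (induction m)
    case (Suc m)
    have "?d (2 * m + 1) = - (1 / l) * ((2 * real m + 1) * cf v (2 * m) - real m * cf v (2 * m - 2)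
        - (real m + 1) * cf v (2 * m + 2))"
      unfolding cf_deriv[OF v] by (simp add: psign_def partner_def One_nat_def numeral_3_eq_3)
    then show ?case using Suc l_pos by (simp add: field_simps One_nat_def numeral_3_eq_3)
  qed simp
  have a: "?d (2 * p) = - (\<Sum>k<p. ?d (2 * k))"
    unfolding even unfolding cf_deriv[OF v] using vz by (simp add: psign_def partner_def One_nat_def)
  have b: "?d (2 * p + 1) = - (\<Sum>k<p. ?d (2 * k + 1))"
    unfolding odd unfolding cf_deriv[OF v] using vz by (simp add: psign_def partner_def One_nat_def)
  have sq: "(\<Sum>k<p. x k)\<^sup>2 \<le> real p * (\<Sum>k<p. (x k)\<^sup>2)" for x :: "nat \<Rightarrow> real"
    using Cauchy_Schwarz_ineq_sum[of "\<lambda>_. 1" x "{..<p}"] by simp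
  have Jn: "(L2_norm lborel (J v))\<^sup>2 = (\<Sum>k<p. (?d (2 * k))\<^sup>2) + (\<Sum>k<p. (?d (2 * k + 1))\<^sup>2)"
    unfolding L2_inner_self[symmetric] inner_V[OF J_V_in[OF v] J_V_in[OF v]] sum_even_odd[symmetric, of "\<lambda>k. (?d k)\<^sup>2"]
    by (intro sum.cong) (auto simp: cf_J[OF v] power2_eq_square)
  have "(L2_norm lborel (deriv v))\<^sup>2 = (\<Sum>k\<le>2 * p + 1. (?d k)\<^sup>2)"
    unfolding L2_inner_self[symmetric]
    by (simp add: parseval[OF deriv_L2[OF v] deriv_in_space[OF v p_pos]] power2_eq_square)
  also have "{..2 * p + 1} = {..<2 * Suc p}" by auto
  also have "(\<Sum>k<2 * Suc p. (?d k)\<^sup>2) = (L2_norm lborel (J v))\<^sup>2 + (?d (2 * p))\<^sup>2 + (?d (2 * p + 1))\<^sup>2"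
    unfolding sum_even_odd Jn by simp
  also have "\<dots> \<le> (L2_norm lborel (J v))\<^sup>2 + real p * (\<Sum>k<p. (?d (2 * k))\<^sup>2) + real p * (\<Sum>k<p. (?d (2 * k + 1))\<^sup>2)"
    unfolding a b power2_minus by (intro add_mono order_refl sq)
  also have "\<dots> = (1 + real p) * (L2_norm lborel (J v))\<^sup>2"
    unfolding Jn by (simp add: algebra_simps)
  finally show ?thesis .
qed

text \<open>The square of \<open>v\<close> is the integral of its derivative from minus infinity. Cauchy-Schwarz and the
  comparison of the derivative with \<open>J v\<close> give the bound.\<close>

lemma pointwise_bound:
  assumes v: "v \<in> V"
  shows "(v x)\<^sup>2 \<le> sqrt (1 + real p) * ((L2_norm lborel v)\<^sup>2 + (L2_norm lborel (J v))\<^sup>2)"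
proof -
  let ?N = "L2_norm lborel v" and ?X = "L2_norm lborel (J v)" and ?D = "L2_norm lborel (deriv v)"
  let ?s = "sqrt (1 + real p)"
  let ?f = "\<lambda>y. 2 * (v y * deriv v y)"
  have i: "integrable lborel (\<lambda>y. v y * deriv v y)" by (rule L2_integrable_mult[OF V_L2[OF v] deriv_L2[OF v]])
  have "(LINT y:{..<x}|lborel. ?f y) = (v x)\<^sup>2 - 0"
  proof (rule has_integral_below_FTC[where F = "\<lambda>y. (v y)\<^sup>2"])
    show "((\<lambda>y. (v y)\<^sup>2) has_vector_derivative ?f y) (at y)" for y
      unfolding has_real_derivative_iff_has_vector_derivative[symmetric]
      using DERIV_power[OF deriv_has[OF v], of 2 y] by (simp add: mult.commute)
    have c: "continuous_on UNIV ?f"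
      by (intro continuous_intros deriv_continuous[OF v] mtc_space_continuous[OF v])
    then show "isCont ?f y" for y by (simp add: continuous_on_eq_continuous_at)
    show "set_integrable lborel {..<x} ?f"
      unfolding set_integrable_def by (rule integrable_mult_indicator) (use i in auto)
    show "isCont (\<lambda>y. (v y)\<^sup>2) x" using DERIV_isCont[OF deriv_has[OF v]] by (intro continuous_intros)
    show "((\<lambda>y. (v y)\<^sup>2) \<longlongrightarrow> 0) at_bot" using tendsto_power[OF mtc_space_tendsto_zero(2)[OF v], of 2] by simp
  qed
  then have "(v x)\<^sup>2 = (LINT y|lborel. indicat_real {..<x} y *\<^sub>R ?f y)"
    by (simp only: set_lebesgue_integral_def diff_zero)
  also have "\<dots> \<le> (LINT y|lborel. 2 * (\<bar>v y\<bar> * \<bar>deriv v y\<bar>))"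
  proof (rule integral_mono)
    show "integrable lborel (\<lambda>y. indicat_real {..<x} y *\<^sub>R ?f y)"
      by (rule integrable_mult_indicator) (use i in auto)
    show "integrable lborel (\<lambda>y. 2 * (\<bar>v y\<bar> * \<bar>deriv v y\<bar>))"
      using integrable_abs[OF i] by (simp add: abs_mult)
    show "indicat_real {..<x} y *\<^sub>R ?f y \<le> 2 * (\<bar>v y\<bar> * \<bar>deriv v y\<bar>)" for y
      using abs_ge_self[of "v y * deriv v y"] by (simp add: indicator_def abs_mult)
  qed
  also have "\<dots> = 2 * (LINT y|lborel. \<bar>v y\<bar> * \<bar>deriv v y\<bar>)" by (rule integral_mult_right_zero)
  also have "(LINT y|lborel. \<bar>v y\<bar> * \<bar>deriv v y\<bar>) \<le> ?N * ?D"
  proof -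
    have "L2_fun lborel (\<lambda>y. \<bar>v y\<bar>)" "L2_fun lborel (\<lambda>y. \<bar>deriv v y\<bar>)"
      using L2_funD[OF V_L2[OF v]] L2_funD[OF deriv_L2[OF v]] unfolding L2_fun_def power2_abs
      by (auto intro: borel_measurable_abs)
    from L2_cauchy_schwarz[OF this] show ?thesis by (simp add: L2_norm_def)
  qed
  also have "?N * ?D \<le> ?N * (?s * ?X)"
  proof (rule mult_left_mono)
    have "?D\<^sup>2 \<le> (?s * ?X)\<^sup>2"
      using deriv_norm_bound[OF v] by (simp add: power_mult_distrib)
    then show "?D \<le> ?s * ?X" by (rule power2_le_imp_le) (simp add: L2_norm_nonneg)
  qed (rule L2_norm_nonneg)
  also have "2 * (?N * (?s * ?X)) \<le> ?s * (?N\<^sup>2 + ?X\<^sup>2)"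
  proof -
    have "2 * (?N * ?X) \<le> ?N\<^sup>2 + ?X\<^sup>2"
      using zero_le_power2[of "?N - ?X"] by (simp add: power2_eq_square algebra_simps)
    then have "?s * (2 * (?N * ?X)) \<le> ?s * (?N\<^sup>2 + ?X\<^sup>2)" by (intro mult_left_mono) auto
    then show ?thesis by (simp add: mult.commute mult.left_commute)
  qed
  finally show ?thesis by simp
qed

end

section \<open>Interpolation as a quadrature rule\<close>

text \<open>The nodes correspond to the \<open>2 * p\<close>-th roots of minus one, whose low powers sum to zero.\<close>

lemma cis_power_sum_zero:
  assumes "0 < q" "q < 2 * p"
  shows "(\<Sum>m<2 * p. cis ((2 * real m + 1) * pi / (2 * real p)) ^ q) = 0"
proof -
  let ?z = "cis (pi / real p) ^ q" and ?w = "cis (pi / (2 * real p)) ^ q"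
  have p: "real p > 0" using assms by simp
  have "cis ((2 * real m + 1) * pi / (2 * real p)) = cis (pi / real p) ^ m * cis (pi / (2 * real p))" for m
  proof -
    have "(2 * real m + 1) * pi / (2 * real p) = real m * (pi / real p) + pi / (2 * real p)"
      using p by (simp add: field_simps)
    then show ?thesis by (simp only: Complex.DeMoivre cis_mult)
  qed
  then have "(\<Sum>m<2 * p. cis ((2 * real m + 1) * pi / (2 * real p)) ^ q) = (\<Sum>m<2 * p. ?w * ?z ^ m)"
    by (intro sum.cong) (simp_all add: power_mult_distrib mult.commute flip: power_mult)
  also have "\<dots> = ?w * (\<Sum>m<2 * p. ?z ^ m)" by (simp only: sum_distrib_left)
  also have "(\<Sum>m<2 * p. ?z ^ m) = 0"
  proof -
    have z: "?z = cis (real q * (pi / real p))" by (rule Complex.DeMoivre)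
    let ?t = "real q * (pi / real p)"
    have "real q / real p < 2" using assms p by (simp add: divide_simps)
    then have "real q / real p * pi < 2 * pi" using pi_gt_zero by (rule mult_strict_right_mono)
    then have "?t < 2 * pi" by simp
    then have "?t / 2 < (2 * pi) / 2" by (rule divide_strict_right_mono) simp
    then have "?t / 2 < pi" by simp
    moreover have "0 < ?t / 2" using assms p by simp
    ultimately have "0 < sin (?t / 2)" by (intro sin_gt_zero)
    then have "cos ?t \<noteq> 1" using cos_double_sin[of "?t / 2"] by simp
    then have z1: "?z \<noteq> 1" unfolding z by (simp add: complex_eq_iff)
    have "?z ^ (2 * p) = cis (real (2 * p) * (real q * (pi / real p)))"
      unfolding z by (rule Complex.DeMoivre)
    also have "real (2 * p) * (real q * (pi / real p)) = 2 * pi * real q"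
      using p by simp
    also have "cis (2 * pi * real q) = 1"
      by (metis Ints_of_nat cis_multiple_2pi)
    finally show ?thesis using geometric_sum[OF z1, of "2 * p"] by simp
  qed
  finally show ?thesis by simp
qed

context mtc_method
begin

text \<open>The quadrature weights hidden in the coefficients of the interpolant. The factor
  \<open>l\<^sup>2 + 4 x\<^sup>2\<close> cancels the denominators of a product of two MTC functions.\<close>

definition W :: "nat \<Rightarrow> real" where
  "W m = pi / (4 * l * real p) * (l\<^sup>2 + 4 * (node l p m)\<^sup>2)"

abbreviation nd :: "nat \<Rightarrow> real" where "nd \<equiv> node l p"

lemma W_nonneg: "0 \<le> W m"
  using l_pos p_pos by (simp add: W_def)

lemma W_weight: "W m / weight l (nd m) = pi / (4 * l * real p)"
  using weight_pos[OF l_pos, of "nd m"] by (simp add: W_def weight_def add.commute)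

lemma unimod_node:
  assumes "m < 2 * p"
  shows "unimod l (nd m) = cis ((2 * real m + 1) * pi / (2 * real p))"
proof -
  let ?t = "(2 * real m + 1) / (4 * real p) * pi"
  have t: "0 < ?t" "?t < pi"
  proof -
    have r: "0 < (2 * real m + 1) / (4 * real p)" "(2 * real m + 1) / (4 * real p) < 1"
      using assms p_pos by (auto simp: divide_simps)
    show "0 < ?t" using r(1) pi_gt_zero by (rule mult_pos_pos)
    show "?t < pi" using mult_strict_right_mono[OF r(2) pi_gt_zero] by simp
  qed
  then have s: "sin ?t \<noteq> 0" using sin_gt_zero by force
  have "Complex (2 * nd m) l = of_real (l / sin ?t) * cis ?t"
    using s by (simp add: node_def cot_def complex_eq_iff)
  moreover have "Complex (2 * nd m) (- l) = of_real (l / sin ?t) * cis (- ?t)"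
    using s by (simp add: node_def cot_def complex_eq_iff)
  moreover have "complex_of_real (l / sin ?t) \<noteq> 0" using s l_pos by simp
  ultimately have "unimod l (nd m) = cis ?t / cis (- ?t)"
    unfolding unimod_def using nonzero_mult_divide_mult_cancel_left by metis
  also have "\<dots> = cis (?t - (- ?t))" by (rule cis_divide)
  also have "?t - (- ?t) = (2 * real m + 1) * pi / (2 * real p)"
    using p_pos by (simp add: field_simps)
  finally show ?thesis .
qed

lemma sum_unimod_node:
  assumes "0 < q" "q < 2 * p"
  shows "(\<Sum>m<2 * p. of_real (W m) * (unimod l (nd m) ^ q / of_real (weight l (nd m)))) = 0"
proof -
  have "(\<Sum>m<2 * p. of_real (W m) * (unimod l (nd m) ^ q / of_real (weight l (nd m))))
      = (\<Sum>m<2 * p. of_real (pi / (4 * l * real p)) * cis ((2 * real m + 1) * pi / (2 * real p)) ^ q)"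
  proof (rule sum.cong[OF refl])
    fix m assume "m \<in> {..<2 * p}"
    have "of_real (W m) * (unimod l (nd m) ^ q / of_real (weight l (nd m)))
        = of_real (W m / weight l (nd m)) * unimod l (nd m) ^ q" by simp
    then show "of_real (W m) * (unimod l (nd m) ^ q / of_real (weight l (nd m)))
        = of_real (pi / (4 * l * real p)) * cis ((2 * real m + 1) * pi / (2 * real p)) ^ q"
      using \<open>m \<in> {..<2 * p}\<close> by (simp only: W_weight) (simp add: unimod_node)
  qed
  then show ?thesis
    unfolding sum_distrib_left[symmetric] cis_power_sum_zero[OF assms] by simp
qed

text \<open>The same computation as on the line, with integrals replaced by sums over the nodes.\<close>

lemma discrete_orthonormal:
  assumes i: "i < 2 * p" and j: "j < 2 * p"
  shows "(\<Sum>m<2 * p. W m * (mtc l i (nd m) * mtc l j (nd m))) = (if i = j then 1 else 0)"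
proof -
  let ?k = "i div 2" and ?h = "j div 2"
  let ?A = "\<Sum>m<2 * p. of_real (W m) * (psi l ?k (nd m) * psi l ?h (nd m))"
  let ?B = "\<Sum>m<2 * p. of_real (W m) * (psi l ?k (nd m) * cnj (psi l ?h (nd m)))"
  have kh: "?k < p" "?h < p" using i j by auto
  have A: "?A = 0"
    unfolding psi_mult_psi[OF l_pos] by (rule sum_unimod_node) (use kh in auto)
  have ge: "(\<Sum>m<2 * p. of_real (W m) * (psi l a (nd m) * cnj (psi l b (nd m)))) = (if a = b then of_real (pi / (2 * l)) else 0)"
    if "b \<le> a" "a < p" for a b
  proof (cases "a = b")
    case True
    have "(\<Sum>m<2 * p. of_real (W m) * (psi l a (nd m) * cnj (psi l b (nd m)))) = (\<Sum>m<2 * p. complex_of_real (W m / weight l (nd m)))"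
      unfolding psi_mult_cnj_psi[OF l_pos that(1)] using True by simp
    also have "\<dots> = of_real (pi / (2 * l))"
      unfolding W_weight using p_pos by simp
    finally show ?thesis using True by simp
  next
    case False
    then show ?thesis
      unfolding psi_mult_cnj_psi[OF l_pos that(1)] using that by (simp add: sum_unimod_node del: times_divide_eq_right)
  qed
  have B: "?B = (if ?k = ?h then of_real (pi / (2 * l)) else 0)"
  proof (cases "?h \<le> ?k")
    case True then show ?thesis using ge kh by simp
  next
    case False
    then have "?k \<le> ?h" by simp
    have "?B = cnj (\<Sum>m<2 * p. of_real (W m) * (psi l ?h (nd m) * cnj (psi l ?k (nd m))))"
      by (simp add: mult.commute mult.left_commute)
    then show ?thesis using ge[OF \<open>?k \<le> ?h\<close> kh(2)] False by auto
  qed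
  have "(\<Sum>m<2 * p. W m * (mtc l i (nd m) * mtc l j (nd m)))
      = 2 * l / pi * Re (phase i * phase j * ?A + phase i * cnj (phase j) * ?B)"
  proof -
    have t: "W m * (mtc l i x * mtc l j x) = 2 * l / pi * Re (phase i * phase j * (of_real (W m) * (psi l ?k x * psi l ?h x))
      + phase i * cnj (phase j) * (of_real (W m) * (psi l ?k x * cnj (psi l ?h x))))" for m x
    proof -
      have "phase i * phase j * (of_real (W m) * (psi l ?k x * psi l ?h x))
          + phase i * cnj (phase j) * (of_real (W m) * (psi l ?k x * cnj (psi l ?h x)))
        = of_real (W m) * (phase i * phase j * (psi l ?k x * psi l ?h x) + phase i * cnj (phase j) * (psi l ?k x * cnj (psi l ?h x)))"
        by (simp add: algebra_simps)
      then show ?thesis unfolding mtc_mult_mtc[OF l_pos] by (simp only: Re_of_real_mult mult.left_commute)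
    qed
    show ?thesis
      unfolding t sum_distrib_left[symmetric] Re_sum[symmetric] sum.distrib ..
  qed
  also have "\<dots> = (if i = j then 1 else 0)"
  proof (cases "?k = ?h")
    case True
    have "Re (phase i * phase j * ?A + phase i * cnj (phase j) * ?B) = Re (phase i * cnj (phase j)) * (pi / (2 * l))"
      unfolding A B if_P[OF True] mult_zero_right add_0 by (rule Re_mult_real)
    then show ?thesis using phase_orthogonal[OF True] l_pos by simp
  next
    case False
    then have "i \<noteq> j" by auto
    then show ?thesis using False by (simp only: A B if_not_P) simp
  qed
  finally show ?thesis .
qed

lemma interp_eq: "interp l p f = (\<lambda>x. \<Sum>k\<le>2 * p - 1. (\<Sum>m<2 * p. W m * f (nd m) * mtc l k (nd m)) * mtc l k x)"
proof -
  have "pi / (4 * l * real p) * (\<Sum>m\<le>2 * p - 1. (l\<^sup>2 + 4 * (nd m)\<^sup>2) * mtc l k (nd m) * f (nd m))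
      = (\<Sum>m<2 * p. W m * f (nd m) * mtc l k (nd m))" for k
    unfolding sum_distrib_left atMost_dim W_def
    by (intro sum.cong refl) (simp add: mult.commute mult.left_commute)
  then show ?thesis unfolding interp_def[abs_def] by (simp only:)
qed

lemma cf_interp: "k < 2 * p \<Longrightarrow> cf (interp l p f) k = (\<Sum>m<2 * p. W m * f (nd m) * mtc l k (nd m))"
  unfolding interp_eq cf_sum by (simp only: le_dim if_True)

lemma interp_in: "interp l p f \<in> V"
  unfolding interp_eq by (rule mtc_space_sumI)

lemma V_at: "v \<in> V \<Longrightarrow> v x = (\<Sum>k<2 * p. cf v k * mtc l k x)"
  using mtc_space_expand[of v "2 * p - 1"] unfolding atMost_dim by metis

lemma inner_interp:
  assumes v: "v \<in> V"
  shows "L2_inner v (interp l p f) = (\<Sum>m<2 * p. W m * f (nd m) * v (nd m))"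
proof -
  have "L2_inner v (interp l p f) = (\<Sum>k<2 * p. cf v k * (\<Sum>m<2 * p. W m * f (nd m) * mtc l k (nd m)))"
    unfolding inner_V[OF v interp_in] by (intro sum.cong) (auto simp: cf_interp)
  also have "\<dots> = (\<Sum>m<2 * p. \<Sum>k<2 * p. cf v k * (W m * f (nd m) * mtc l k (nd m)))"
    unfolding sum_distrib_left by (rule sum.swap)
  also have "\<dots> = (\<Sum>m<2 * p. W m * f (nd m) * v (nd m))"
    by (intro sum.cong refl) (simp add: V_at[OF v] sum_distrib_left mult.commute mult.left_commute)
  finally show ?thesis .
qed

lemma interp_id:
  assumes w: "w \<in> V"
  shows "interp l p w = w"
proof (rule V_eqI[OF interp_in w])
  fix k assume k: "k < 2 * p"
  have "cf (interp l p w) k = (\<Sum>m<2 * p. \<Sum>j<2 * p. cf w j * (W m * (mtc l j (nd m) * mtc l k (nd m))))"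
    unfolding cf_interp[OF k]
  proof (rule sum.cong[OF refl])
    fix m
    show "W m * w (nd m) * mtc l k (nd m) = (\<Sum>j<2 * p. cf w j * (W m * (mtc l j (nd m) * mtc l k (nd m))))"
      unfolding V_at[OF w, of "nd m"] sum_distrib_left sum_distrib_right
      by (intro sum.cong refl) (simp only: mult.commute mult.left_commute)
  qed
  also have "\<dots> = (\<Sum>j<2 * p. \<Sum>m<2 * p. cf w j * (W m * (mtc l j (nd m) * mtc l k (nd m))))"
    by (rule sum.swap)
  also have "\<dots> = (\<Sum>j<2 * p. if j = k then cf w j else 0)"
    by (intro sum.cong refl) (simp add: discrete_orthonormal k flip: sum_distrib_left)
  also have "\<dots> = cf w k" using k by (simp add: sum.delta)
  finally show "cf (interp l p w) k = cf w k" .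
qed

lemma inner_nodes:
  assumes v: "v \<in> V" and w: "w \<in> V"
  shows "L2_inner v w = (\<Sum>m<2 * p. W m * (v (nd m) * w (nd m)))"
  using inner_interp[OF v, of w] unfolding interp_id[OF w] by (simp add: mult.commute mult.left_commute)

text \<open>The bilinear form that polarises the quadratic part of \<open>G_fun\<close>, up to the factor two.\<close>

definition Q :: "real \<Rightarrow> real \<Rightarrow> real \<Rightarrow> (real \<Rightarrow> real) \<Rightarrow> (real \<Rightarrow> real) \<Rightarrow> real" where
  "Q \<alpha> \<beta> \<gamma> v w = \<alpha> * L2_inner v w + \<beta> * L2_inner v (hilbert (J w)) + \<gamma> * L2_inner (J v) (J w)"

lemma G_fun_V:
  assumes v: "v \<in> V"
  shows "G_fun l p \<alpha> \<beta> \<gamma> \<delta> v = Q \<alpha> \<beta> \<gamma> v v / 2 + \<delta> / 3 * (\<Sum>m<2 * p. W m * (v (nd m)) ^ 3)"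
proof -
  note Jv = J_V_in[OF v]
  note i = L2_integrable_mult[OF V_L2[OF v] V_L2[OF v]] L2_integrable_mult[OF V_L2[OF v] V_L2[OF H_in[OF Jv]]]
    L2_integrable_mult[OF V_L2[OF Jv] V_L2[OF Jv]] L2_integrable_mult[OF V_L2[OF v] V_L2[OF interp_in]]
  have "G_fun l p \<alpha> \<beta> \<gamma> \<delta> v = 1 / 2 * (LINT x|lborel. \<alpha> * (v x * v x) + \<beta> * (v x * hilbert (J v) x)
      + \<gamma> * (J v x * J v x) + 2 * \<delta> / 3 * (v x * interp l p (\<lambda>y. (v y)\<^sup>2) x))"
    unfolding G_fun_def power2_abs by (simp only: power2_eq_square mult.assoc)
  also have "(LINT x|lborel. \<alpha> * (v x * v x) + \<beta> * (v x * hilbert (J v) x)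
      + \<gamma> * (J v x * J v x) + 2 * \<delta> / 3 * (v x * interp l p (\<lambda>y. (v y)\<^sup>2) x))
      = \<alpha> * L2_inner v v + \<beta> * L2_inner v (hilbert (J v)) + \<gamma> * L2_inner (J v) (J v)
        + 2 * \<delta> / 3 * L2_inner v (interp l p (\<lambda>y. (v y)\<^sup>2))"
    unfolding L2_inner_def
    by (rule has_bochner_integral_integral_eq)
       (intro has_bochner_integral_add has_bochner_integral_mult_right has_bochner_integral_integrable i)
  also have "L2_inner v (interp l p (\<lambda>y. (v y)\<^sup>2)) = (\<Sum>m<2 * p. W m * (v (nd m)) ^ 3)"
    unfolding inner_interp[OF v] by (simp add: power3_eq_cube power2_eq_square mult.assoc)
  finally show ?thesis by (simp add: Q_def algebra_simps)
qed

lemma Q_sym: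
  assumes v: "v \<in> V" and w: "w \<in> V"
  shows "Q \<alpha> \<beta> \<gamma> v w = Q \<alpha> \<beta> \<gamma> w v"
  using HJ_sym[OF v w] by (simp add: Q_def L2_inner_commute)

lemma inner_lin_right:
  "u \<in> V \<Longrightarrow> v \<in> V \<Longrightarrow> w \<in> V \<Longrightarrow> L2_inner u (\<lambda>x. a * v x + b * w x) = a * L2_inner u v + b * L2_inner u w"
  by (simp add: L2_inner_commute[of u] L2_inner_add_left L2_inner_cmult_left V_L2 L2_fun_cmult)

lemma Q_lin_right:
  assumes u: "u \<in> V" and v: "v \<in> V" and w: "w \<in> V"
  shows "Q \<alpha> \<beta> \<gamma> u (\<lambda>x. a * v x + b * w x) = a * Q \<alpha> \<beta> \<gamma> u v + b * Q \<alpha> \<beta> \<gamma> u w"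
  unfolding Q_def J_lin[OF v w] H_lin[OF J_V_in[OF v] J_V_in[OF w]] inner_lin_right[OF u v w]
    inner_lin_right[OF u H_in[OF J_V_in[OF v]] H_in[OF J_V_in[OF w]]]
    inner_lin_right[OF J_V_in[OF u] J_V_in[OF v] J_V_in[OF w]]
  by (simp add: algebra_simps)

lemma Q_lin_left:
  assumes "u \<in> V" "v \<in> V" "w \<in> V"
  shows "Q \<alpha> \<beta> \<gamma> (\<lambda>x. a * v x + b * w x) u = a * Q \<alpha> \<beta> \<gamma> v u + b * Q \<alpha> \<beta> \<gamma> w u"
  using Q_lin_right[OF assms] assms by (simp add: Q_sym V_lin)

text \<open>Each of the three terms pairs an operator that is skew on the discrete space with a vector and
  itself.\<close>

lemma Q_J: "v \<in> V \<Longrightarrow> Q \<alpha> \<beta> \<gamma> v (J v) = 0"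
proof -
  assume v: "v \<in> V"
  note Jv = J_V_in[OF v]
  have 1: "L2_inner v (J v) = 0" using J_skew[OF v v] by (simp add: L2_inner_commute)
  have 2: "L2_inner v (hilbert (J (J v))) = 0"
    using HJ_sym[OF v Jv] H_skew[OF Jv Jv] by (simp add: L2_inner_commute)
  have 3: "L2_inner (J v) (J (J v)) = 0" using J_skew[OF Jv Jv] by (simp add: L2_inner_commute)
  show ?thesis by (simp add: Q_def 1 2 3)
qed

end

section \<open>Curves in the discrete space\<close>

context mtc_method
begin

text \<open>Differentiability is demanded of the coefficients, so that it passes through \<open>J\<close> and the Hilbert
  transform, which act linearly on finitely many coefficients.\<close>

definition curve_deriv :: "(real \<Rightarrow> real \<Rightarrow> real) \<Rightarrow> (real \<Rightarrow> real \<Rightarrow> real) \<Rightarrow> real set \<Rightarrow> bool" where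
  "curve_deriv c c' S \<longleftrightarrow> (\<forall>s\<in>S. c s \<in> V \<and> c' s \<in> V \<and>
     (\<forall>k<2 * p. ((\<lambda>r. cf (c r) k) has_real_derivative cf (c' s) k) (at s within S)))"

lemma curve_derivD:
  assumes "curve_deriv c c' S" "s \<in> S"
  shows "c s \<in> V" "c' s \<in> V"
    "k < 2 * p \<Longrightarrow> ((\<lambda>r. cf (c r) k) has_real_derivative cf (c' s) k) (at s within S)"
  using assms by (auto simp: curve_deriv_def)

lemma cf_nodes:
  assumes "v \<in> V" "k < 2 * p"
  shows "cf v k = (\<Sum>m<2 * p. W m * v (nd m) * mtc l k (nd m))"
  using cf_interp[OF assms(2), of v] interp_id[OF assms(1)] by simp

text \<open>Coefficients of elements of the discrete space are finite combinations of their node values.\<close>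

lemma curve_derivI:
  assumes "\<And>s. s \<in> S \<Longrightarrow> c s \<in> V" "\<And>s. s \<in> S \<Longrightarrow> c' s \<in> V"
    and D: "\<And>s x. s \<in> S \<Longrightarrow> ((\<lambda>r. c r x) has_real_derivative c' s x) (at s within S)"
  shows "curve_deriv c c' S"
  unfolding curve_deriv_def
proof (intro ballI conjI allI impI)
  fix s k assume s: "s \<in> S" and k: "k < 2 * p"
  have "((\<lambda>r. \<Sum>m<2 * p. W m * c r (nd m) * mtc l k (nd m)) has_real_derivative
      (\<Sum>m<2 * p. W m * c' s (nd m) * mtc l k (nd m))) (at s within S)"
    by (intro DERIV_sum DERIV_cmult_right DERIV_cmult D s)
  then show "((\<lambda>r. cf (c r) k) has_real_derivative cf (c' s) k) (at s within S)"
    unfolding cf_nodes[OF assms(2)[OF s] k]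
    by (rule has_field_derivative_transform_within[where d = 1])
       (use s cf_nodes[OF assms(1) k] in auto)
qed (use assms in auto)

lemma cf_J_sum:
  assumes v: "v \<in> V" and j: "j < 2 * p"
  shows "cf (J v) j = (\<Sum>k<2 * p. cf v k * cf (J (mtc l k)) j)"
proof -
  have "cf (deriv v) j = (\<Sum>k<2 * p. cf v k * cf (dmtc k) j)"
    unfolding deriv_mtc_space[OF v] cf_def[of _ j] atMost_dim
    by (rule L2_inner_sum_left) (auto intro: dmtc_L2 mtc_L2)
  moreover have "cf (J (mtc l k)) j = - cf (dmtc k) j" if "k < 2 * p" for k
    using cf_J[OF mtc_in_space j] that by (simp add: deriv_mtc le_dim)
  ultimately show ?thesis
    unfolding cf_J[OF v j] by (simp add: sum_negf[symmetric])
qed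

lemma curve_deriv_J:
  assumes c: "curve_deriv c c' S"
  shows "curve_deriv (\<lambda>s. J (c s)) (\<lambda>s. J (c' s)) S"
  unfolding curve_deriv_def
proof (intro ballI conjI allI impI)
  fix s assume s: "s \<in> S"
  note cs = curve_derivD[OF c s]
  show "J (c s) \<in> V" "J (c' s) \<in> V" using cs(1,2) by (auto intro: J_V_in)
  fix j assume j: "j < 2 * p"
  have "((\<lambda>r. \<Sum>k<2 * p. cf (c r) k * cf (J (mtc l k)) j) has_real_derivative
      (\<Sum>k<2 * p. cf (c' s) k * cf (J (mtc l k)) j)) (at s within S)"
    by (intro DERIV_sum DERIV_cmult_right cs(3)) auto
  then show "((\<lambda>r. cf (J (c r)) j) has_real_derivative cf (J (c' s)) j) (at s within S)"
    unfolding cf_J_sum[OF cs(2) j]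
    by (rule has_field_derivative_transform_within[where d = 1])
       (use s cf_J_sum[OF curve_derivD(1)[OF c] j] in auto)
qed

lemma curve_deriv_H:
  assumes c: "curve_deriv c c' S"
  shows "curve_deriv (\<lambda>s. hilbert (c s)) (\<lambda>s. hilbert (c' s)) S"
  unfolding curve_deriv_def
proof (intro ballI conjI allI impI)
  fix s assume s: "s \<in> S"
  note cs = curve_derivD[OF c s]
  show "hilbert (c s) \<in> V" "hilbert (c' s) \<in> V" using cs(1,2) by (auto intro: H_in)
  fix j assume j: "j < 2 * p"
  have "((\<lambda>r. - psign j * cf (c r) (partner j)) has_real_derivative
      - psign j * cf (c' s) (partner j)) (at s within S)"
    by (intro DERIV_cmult cs(3)) (use j in \<open>simp add: partner_less\<close>)
  then show "((\<lambda>r. cf (hilbert (c r)) j) has_real_derivative cf (hilbert (c' s)) j) (at s within S)"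
    unfolding cf_H[OF cs(2)]
    by (rule has_field_derivative_transform_within[where d = 1])
       (use s cf_H[OF curve_derivD(1)[OF c]] in auto)
qed

lemma curve_deriv_inner:
  assumes c: "curve_deriv c c' S" and d: "curve_deriv d d' S" and s: "s \<in> S"
  shows "((\<lambda>r. L2_inner (c r) (d r)) has_real_derivative
     L2_inner (c' s) (d s) + L2_inner (c s) (d' s)) (at s within S)"
proof -
  note cs = curve_derivD[OF c s] and ds = curve_derivD[OF d s]
  have "((\<lambda>r. \<Sum>k<2 * p. cf (c r) k * cf (d r) k) has_real_derivative
      (\<Sum>k<2 * p. cf (c' s) k * cf (d s) k + cf (d' s) k * cf (c s) k)) (at s within S)"
    by (intro DERIV_sum DERIV_mult cs(3) ds(3)) auto
  moreover have "(\<Sum>k<2 * p. cf (c' s) k * cf (d s) k + cf (d' s) k * cf (c s) k)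
      = L2_inner (c' s) (d s) + L2_inner (c s) (d' s)"
    unfolding inner_V[OF cs(2) ds(1)] inner_V[OF cs(1) ds(2)] sum.distrib by (simp add: mult.commute)
  ultimately have "((\<lambda>r. \<Sum>k<2 * p. cf (c r) k * cf (d r) k) has_real_derivative
      L2_inner (c' s) (d s) + L2_inner (c s) (d' s)) (at s within S)" by simp
  then show ?thesis
    by (rule has_field_derivative_transform_within[where d = 1])
       (use s in \<open>auto simp: inner_V curve_derivD(1)[OF c] curve_derivD(1)[OF d]\<close>)
qed

lemma curve_deriv_Q:
  assumes c: "curve_deriv c c' S" and s: "s \<in> S"
  shows "((\<lambda>r. Q \<alpha> \<beta> \<gamma> (c r) (c r) / 2) has_real_derivative Q \<alpha> \<beta> \<gamma> (c s) (c' s)) (at s within S)"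
proof -
  note cs = curve_derivD[OF c s]
  note cJ = curve_deriv_J[OF c]
  have "((\<lambda>r. Q \<alpha> \<beta> \<gamma> (c r) (c r)) has_real_derivative
     \<alpha> * (L2_inner (c' s) (c s) + L2_inner (c s) (c' s))
     + \<beta> * (L2_inner (c' s) (hilbert (J (c s))) + L2_inner (c s) (hilbert (J (c' s))))
     + \<gamma> * (L2_inner (J (c' s)) (J (c s)) + L2_inner (J (c s)) (J (c' s)))) (at s within S)"
    unfolding Q_def
    by (intro DERIV_add DERIV_cmult curve_deriv_inner c cJ curve_deriv_H s)
  moreover have "\<alpha> * (L2_inner (c' s) (c s) + L2_inner (c s) (c' s))
     + \<beta> * (L2_inner (c' s) (hilbert (J (c s))) + L2_inner (c s) (hilbert (J (c' s))))
     + \<gamma> * (L2_inner (J (c' s)) (J (c s)) + L2_inner (J (c s)) (J (c' s)))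
     = Q \<alpha> \<beta> \<gamma> (c' s) (c s) + Q \<alpha> \<beta> \<gamma> (c s) (c' s)"
    by (simp add: Q_def algebra_simps)
  ultimately have "((\<lambda>r. Q \<alpha> \<beta> \<gamma> (c r) (c r)) has_real_derivative 2 * Q \<alpha> \<beta> \<gamma> (c s) (c' s)) (at s within S)"
    using Q_sym[OF cs(1,2)] by simp
  from DERIV_cdivide[OF this, of 2] show ?thesis by simp
qed

end

section \<open>Regularity of the consistency error\<close>

lemma regular_dx:
  assumes "regular u"
  shows "k \<le> 3 \<Longrightarrow> C_L2 (dx k u)" "k \<le> 2 \<Longrightarrow> time_differentiable (dx k u)"
    "k \<le> 2 \<Longrightarrow> C_L2 (dt (dx k u))"
    "k < 3 \<Longrightarrow> t \<ge> 0 \<Longrightarrow> (dx k u t has_real_derivative dx (k + 1) u t x) (at x)"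
proof -
  show "k \<le> 3 \<Longrightarrow> C_L2 (dx k u)" "k \<le> 2 \<Longrightarrow> time_differentiable (dx k u)"
    "k \<le> 2 \<Longrightarrow> C_L2 (dt (dx k u))"
    using assms by (auto simp: regular_def time_differentiable_def)
  assume "k < 3" "t \<ge> 0"
  then have "dx k u t differentiable at x" using assms by (auto simp: regular_def)
  then show "(dx k u t has_real_derivative dx (k + 1) u t x) (at x)"
    by (simp add: dx_def DERIV_deriv_iff_real_differentiable flip: Suc_eq_plus1)
qed

lemma dx_zero: "dx 0 u = u"
  by (auto simp: dx_def)

lemma differentiable_if_DERIV: "(f has_real_derivative D) F \<Longrightarrow> f differentiable F"
  by (auto simp: differentiable_def has_field_derivative_def)

lemma pairing_differentiable:
  assumes "C_L2 v" "time_differentiable v" "C_L2 (dt v)" "L2_fun lborel \<phi>" "t \<ge> 0"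
  shows "(\<lambda>s. L2_inner (v s) \<phi>) differentiable at t within {0..}"
  by (rule differentiable_if_DERIV[OF C_L2_pairing_derivative[OF assms]])

context mtc_method
begin

lemma u_proj_at:
  assumes "L2_fun lborel (u t)"
  shows "u_proj l p u t = (\<lambda>x. \<Sum>k<2 * p. cf (u t) k * mtc l k x)"
  unfolding u_proj_def proj_eq[OF assms] atMost_dim ..

lemma u_proj_in: "L2_fun lborel (u t) \<Longrightarrow> u_proj l p u t \<in> V"
  unfolding u_proj_def by (rule proj_in_space)

lemma J_proj: "L2_fun lborel f \<Longrightarrow> J f = J (proj l (2 * p - 1) f)"
  using proj_id[OF proj_in_space[of f "2 * p - 1"]] by (simp only: Jop_def)

lemma cf_J_L2:
  assumes f: "L2_fun lborel f" and j: "j < 2 * p"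
  shows "cf (J f) j = (\<Sum>k<2 * p. cf f k * cf (J (mtc l k)) j)"
  unfolding J_proj[OF f] cf_J_sum[OF proj_in_space[OF f] j]
  by (intro sum.cong) (auto simp: cf_proj[OF f] le_dim)

lemma u_proj_time_derivative:
  assumes u: "C_L2 u" "time_differentiable u" "C_L2 (dt u)" and t: "t \<ge> 0"
  shows "((\<lambda>s. u_proj l p u s x) has_real_derivative (\<Sum>k<2 * p. cf (dt u t) k * mtc l k x)) (at t within {0..})"
    and "dt (u_proj l p u) t x = (\<Sum>k<2 * p. cf (dt u t) k * mtc l k x)"
proof -
  have "((\<lambda>s. \<Sum>k<2 * p. cf (u s) k * mtc l k x) has_real_derivative
      (\<Sum>k<2 * p. cf (dt u t) k * mtc l k x)) (at t within {0..})"
    unfolding cf_def by (intro DERIV_sum DERIV_cmult_right C_L2_pairing_derivative u mtc_L2 t)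
  then show d: "((\<lambda>s. u_proj l p u s x) has_real_derivative (\<Sum>k<2 * p. cf (dt u t) k * mtc l k x)) (at t within {0..})"
    by (rule has_field_derivative_transform_within[where d = 1])
       (use t in \<open>auto simp: u_proj_at C_L2D(1)[OF u(1)]\<close>)
  have "t islimpt {0..}"
  proof (rule connected_imp_perfect)
    show "{0..} \<noteq> {a}" for a :: real
    proof
      assume "{0..} = {a}"
      then have "0 = a" "1 = a" by (metis atLeast_iff order_refl singletonD, metis atLeast_iff zero_le_one singletonD)
      then show False by simp
    qed
  qed (use t in auto)
  then have "at t within {0..} \<noteq> bot" by (simp add: trivial_limit_within)
  then show "dt (u_proj l p u) t x = (\<Sum>k<2 * p. cf (dt u t) k * mtc l k x)"
    unfolding dt_def[of "u_proj l p u"] using d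
    by (intro vector_derivative_within) (simp_all add: has_real_derivative_iff_has_vector_derivative)
qed

lemma mtc_sum_jointly_continuous:
  assumes "\<And>k. k < 2 * p \<Longrightarrow> continuous_on {0..T} (\<lambda>t. a t k)"
  shows "continuous_on ({0..T} \<times> UNIV) (\<lambda>(t, x). \<Sum>k<2 * p. a t k * mtc l k x)"
  unfolding case_prod_beta
proof (intro continuous_on_sum continuous_on_mult)
  fix k assume "k \<in> {..<2 * p}"
  then show "continuous_on ({0..T} \<times> UNIV) (\<lambda>z. a (fst z) k)"
    by (intro continuous_on_compose2[OF assms, of k]) (auto intro!: continuous_intros)
  show "continuous_on ({0..T} \<times> UNIV) (\<lambda>z. mtc l k (snd z))"
    by (rule continuous_on_compose2[OF mtc_continuous[of UNIV]]) (auto intro!: continuous_intros)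
qed

text \<open>Every ingredient is expressed by values of the solution, by its \<open>L\<^sup>2\<close> pairings with fixed functions
  and by finite sums; all of these are differentiable in time.\<close>

lemma grad_D_formula:
  assumes u: "regular u" and t: "t \<ge> 0"
  shows "grad_D l p \<alpha> \<beta> \<gamma> \<delta> u t x =
     \<alpha> * (u t x - u_proj l p u t x)
     - \<beta> * ((1 / pi) * (L2_inner (dx 1 u t) (far_kernel x) - L2_inner (dx 2 u t) (near_kernel x))
         + (\<Sum>j<2 * p. cf (J (u t)) j * (psign j * mtc l (partner j) x)))
     - \<gamma> * (dx 2 u t x - (\<Sum>j<2 * p. cf (J (J (u t))) j * mtc l j x))
     + \<delta> * ((u t x)\<^sup>2 - (\<Sum>k<2 * p. (\<Sum>m<2 * p. W m * (u_proj l p u t (nd m))\<^sup>2 * mtc l k (nd m)) * mtc l k x))"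
proof -
  note C = regular_dx(1)[OF u]
  have L: "L2_fun lborel (u t)" using C_L2D(1)[OF C[of 0] t] by (simp add: dx_zero)
  have L1: "L2_fun lborel (dx 1 u t)" and L2: "L2_fun lborel (dx 2 u t)"
    using C_L2D(1)[OF C t] by auto
  note Ju = J_in[OF L]
  have c2: "continuous_on UNIV (dx 2 u t)"
    using regular_dx(4)[OF u, of 2 t] t
    by (intro DERIV_atLeastAtMost_imp_continuous_on continuous_at_imp_continuous_on ballI DERIV_isCont) auto
  have "hilbert (\<lambda>y. dx 1 u t y + J (u t) y) x = (1 / pi) *
      (L2_inner (\<lambda>y. dx 1 u t y + J (u t) y) (far_kernel x)
       - L2_inner (\<lambda>y. dx 2 u t y + deriv (J (u t)) y) (near_kernel x))"
  proof (rule hilbert_L2_representation)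
    show "((\<lambda>y. dx 1 u t y + J (u t) y) has_real_derivative dx 2 u t y + deriv (J (u t)) y) (at y)" for y
      using regular_dx(4)[OF u, of 1 t y] t by (intro DERIV_add deriv_has[OF Ju]) (simp add: numeral_2_eq_2 One_nat_def)
    show "continuous_on UNIV (\<lambda>y. dx 2 u t y + deriv (J (u t)) y)"
      by (intro continuous_on_add c2 deriv_continuous[OF Ju])
  qed (intro L2_fun_add L1 L2 V_L2[OF Ju] deriv_L2[OF Ju])+
  also have "\<dots> = (1 / pi) * (L2_inner (dx 1 u t) (far_kernel x) - L2_inner (dx 2 u t) (near_kernel x))
      + (1 / pi) * (L2_inner (J (u t)) (far_kernel x) - L2_inner (deriv (J (u t))) (near_kernel x))"
    unfolding L2_inner_add_left[OF L1 V_L2[OF Ju] far_kernel_L2] L2_inner_add_left[OF L2 deriv_L2[OF Ju] near_kernel_L2]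
    by (simp add: algebra_simps)
  also have "(1 / pi) * (L2_inner (J (u t)) (far_kernel x) - L2_inner (deriv (J (u t))) (near_kernel x)) = hilbert (J (u t)) x"
    by (rule hilbert_L2_representation[symmetric])
       (auto intro: deriv_has[OF Ju] deriv_continuous[OF Ju] V_L2[OF Ju] deriv_L2[OF Ju])
  also have "hilbert (J (u t)) x = (\<Sum>j<2 * p. cf (J (u t)) j * (psign j * mtc l (partner j) x))"
    using hilbert_mtc_space[OF Ju] unfolding atMost_dim by metis
  finally have h: "hilbert (\<lambda>y. dx 1 u t y + J (u t) y) x
      = (1 / pi) * (L2_inner (dx 1 u t) (far_kernel x) - L2_inner (dx 2 u t) (near_kernel x))
         + (\<Sum>j<2 * p. cf (J (u t)) j * (psign j * mtc l (partner j) x))" .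
  have i: "interp l p (\<lambda>y. (u_proj l p u t y)\<^sup>2) x
      = (\<Sum>k<2 * p. (\<Sum>m<2 * p. W m * (u_proj l p u t (nd m))\<^sup>2 * mtc l k (nd m)) * mtc l k x)"
    unfolding interp_eq atMost_dim ..
  show ?thesis
    unfolding grad_D_def Let_def h i V_at[OF J_V_in[OF Ju], of x] ..
qed

lemma grad_D_time_differentiable:
  assumes u: "regular u"
  shows "time_differentiable (grad_D l p \<alpha> \<beta> \<gamma> \<delta> u)"
  unfolding time_differentiable_def
proof (intro allI impI)
  fix t x :: real assume t: "t \<ge> 0"
  note C = regular_dx(1)[OF u] and T = regular_dx(2)[OF u] and C' = regular_dx(3)[OF u]
  have L: "L2_fun lborel (u s)" if "s \<ge> 0" for s using C_L2D(1)[OF C[of 0] that] by (simp add: dx_zero)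
  let ?F = "at t within {0..}"
  have dd: "(\<lambda>s. dx k u s x) differentiable ?F" if "k \<le> 2" for k
    using T[OF that] t by (auto simp: time_differentiable_def)
  have d0: "(\<lambda>s. u s x) differentiable ?F" using dd[of 0] by (simp add: dx_zero)
  have pr: "(\<lambda>s. L2_inner (dx k u s) \<phi>) differentiable ?F" if "k \<le> 2" "L2_fun lborel \<phi>" for k \<phi>
    by (rule pairing_differentiable) (use C T C' that t in auto)
  have dc: "(\<lambda>s. cf (u s) k) differentiable ?F" for k
    using pr[of 0, OF _ mtc_L2] by (simp add: dx_zero cf_def)
  have tr: "g differentiable ?F" if "f differentiable ?F" "\<And>s. s \<ge> 0 \<Longrightarrow> f s = g s" for f g :: "real \<Rightarrow> real"
    by (rule differentiable_transform_within[OF that(1), of 1]) (use that(2) t in auto)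
  have dp: "(\<lambda>s. u_proj l p u s y) differentiable ?F" for y
    by (rule tr[of "\<lambda>s. \<Sum>k<2 * p. cf (u s) k * mtc l k y"])
       (auto simp: u_proj_at L intro!: derivative_intros dc)
  have dJ: "(\<lambda>s. cf (J (u s)) j) differentiable ?F" if "j < 2 * p" for j
    by (rule tr[of "\<lambda>s. \<Sum>k<2 * p. cf (u s) k * cf (J (mtc l k)) j"])
       (auto simp: cf_J_L2[OF L that] intro!: derivative_intros dc)
  have dJJ: "(\<lambda>s. cf (J (J (u s))) j) differentiable ?F" if "j < 2 * p" for j
    by (rule tr[of "\<lambda>s. \<Sum>k<2 * p. cf (J (u s)) k * cf (J (mtc l k)) j"])
       (auto simp: cf_J_L2[OF V_L2[OF J_in[OF L]] that] intro!: derivative_intros dJ)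
  show "(\<lambda>s. grad_D l p \<alpha> \<beta> \<gamma> \<delta> u s x) differentiable ?F"
    by (rule tr[OF _ grad_D_formula[OF u, symmetric]])
       (auto intro!: derivative_intros d0 dd dp dJ dJJ pr far_kernel_L2 near_kernel_L2)
qed

end

section \<open>Bootstrap and Gronwall\<close>

text \<open>The differential inequality is known only while \<open>B * N t \<le> 1\<close>. Gronwall's bound, applied up to
  the first time at which \<open>B * N\<close> would reach one, is strictly below that threshold.\<close>

lemma bootstrap_gronwall:
  fixes N N' :: "real \<Rightarrow> real"
  assumes D: "\<And>t. t \<in> {0..T} \<Longrightarrow> (N has_real_derivative N' t) (at t within {0..T})"
    and nn: "\<And>t. t \<in> {0..T} \<Longrightarrow> 0 \<le> N t"
    and K: "0 \<le> K" and A: "0 \<le> A" and B: "0 \<le> B" and N0: "N 0 \<le> A"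
    and est: "\<And>t. t \<in> {0..T} \<Longrightarrow> B * N t \<le> 1 \<Longrightarrow> \<bar>N' t\<bar> \<le> K * (A + N t + integral {0..t} N)"
    and small: "B * (2 * A * exp ((K + 1) * T)) < 1"
    and t: "t \<in> {0..T}"
  shows "N t \<le> 2 * A * exp ((K + 1) * T)"
proof -
  let ?I = "\<lambda>t. integral {0..t} N" and ?R = "2 * A * exp ((K + 1) * T)"
  have cN: "continuous_on {0..T} N"
    using D by (meson DERIV_continuous continuous_on_eq_continuous_within)
  have I: "(?I has_real_derivative N t) (at t within {0..T})" if "t \<in> {0..T}" for t
    unfolding has_real_derivative_iff_has_vector_derivative
    by (rule integral_has_vector_derivative[OF cN that])
  have Inn: "0 \<le> ?I t" if "t \<in> {0..T}" for t
    by (rule integral_nonneg) (use that nn in \<open>auto intro!: integrable_continuous_real continuous_on_subset[OF cN]\<close>)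
  \<comment> \<open>The derivative of \<open>?Y\<close> is bounded by a multiple of \<open>?Y\<close> itself, because it contains the integral.\<close>
  let ?Y = "\<lambda>t. A + N t + ?I t"
  let ?z = "\<lambda>t. ?Y t * exp (- ((K + 1) * t))"
  have gron: "N s \<le> ?R" if s: "s \<in> {0..T}" and lt: "\<And>t. 0 \<le> t \<Longrightarrow> t < s \<Longrightarrow> B * N t < 1" for s
  proof -
    have z: "(?z has_real_derivative (N' t + N t - (K + 1) * ?Y t) * exp (- ((K + 1) * t))) (at t within {0..T})"
      if "t \<in> {0..T}" for t
      using D[OF that] I[OF that] by (auto intro!: derivative_eq_intros simp: algebra_simps)
    have cz: "continuous_on {0..T} ?z"
      using z by (meson DERIV_continuous continuous_on_eq_continuous_within)
    have "?z s \<le> ?z 0"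
    proof (cases "s = 0")
      case False
      show ?thesis
      proof (rule DERIV_nonpos_imp_decreasing_open[of 0 s ?z])
        show "0 \<le> s" using s by simp
        show "continuous_on {0..s} ?z" by (rule continuous_on_subset[OF cz]) (use s in auto)
        fix t assume t: "0 < t" "t < s"
        then have tT: "t \<in> {0..T}" using s by auto
        have "at t within {0..T} = at t" using t s by (intro at_within_Icc_at) auto
        then have "(?z has_real_derivative (N' t + N t - (K + 1) * ?Y t) * exp (- ((K + 1) * t))) (at t)"
          using z[OF tT] by simp
        moreover have "(N' t + N t - (K + 1) * ?Y t) * exp (- ((K + 1) * t)) \<le> 0"
        proof (rule mult_nonpos_nonneg)
          have "N' t \<le> K * ?Y t" using est[OF tT] lt[of t] t by auto
          moreover have "N t \<le> ?Y t" using A Inn[OF tT] by simp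
          ultimately show "N' t + N t - (K + 1) * ?Y t \<le> 0" by (simp add: distrib_right)
        qed simp
        ultimately show "\<exists>y. (?z has_real_derivative y) (at t) \<and> y \<le> 0" by blast
      qed
    qed simp
    then have "?Y s * exp (- ((K + 1) * s)) \<le> 2 * A" using N0 by simp
    then have "?Y s * exp (- ((K + 1) * s)) * exp ((K + 1) * s) \<le> 2 * A * exp ((K + 1) * s)"
      by (rule mult_right_mono) simp
    moreover have "?Y s * exp (- ((K + 1) * s)) * exp ((K + 1) * s) = ?Y s"
      by (simp only: mult.assoc exp_add[symmetric]) simp
    ultimately have "?Y s \<le> 2 * A * exp ((K + 1) * s)" by simp
    also have "\<dots> \<le> ?R" using s K A by (intro mult_left_mono) auto
    finally show ?thesis using A Inn[OF s] by simp
  qed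
  have "B * N s < 1" if s: "s \<in> {0..T}" for s
  proof (rule ccontr)
    assume "\<not> B * N s < 1"
    let ?S = "{t \<in> {0..T}. 1 \<le> B * N t}"
    have "closed ?S"
      by (rule continuous_on_closed_Collect_le) (auto intro!: continuous_intros cN)
    moreover have "bounded ?S" by (rule bounded_subset[of "{0..T}"]) auto
    ultimately have "compact ?S" by (simp only: compact_eq_bounded_closed)
    moreover have "?S \<noteq> {}" using s \<open>\<not> B * N s < 1\<close> by auto
    ultimately have "\<exists>r\<in>?S. \<forall>t\<in>?S. r \<le> t" by (rule compact_attains_inf)
    then obtain r where r: "r \<in> ?S" "\<And>t. t \<in> ?S \<Longrightarrow> r \<le> t" by blast
    have "N r \<le> ?R"
      by (rule gron) (use r in force)+
    then have "B * N r \<le> B * ?R" using B by (rule mult_left_mono)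
    then show False using small r(1) by simp
  qed
  then show ?thesis using gron[OF t] t by auto
qed

text \<open>The gradient is determined by directional derivatives, and these can be computed by calculus in
  one real variable.\<close>

lemma has_L2_gradient_direction:
  assumes g: "has_L2_gradient V F v g"
    and V: "\<And>s. (\<lambda>x. s * h x) \<in> V"
    and D: "((\<lambda>s. F (\<lambda>x. v x + s * h x)) has_real_derivative D) (at 0)"
  shows "L2_inner g h = D"
proof -
  have n: "L2_norm lborel (\<lambda>x. s * h x) = \<bar>s\<bar> * L2_norm lborel h" for s
    by (simp add: L2_norm_def power_mult_distrib real_sqrt_mult)
  have i: "L2_inner g (\<lambda>x. s * h x) = s * L2_inner g h" for s
    by (simp add: L2_inner_commute[of g] L2_inner_cmult_left)
  let ?n = "L2_norm lborel h"
  have "((\<lambda>s. F (\<lambda>x. v x + s * h x)) has_real_derivative L2_inner g h) (at 0)"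
    unfolding has_field_derivative_def has_derivative_at_alt
  proof (intro conjI allI impI)
    show "bounded_linear ((*) (L2_inner g h))" by (rule bounded_linear_mult_right)
    fix r :: real assume r: "0 < r"
    let ?eta = "r / (?n + 1)"
    have np: "0 < ?n + 1" using L2_norm_nonneg[of lborel h] by linarith
    then have "0 < ?eta" using r by simp
    then obtain d where d: "d > 0" "\<And>k. k \<in> V \<Longrightarrow> L2_norm lborel k < d \<Longrightarrow>
        \<bar>F (\<lambda>x. v x + k x) - F v - L2_inner g k\<bar> \<le> ?eta * L2_norm lborel k"
      using g unfolding has_L2_gradient_def by blast
    show "\<exists>d>0. \<forall>y. norm (y - 0) < d \<longrightarrow>
        norm (F (\<lambda>x. v x + y * h x) - F (\<lambda>x. v x + 0 * h x) - L2_inner g h * (y - 0)) \<le> r * norm (y - 0)"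
    proof (intro exI[of _ "d / (?n + 1)"] conjI allI impI)
      show "0 < d / (?n + 1)" using d(1) np by simp
      fix y :: real assume "norm (y - 0) < d / (?n + 1)"
      then have "\<bar>y\<bar> * (?n + 1) < d" using np by (simp add: pos_less_divide_eq)
      moreover have "\<bar>y\<bar> * ?n \<le> \<bar>y\<bar> * (?n + 1)" by (intro mult_left_mono) auto
      ultimately have "L2_norm lborel (\<lambda>x. y * h x) < d" unfolding n by linarith
      from d(2)[OF V this] have "\<bar>F (\<lambda>x. v x + y * h x) - F v - y * L2_inner g h\<bar> \<le> ?eta * (\<bar>y\<bar> * ?n)"
        unfolding n i .
      also have "\<dots> = \<bar>y\<bar> * (?eta * ?n)" by (simp add: mult.commute mult.left_commute)
      also have "?eta * ?n \<le> r"
      proof -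
        have "?eta * ?n \<le> ?eta * (?n + 1)" using \<open>0 < ?eta\<close> by (intro mult_left_mono) auto
        also have "\<dots> = r" using np by simp
        finally show ?thesis .
      qed
      then have "\<bar>y\<bar> * (?eta * ?n) \<le> \<bar>y\<bar> * r" by (intro mult_left_mono) auto
      finally show "norm (F (\<lambda>x. v x + y * h x) - F (\<lambda>x. v x + 0 * h x) - L2_inner g h * (y - 0)) \<le> r * norm (y - 0)"
        by (simp add: mult.commute)
    qed
  qed
  then show ?thesis by (rule DERIV_unique[OF _ D])
qed

section \<open>The energy of the error\<close>

locale error_evolution = mtc_method +
  fixes \<alpha> \<beta> \<gamma> \<delta> C T :: real and u0 :: "real \<Rightarrow> real" and u e :: "real \<Rightarrow> real \<Rightarrow> real"
  assumes gamma: "\<gamma> \<noteq> 0" and C_pos: "C > 0" and T_pos: "T > 0"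
    and reg: "regular u" and u0: "u 0 = u0"
    and sol: "error_solution l p \<alpha> \<beta> \<gamma> \<delta> T u0 u e"
    and bound_u: "Linf_norm (slab T) (\<lambda>(t, x). u_proj l p u t x) < ereal C"
    and bound_ut: "Linf_norm (slab T) (\<lambda>(t, x). dt (u_proj l p u) t x) < ereal C"
    and gD_slab: "L2_fun (slab T) (\<lambda>(t, x). grad_D l p \<alpha> \<beta> \<gamma> \<delta> u t x)"
    and dgD_slab: "L2_fun (slab T) (\<lambda>(t, x). dt (grad_D l p \<alpha> \<beta> \<gamma> \<delta> u) t x)"
begin

abbreviation gD :: "real \<Rightarrow> real \<Rightarrow> real" where "gD \<equiv> grad_D l p \<alpha> \<beta> \<gamma> \<delta> u"

abbreviation up :: "real \<Rightarrow> real \<Rightarrow> real" where "up \<equiv> u_proj l p u"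

definition data_sq :: real where "data_sq = (data_size l p \<alpha> \<beta> \<gamma> \<delta> T u0 u)\<^sup>2"

lemma u_C: "C_L2 u" "time_differentiable u" "C_L2 (dt u)"
  using regular_dx(1-3)[OF reg, of 0] by (simp_all add: dx_zero)

lemma u_L2: "t \<ge> 0 \<Longrightarrow> L2_fun lborel (u t)"
  by (rule C_L2D(1)[OF u_C(1)])

lemma up_in: "t \<ge> 0 \<Longrightarrow> up t \<in> V"
  by (rule u_proj_in[where u = u, OF u_L2])

lemma up_bound:
  assumes t: "t \<in> {0..T}" shows "\<bar>up t x\<bar> \<le> C"
proof -
  have "continuous_on ({0..T} \<times> UNIV) (\<lambda>(t, x). \<Sum>k<2 * p. cf (u t) k * mtc l k x)"
    unfolding cf_def
    by (intro mtc_sum_jointly_continuous continuous_on_subset[OF C_L2_pairing_continuous[OF u_C(1) mtc_L2]]) auto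
  then have "continuous_on ({0..T} \<times> UNIV) (\<lambda>(t, x). up t x)"
    by (rule continuous_on_eq) (auto simp: u_proj_at[where u = u, OF u_L2])
  from slab_bound[OF T_pos this bound_u, of "(t, x)"] t show ?thesis by simp
qed

lemma up_dt: "t \<ge> 0 \<Longrightarrow> ((\<lambda>s. up s x) has_real_derivative dt up t x) (at t within {0..})"
  using u_proj_time_derivative[OF u_C] by simp

lemma dup_bound:
  assumes t: "t \<in> {0..T}" shows "\<bar>dt up t x\<bar> \<le> C"
proof -
  have "continuous_on ({0..T} \<times> UNIV) (\<lambda>(t, x). \<Sum>k<2 * p. cf (dt u t) k * mtc l k x)"
    unfolding cf_def
    by (intro mtc_sum_jointly_continuous continuous_on_subset[OF C_L2_pairing_continuous[OF u_C(3) mtc_L2]]) auto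
  then have "continuous_on ({0..T} \<times> UNIV) (\<lambda>(t, x). dt up t x)"
    by (rule continuous_on_eq) (auto simp: u_proj_time_derivative(2)[OF u_C])
  from slab_bound[OF T_pos this bound_ut, of "(t, x)"] t show ?thesis by simp
qed

lemma gD_deriv:
  assumes "t \<in> {0..T}"
  shows "((\<lambda>s. gD s x) has_real_derivative dt gD t x) (at t within {0..T})"
  by (rule has_field_derivative_subset[OF time_derivative[OF grad_D_time_differentiable[OF reg]]])
     (use assms in auto)

lemma data_bounds:
  "(L2_norm lborel (e 0))\<^sup>2 \<le> data_sq"
  "\<bar>G_fun l p \<alpha> \<beta> \<gamma> \<delta> (\<lambda>x. - e 0 x)\<bar> + \<bar>E_fun l p \<delta> u (e 0) 0\<bar> + \<bar>D_fun l p \<alpha> \<beta> \<gamma> \<delta> u (e 0) 0\<bar> \<le> data_sq"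
  "(L2_norm (slab T) (\<lambda>(t, x). gD t x))\<^sup>2 \<le> data_sq"
  "(L2_norm (slab T) (\<lambda>(t, x). dt gD t x))\<^sup>2 \<le> data_sq"
proof -
  have e0: "e 0 = err0 l p u0" using sol by (simp add: error_solution_def)
  let ?a = "L2_norm lborel (e 0)" and ?b = "\<bar>G_fun l p \<alpha> \<beta> \<gamma> \<delta> (\<lambda>x. - e 0 x)\<bar>"
    and ?c = "\<bar>E_fun l p \<delta> u (e 0) 0\<bar>" and ?d = "\<bar>D_fun l p \<alpha> \<beta> \<gamma> \<delta> u (e 0) 0\<bar>"
    and ?f = "L2_norm (slab T) (\<lambda>(t, x). gD t x)" and ?g = "L2_norm (slab T) (\<lambda>(t, x). dt gD t x)"
  have data_sq: "data_sq = (?a + sqrt ?b + sqrt ?c + sqrt ?d + ?f + ?g)\<^sup>2"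
    by (simp add: data_sq_def data_size_def Let_def e0)
  have nn: "0 \<le> ?a" "0 \<le> sqrt ?b" "0 \<le> sqrt ?c" "0 \<le> sqrt ?d" "0 \<le> ?f" "0 \<le> ?g"
    by (auto simp: L2_norm_nonneg)
  show "?a\<^sup>2 \<le> data_sq" "?f\<^sup>2 \<le> data_sq" "?g\<^sup>2 \<le> data_sq"
    unfolding data_sq by (intro power_mono; use nn in linarith)+
  have sq: "x\<^sup>2 + y\<^sup>2 + z\<^sup>2 \<le> (x + y + z)\<^sup>2" if "0 \<le> x" "0 \<le> y" "0 \<le> z" for x y z :: real
    using that by (simp add: power2_eq_square algebra_simps)
  have "?b + ?c + ?d = (sqrt ?b)\<^sup>2 + (sqrt ?c)\<^sup>2 + (sqrt ?d)\<^sup>2" by simp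
  also have "\<dots> \<le> (sqrt ?b + sqrt ?c + sqrt ?d)\<^sup>2" by (rule sq) (use nn in auto)
  also have "\<dots> \<le> data_sq" unfolding data_sq by (intro power_mono; use nn in linarith)
  finally show "?b + ?c + ?d \<le> data_sq" .
qed

lemma data_sq_nonneg: "0 \<le> data_sq"
  by (simp add: data_sq_def)

lemma gD_envelope:
  obtains M where "L2_fun lborel M" "AE x in lborel. \<forall>t\<in>{0..T}. \<bar>gD t x\<bar> \<le> M x"
    "(L2_norm lborel M)\<^sup>2 \<le> (2 / T + 2 * T) * data_sq"
proof -
  obtain M where M: "L2_fun lborel M" "AE x in lborel. \<forall>t\<in>{0..T}. \<bar>gD t x\<bar> \<le> M x"
    "(L2_norm lborel M)\<^sup>2 \<le> 2 / T * (L2_norm (slab T) (\<lambda>(t, x). gD t x))\<^sup>2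
       + 2 * T * (L2_norm (slab T) (\<lambda>(t, x). dt gD t x))\<^sup>2"
    by (rule slab_envelope[OF T_pos gD_deriv gD_slab dgD_slab])
  note M(3)
  also have "2 / T * (L2_norm (slab T) (\<lambda>(t, x). gD t x))\<^sup>2
       + 2 * T * (L2_norm (slab T) (\<lambda>(t, x). dt gD t x))\<^sup>2 \<le> 2 / T * data_sq + 2 * T * data_sq"
    using T_pos data_bounds(3,4) by (intro add_mono mult_left_mono) auto
  also have "\<dots> = (2 / T + 2 * T) * data_sq" by (simp add: algebra_simps)
  finally show ?thesis using that M(1,2) by blast
qed

lemma gD_measurable: "t \<in> {0..T} \<Longrightarrow> gD t \<in> borel_measurable lborel"
  by (rule slab_measurable_section[OF L2_funD(1)[OF gD_slab]])

lemma gD_at: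
  assumes t: "t \<in> {0..T}"
  shows "L2_fun lborel (gD t)" "(L2_norm lborel (gD t))\<^sup>2 \<le> (2 / T + 2 * T) * data_sq"
proof -
  obtain M where M: "L2_fun lborel M" "AE x in lborel. \<forall>t\<in>{0..T}. \<bar>gD t x\<bar> \<le> M x"
    "(L2_norm lborel M)\<^sup>2 \<le> (2 / T + 2 * T) * data_sq" by (rule gD_envelope)
  have ae: "AE x in lborel. \<bar>gD t x\<bar> \<le> 1 * \<bar>M x\<bar>"
    using M(2) by eventually_elim (use t in force)
  show L: "L2_fun lborel (gD t)" by (rule L2_fun_bound[OF M(1) gD_measurable[OF t] ae])
  have "(L2_norm lborel (gD t))\<^sup>2 \<le> (L2_norm lborel M)\<^sup>2"
    unfolding L2_norm_sq
  proof (rule integral_mono_AE[OF L2_funD(2)[OF L] L2_funD(2)[OF M(1)]])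
    show "AE x in lborel. (gD t x)\<^sup>2 \<le> (M x)\<^sup>2"
      using ae by eventually_elim (simp add: abs_le_square_iff)
  qed
  then show "(L2_norm lborel (gD t))\<^sup>2 \<le> (2 / T + 2 * T) * data_sq" using M(3) by simp
qed

text \<open>Dominated convergence with the envelope. The continuity in time of the consistency error as an
  element of \<open>L\<^sup>2\<close> is replaced by this weak form.\<close>

lemma gD_pairing_continuous:
  assumes phi: "L2_fun lborel \<phi>"
  shows "continuous_on {0..T} (\<lambda>t. L2_inner \<phi> (gD t))"
proof -
  obtain M where M: "L2_fun lborel M" "AE x in lborel. \<forall>t\<in>{0..T}. \<bar>gD t x\<bar> \<le> M x"
    "(L2_norm lborel M)\<^sup>2 \<le> (2 / T + 2 * T) * data_sq" by (rule gD_envelope)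
  show ?thesis
    unfolding continuous_on_sequentially
  proof (intro allI ballI impI)
    fix s a assume a: "a \<in> {0..T}" and s: "(\<forall>n. s n \<in> {0..T}) \<and> s \<longlonglongrightarrow> a"
    have "(\<lambda>n. LINT x|lborel. \<phi> x * gD (s n) x) \<longlonglongrightarrow> (LINT x|lborel. \<phi> x * gD a x)"
    proof (rule integral_dominated_convergence[where w = "\<lambda>x. \<bar>\<phi> x * M x\<bar>"])
      show "(\<lambda>x. \<phi> x * gD a x) \<in> borel_measurable lborel"
        using L2_funD(1)[OF phi] gD_measurable[OF a] by (rule borel_measurable_times)
      show "(\<lambda>x. \<phi> x * gD (s n) x) \<in> borel_measurable lborel" for n
        using L2_funD(1)[OF phi] gD_measurable[of "s n"] s by (intro borel_measurable_times) auto
      show "integrable lborel (\<lambda>x. \<bar>\<phi> x * M x\<bar>)"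
        by (rule integrable_abs[OF L2_integrable_mult[OF phi M(1)]])
      show "AE x in lborel. norm (\<phi> x * gD (s n) x) \<le> \<bar>\<phi> x * M x\<bar>" for n
        using M(2)
      proof eventually_elim
        fix x assume "\<forall>t\<in>{0..T}. \<bar>gD t x\<bar> \<le> M x"
        moreover have "s n \<in> {0..T}" using s by blast
        ultimately have "\<bar>gD (s n) x\<bar> \<le> M x" by blast
        then have "\<bar>gD (s n) x\<bar> \<le> \<bar>M x\<bar>" by linarith
        then show "norm (\<phi> x * gD (s n) x) \<le> \<bar>\<phi> x * M x\<bar>"
          by (simp add: abs_mult mult_left_mono)
      qed
      show "AE x in lborel. (\<lambda>n. \<phi> x * gD (s n) x) \<longlonglongrightarrow> \<phi> x * gD a x"
      proof (intro AE_I2 tendsto_mult tendsto_const)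
        fix x
        have "continuous_on {0..T} (\<lambda>t. gD t x)"
          using gD_deriv by (meson DERIV_continuous continuous_on_eq_continuous_within)
        then show "(\<lambda>n. gD (s n) x) \<longlonglongrightarrow> gD a x"
          using s a unfolding continuous_on_sequentially by (auto simp: o_def)
      qed
    qed
    then show "((\<lambda>t. L2_inner \<phi> (gD t)) \<circ> s) \<longlonglongrightarrow> L2_inner \<phi> (gD a)"
      by (simp add: L2_inner_def o_def)
  qed
qed

text \<open>The functional whose gradient drives the error equation.\<close>

definition F :: "real \<Rightarrow> (real \<Rightarrow> real) \<Rightarrow> real" where
  "F t w = G_fun l p \<alpha> \<beta> \<gamma> \<delta> (\<lambda>x. - w x) + E_fun l p \<delta> u w t + D_fun l p \<alpha> \<beta> \<gamma> \<delta> u w t"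

text \<open>A gradient for which the error equation holds; it exists at every time by assumption.\<close>

definition gr :: "real \<Rightarrow> real \<Rightarrow> real" where
  "gr t = (SOME g. has_L2_gradient V (F t) (e t) g \<and>
     (\<forall>x. ((\<lambda>s. e s x) has_real_derivative J g x) (at t within {0..T})))"

abbreviation e' :: "real \<Rightarrow> real \<Rightarrow> real" where "e' t \<equiv> J (gr t)"

lemma gr:
  assumes "t \<in> {0..T}"
  shows "has_L2_gradient V (F t) (e t) (gr t)"
    "((\<lambda>s. e s x) has_real_derivative e' t x) (at t within {0..T})"
proof -
  have "\<exists>g. has_L2_gradient V (F t) (e t) g \<and>
     (\<forall>x. ((\<lambda>s. e s x) has_real_derivative J g x) (at t within {0..T}))"
    using sol assms unfolding error_solution_def F_def[abs_def] by blast
  from someI_ex[OF this, folded gr_def]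
  show "has_L2_gradient V (F t) (e t) (gr t)"
    "((\<lambda>s. e s x) has_real_derivative e' t x) (at t within {0..T})" by auto
qed

lemma e_in: "t \<in> {0..T} \<Longrightarrow> e t \<in> V"
  using sol by (simp add: error_solution_def)

lemma gr_in: "t \<in> {0..T} \<Longrightarrow> gr t \<in> V"
  using gr(1) by (simp add: has_L2_gradient_def)

lemma e_curve: "curve_deriv e e' {0..T}"
  by (rule curve_derivI[OF e_in J_V_in[OF gr_in] gr(2)])

text \<open>On the discrete space the interpolation terms become sums over the nodes, so that the energy is
  a polynomial in finitely many node values and coefficients.\<close>

lemma F_V:
  assumes t: "t \<in> {0..T}" and w: "w \<in> V"
  shows "F t w = Q \<alpha> \<beta> \<gamma> w w / 2 - \<delta> / 3 * (\<Sum>m<2 * p. W m * w (nd m) ^ 3)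
     + \<delta> * (\<Sum>m<2 * p. W m * (up t (nd m) * (w (nd m))\<^sup>2)) + L2_inner w (gD t)"
proof -
  have m: "(\<lambda>x. - w x) \<in> V" by (rule mtc_space_minus[OF w])
  have "(\<lambda>x. - w x) = (\<lambda>x. (-1) * w x + 0 * w x)" by simp
  then have "Q \<alpha> \<beta> \<gamma> (\<lambda>x. - w x) (\<lambda>x. - w x) = Q \<alpha> \<beta> \<gamma> w w"
    using Q_lin_right[OF V_lin[OF w w] w w, of \<alpha> \<beta> \<gamma> "-1" 0 "-1" 0] Q_lin_left[OF w w w, of \<alpha> \<beta> \<gamma> "-1" 0]
    by simp
  moreover have "(\<Sum>m<2 * p. W m * (- w (nd m)) ^ 3) = - (\<Sum>m<2 * p. W m * w (nd m) ^ 3)"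
    by (simp add: sum_negf[symmetric])
  moreover have "L2_inner (up t) (interp l p (\<lambda>y. (w y)\<^sup>2)) = (\<Sum>m<2 * p. W m * (up t (nd m) * (w (nd m))\<^sup>2))"
    using inner_interp[OF up_in, of t "\<lambda>y. (w y)\<^sup>2"] t by (simp add: mult.commute mult.left_commute)
  ultimately show ?thesis
    by (simp add: F_def G_fun_V[OF m] E_fun_def D_fun_def)
qed

text \<open>The directional derivative of the energy at the error.\<close>

definition dF :: "real \<Rightarrow> (real \<Rightarrow> real) \<Rightarrow> real" where
  "dF t h = Q \<alpha> \<beta> \<gamma> (e t) h - \<delta> * (\<Sum>m<2 * p. W m * ((e t (nd m))\<^sup>2 * h (nd m)))
     + 2 * \<delta> * (\<Sum>m<2 * p. W m * (up t (nd m) * (e t (nd m) * h (nd m)))) + L2_inner h (gD t)"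

lemma gr_inner:
  assumes t: "t \<in> {0..T}" and h: "h \<in> V"
  shows "L2_inner (gr t) h = dF t h"
proof (rule has_L2_gradient_direction[OF gr(1)[OF t]])
  have cube: "((\<lambda>s. (a + s * b) ^ 3) has_real_derivative 3 * a\<^sup>2 * b) (at 0)" for a b :: real
    by (auto intro!: derivative_eq_intros simp: power2_eq_square)
  have square: "((\<lambda>s. (a + s * b)\<^sup>2) has_real_derivative 2 * a * b) (at 0)" for a b :: real
    by (auto intro!: derivative_eq_intros)
  have quadratic: "((\<lambda>s. (a + 2 * s * b + s\<^sup>2 * c) / 2) has_real_derivative b) (at 0)" for a b c :: real
    by (auto intro!: derivative_eq_intros)
  have linear: "((\<lambda>s. a + s * b) has_real_derivative b) (at 0)" for a b :: real
    by (auto intro!: derivative_eq_intros)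
  note et = e_in[OF t]
  show "(\<lambda>x. s * h x) \<in> V" for s by (rule mtc_space_cmult[OF h])
  have w: "(\<lambda>x. e t x + s * h x) \<in> V" for s using V_lin[OF et h, of 1 s] by simp
  have q: "Q \<alpha> \<beta> \<gamma> (\<lambda>x. e t x + s * h x) (\<lambda>x. e t x + s * h x)
      = Q \<alpha> \<beta> \<gamma> (e t) (e t) + 2 * s * Q \<alpha> \<beta> \<gamma> (e t) h + s\<^sup>2 * Q \<alpha> \<beta> \<gamma> h h" for s
    using Q_lin_right[OF w et h, of \<alpha> \<beta> \<gamma> s 1 s] Q_lin_left[OF et et h, of \<alpha> \<beta> \<gamma> 1 s]
      Q_lin_left[OF h et h, of \<alpha> \<beta> \<gamma> 1 s] Q_sym[OF et h, of \<alpha> \<beta> \<gamma>]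
    by (simp add: power2_eq_square algebra_simps)
  have i: "L2_inner (\<lambda>x. e t x + s * h x) (gD t) = L2_inner (e t) (gD t) + s * L2_inner h (gD t)" for s
    by (simp add: L2_inner_add_left L2_inner_cmult_left V_L2 et h L2_fun_cmult gD_at(1)[OF t])
  have "F t (\<lambda>x. e t x + s * h x) = (Q \<alpha> \<beta> \<gamma> (e t) (e t) + 2 * s * Q \<alpha> \<beta> \<gamma> (e t) h + s\<^sup>2 * Q \<alpha> \<beta> \<gamma> h h) / 2
     - \<delta> / 3 * (\<Sum>m<2 * p. W m * (e t (nd m) + s * h (nd m)) ^ 3)
     + \<delta> * (\<Sum>m<2 * p. W m * (up t (nd m) * (e t (nd m) + s * h (nd m))\<^sup>2))
     + (L2_inner (e t) (gD t) + s * L2_inner h (gD t))" for s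
    unfolding F_V[OF t w] q i ..
  moreover have "((\<lambda>s. (Q \<alpha> \<beta> \<gamma> (e t) (e t) + 2 * s * Q \<alpha> \<beta> \<gamma> (e t) h + s\<^sup>2 * Q \<alpha> \<beta> \<gamma> h h) / 2
     - \<delta> / 3 * (\<Sum>m<2 * p. W m * (e t (nd m) + s * h (nd m)) ^ 3)
     + \<delta> * (\<Sum>m<2 * p. W m * (up t (nd m) * (e t (nd m) + s * h (nd m))\<^sup>2))
     + (L2_inner (e t) (gD t) + s * L2_inner h (gD t))) has_real_derivative
     (Q \<alpha> \<beta> \<gamma> (e t) h - \<delta> / 3 * (\<Sum>m<2 * p. W m * (3 * (e t (nd m))\<^sup>2 * h (nd m)))
     + \<delta> * (\<Sum>m<2 * p. W m * (up t (nd m) * (2 * e t (nd m) * h (nd m)))) + L2_inner h (gD t))) (at 0)"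
    by (intro DERIV_add DERIV_diff DERIV_cmult DERIV_sum cube square quadratic linear)
  moreover have "Q \<alpha> \<beta> \<gamma> (e t) h - \<delta> / 3 * (\<Sum>m<2 * p. W m * (3 * (e t (nd m))\<^sup>2 * h (nd m)))
     + \<delta> * (\<Sum>m<2 * p. W m * (up t (nd m) * (2 * e t (nd m) * h (nd m)))) + L2_inner h (gD t) = dF t h"
    by (simp add: dF_def sum_distrib_left mult.assoc mult.commute mult.left_commute)
  ultimately show "((\<lambda>s. F t (\<lambda>x. e t x + s * h x)) has_real_derivative dF t h) (at 0)" by simp
qed

end

section \<open>Growth of the error norm\<close>

text \<open>The three summands in the second factor are the coefficients of the squared data, of \<open>N\<close> and of the
  time integral of \<open>N\<close> in the energy estimate. The factor \<open>4 / \<bar>\<gamma>\<bar>\<close> appears because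
  \<open>\<bar>\<gamma>\<bar> / 4\<close> is left of the coefficient \<open>\<bar>\<gamma>\<bar> / 2\<close> of \<open>X\<close> after two portions of \<open>\<bar>\<gamma>\<bar> / 8\<close> are absorbed.\<close>

definition energy_rate :: "real \<Rightarrow> real \<Rightarrow> real \<Rightarrow> real \<Rightarrow> real \<Rightarrow> real \<Rightarrow> real" where
  "energy_rate \<alpha> \<beta> \<gamma> \<delta> C T = 4 / \<bar>\<gamma>\<bar> * ((3 / 2 + 1 / T + T)
     + (\<bar>\<alpha>\<bar> / 2 + \<beta>\<^sup>2 / (2 * \<bar>\<gamma>\<bar>) + \<bar>\<gamma>\<bar> / 8 + 2 * \<delta>\<^sup>2 / (9 * \<bar>\<gamma>\<bar>) + \<bar>\<delta>\<bar> * C + 1 / 2)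
     + (\<bar>\<delta>\<bar> * C + 1 / 2))"

definition growth_rate :: "real \<Rightarrow> real \<Rightarrow> real \<Rightarrow> real \<Rightarrow> real \<Rightarrow> real \<Rightarrow> real" where
  "growth_rate \<alpha> \<beta> \<gamma> \<delta> C T = (2 * \<bar>\<delta>\<bar> + 2 * \<bar>\<delta>\<bar> * C + 1 + 2 / T + 2 * T)
     * (1 + energy_rate \<alpha> \<beta> \<gamma> \<delta> C T)"

lemma young: "0 < c \<Longrightarrow> a * b \<le> c * a\<^sup>2 + b\<^sup>2 / (4 * c)" for a b c :: real
proof -
  assume c: "0 < c"
  have "0 \<le> (2 * c * a - b)\<^sup>2 / (4 * c)" using c by simp
  also have "\<dots> = c * a\<^sup>2 + b\<^sup>2 / (4 * c) - a * b"
    using c by (simp add: power2_eq_square field_simps)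
  finally show ?thesis by simp
qed

lemma weighted_sum_le:
  fixes a b c :: real
  assumes "0 \<le> a" "0 \<le> b" "0 \<le> c" "x \<le> k" "y \<le> k" "z \<le> k"
  shows "x * a + y * b + z * c \<le> k * (a + b + c)"
  using mult_right_mono[OF assms(4,1)] mult_right_mono[OF assms(5,2)] mult_right_mono[OF assms(6,3)]
  by (simp add: distrib_left)

lemma energy_rate_nonneg: "T > 0 \<Longrightarrow> C > 0 \<Longrightarrow> 0 \<le> energy_rate \<alpha> \<beta> \<gamma> \<delta> C T"
  unfolding energy_rate_def by (intro mult_nonneg_nonneg add_nonneg_nonneg) auto

lemma growth_rate_nonneg: "T > 0 \<Longrightarrow> C > 0 \<Longrightarrow> 0 \<le> growth_rate \<alpha> \<beta> \<gamma> \<delta> C T"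
  unfolding growth_rate_def
  by (intro mult_nonneg_nonneg add_nonneg_nonneg energy_rate_nonneg) auto

text \<open>\<open>n\<close>, \<open>x\<close>, \<open>g\<close>, \<open>m\<close> stand for the norms of \<open>e\<close>, \<open>J e\<close> and the consistency error and for
  an upper bound of \<open>\<bar>e\<bar>\<close>, and \<open>H\<close> for the energy.\<close>

lemma energy_controls_derivative:
  fixes n x g m H I A :: real
  assumes "\<gamma> \<noteq> 0" "C > 0" "T > 0" "0 \<le> n" "0 \<le> x" "0 \<le> g" "0 \<le> m" "0 \<le> A" "0 \<le> I"
    and m: "(m * n)\<^sup>2 \<le> n\<^sup>2 + x\<^sup>2"
    and g: "g\<^sup>2 \<le> (2 / T + 2 * T) * A"
    and H: "\<bar>H\<bar> \<le> 3 / 2 * A + (\<bar>\<delta>\<bar> * C + 1 / 2) * I"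
    and E: "\<bar>\<gamma>\<bar> / 2 * x\<^sup>2 \<le> \<bar>H\<bar> + \<bar>\<alpha>\<bar> / 2 * n\<^sup>2 + \<bar>\<beta>\<bar> / 2 * (n * x) + \<bar>\<delta>\<bar> / 3 * (m * n * n) + \<bar>\<delta>\<bar> * (C * n * n) + n * g"
  shows "x\<^sup>2 \<le> energy_rate \<alpha> \<beta> \<gamma> \<delta> C T * (A + n\<^sup>2 + I)"
proof -
  define G where "G = \<bar>\<gamma>\<bar>"
  have G: "G > 0" using assms(1) by (simp add: G_def)
  have 1: "\<bar>\<beta>\<bar> / 2 * (n * x) \<le> G / 8 * x\<^sup>2 + \<beta>\<^sup>2 / (2 * G) * n\<^sup>2"
  proof -
    have "x * (\<bar>\<beta>\<bar> / 2 * n) \<le> G / 8 * x\<^sup>2 + (\<bar>\<beta>\<bar> / 2 * n)\<^sup>2 / (4 * (G / 8))" by (rule young) (use G in simp)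
    also have "(\<bar>\<beta>\<bar> / 2 * n)\<^sup>2 / (4 * (G / 8)) = \<beta>\<^sup>2 / (2 * G) * n\<^sup>2"
      using G by (simp add: power2_eq_square field_simps)
    finally show ?thesis by (simp add: mult.commute mult.left_commute)
  qed
  have 2: "\<bar>\<delta>\<bar> / 3 * (m * n * n) \<le> G / 8 * (n\<^sup>2 + x\<^sup>2) + 2 * \<delta>\<^sup>2 / (9 * G) * n\<^sup>2"
  proof -
    have "(m * n) * (\<bar>\<delta>\<bar> / 3 * n) \<le> G / 8 * (m * n)\<^sup>2 + (\<bar>\<delta>\<bar> / 3 * n)\<^sup>2 / (4 * (G / 8))" by (rule young) (use G in simp)
    also have "(\<bar>\<delta>\<bar> / 3 * n)\<^sup>2 / (4 * (G / 8)) = 2 * \<delta>\<^sup>2 / (9 * G) * n\<^sup>2"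
      using G by (simp add: power2_eq_square field_simps)
    also have "G / 8 * (m * n)\<^sup>2 \<le> G / 8 * (n\<^sup>2 + x\<^sup>2)" using m G by (intro mult_left_mono) auto
    finally show ?thesis by (simp add: mult.commute mult.left_commute)
  qed
  have 3: "n * g \<le> 1 / 2 * n\<^sup>2 + (1 / T + T) * A"
  proof -
    have "n * g \<le> 1 / 2 * n\<^sup>2 + g\<^sup>2 / (4 * (1 / 2))" by (rule young) simp
    also have "g\<^sup>2 / (4 * (1 / 2)) \<le> ((2 / T + 2 * T) * A) / 2" using g by simp
    also have "((2 / T + 2 * T) * A) / 2 = (1 / T + T) * A" by (simp add: field_simps)
    finally show ?thesis by simp
  qed
  let ?k0 = "3 / 2 + 1 / T + T"
  let ?k1 = "\<bar>\<alpha>\<bar> / 2 + \<beta>\<^sup>2 / (2 * G) + G / 8 + 2 * \<delta>\<^sup>2 / (9 * G) + \<bar>\<delta>\<bar> * C + 1 / 2"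
  let ?k2 = "\<bar>\<delta>\<bar> * C + 1 / 2"
  have k: "0 \<le> ?k0" "0 \<le> ?k1" "0 \<le> ?k2" using assms(2,3) G by auto
  have "G / 2 * x\<^sup>2 \<le> (3 / 2 * A + ?k2 * I) + \<bar>\<alpha>\<bar> / 2 * n\<^sup>2 + (G / 8 * x\<^sup>2 + \<beta>\<^sup>2 / (2 * G) * n\<^sup>2)
      + (G / 8 * (n\<^sup>2 + x\<^sup>2) + 2 * \<delta>\<^sup>2 / (9 * G) * n\<^sup>2) + \<bar>\<delta>\<bar> * (C * n * n) + (1 / 2 * n\<^sup>2 + (1 / T + T) * A)"
    using E H 1 2 3 unfolding G_def[symmetric] by linarith
  moreover have "(3 / 2 * A + k2 * I) + a * n2 + (G / 8 * x2 + b * n2) + (G / 8 * (n2 + x2) + d * n2) + c * n2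
      + (1 / 2 * n2 + tT * A)
    = (3 / 2 + tT) * A + (a + b + G / 8 + d + c + 1 / 2) * n2 + k2 * I + G / 4 * x2" for a b c d tT k2 n2 x2
    by (simp add: field_simps)
  moreover have "\<bar>\<delta>\<bar> * (C * n * n) = (\<bar>\<delta>\<bar> * C) * n\<^sup>2" by (simp add: power2_eq_square)
  ultimately have "G / 2 * x\<^sup>2 \<le> (3 / 2 + (1 / T + T)) * A + ?k1 * n\<^sup>2 + ?k2 * I + G / 4 * x\<^sup>2"
    by (simp only:)
  then have "G / 4 * x\<^sup>2 \<le> ?k0 * A + ?k1 * n\<^sup>2 + ?k2 * I"
    by (simp only: add.assoc)
  also have "\<dots> \<le> (?k0 + ?k1 + ?k2) * (A + n\<^sup>2 + I)"
    by (rule weighted_sum_le[OF assms(8) zero_le_power2 assms(9)]) (use k in linarith)+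
  finally have "4 / G * (G / 4 * x\<^sup>2) \<le> 4 / G * ((?k0 + ?k1 + ?k2) * (A + n\<^sup>2 + I))"
    using G by (intro mult_left_mono) auto
  moreover have "4 / G * (G / 4 * x\<^sup>2) = x\<^sup>2" using G by simp
  ultimately show ?thesis
    unfolding energy_rate_def G_def[symmetric] by (simp only: mult.assoc)
qed

lemma growth_bound:
  fixes n x g m I A :: real
  assumes "\<gamma> \<noteq> 0" "C > 0" "T > 0" "0 \<le> n" "0 \<le> x" "0 \<le> g" "0 \<le> m" "0 \<le> A" "0 \<le> I"
    and m: "(m * n)\<^sup>2 \<le> n\<^sup>2 + x\<^sup>2"
    and g: "g\<^sup>2 \<le> (2 / T + 2 * T) * A"
    and X: "x\<^sup>2 \<le> energy_rate \<alpha> \<beta> \<gamma> \<delta> C T * (A + n\<^sup>2 + I)"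
    and N': "\<bar>N'\<bar> \<le> 2 * (\<bar>\<delta>\<bar> * (m * n * x) + 2 * \<bar>\<delta>\<bar> * (C * n * x) + x * g)"
  shows "\<bar>N'\<bar> \<le> growth_rate \<alpha> \<beta> \<gamma> \<delta> C T * (A + n\<^sup>2 + I)"
proof -
  let ?K = "2 * \<bar>\<delta>\<bar> + 2 * \<bar>\<delta>\<bar> * C + 1 + 2 / T + 2 * T"
  have "(m * n) * x \<le> 1 / 2 * (m * n)\<^sup>2 + x\<^sup>2 / (4 * (1 / 2))" by (rule young) simp
  then have "m * n * x \<le> n\<^sup>2 + x\<^sup>2" using m zero_le_power2[of n] by linarith
  then have 1: "\<bar>\<delta>\<bar> * (m * n * x) \<le> \<bar>\<delta>\<bar> * (n\<^sup>2 + x\<^sup>2)" by (intro mult_left_mono) auto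
  have nx: "n * x \<le> 1 / 2 * n\<^sup>2 + x\<^sup>2 / (4 * (1 / 2))" by (rule young) simp
  then have "(2 * \<bar>\<delta>\<bar> * C) * (n * x) \<le> (2 * \<bar>\<delta>\<bar> * C) * (1 / 2 * (n\<^sup>2 + x\<^sup>2))"
    using assms(2) by (intro mult_left_mono) auto
  then have 2: "2 * \<bar>\<delta>\<bar> * (C * n * x) \<le> \<bar>\<delta>\<bar> * C * (n\<^sup>2 + x\<^sup>2)" by (simp add: mult.assoc)
  have "x * g \<le> 1 / 2 * x\<^sup>2 + g\<^sup>2 / (4 * (1 / 2))" by (rule young) simp
  then have 3: "2 * (x * g) \<le> x\<^sup>2 + (2 / T + 2 * T) * A" using g by simp
  have "\<bar>N'\<bar> \<le> 2 * (\<bar>\<delta>\<bar> * (n\<^sup>2 + x\<^sup>2)) + 2 * (\<bar>\<delta>\<bar> * C * (n\<^sup>2 + x\<^sup>2)) + (x\<^sup>2 + (2 / T + 2 * T) * A)"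
  proof -
    have "2 * (a + b + c) \<le> 2 * a' + 2 * b' + c'" if "a \<le> a'" "b \<le> b'" "2 * c \<le> c'" for a b c a' b' c' :: real
      using that unfolding distrib_left by (intro add_mono) auto
    from order_trans[OF N' this[OF 1 2 3]] show ?thesis .
  qed
  also have "\<dots> = (2 / T + 2 * T) * A + (2 * \<bar>\<delta>\<bar> + 2 * \<bar>\<delta>\<bar> * C) * n\<^sup>2 + (2 * \<bar>\<delta>\<bar> + 2 * \<bar>\<delta>\<bar> * C + 1) * x\<^sup>2"
    by (simp add: algebra_simps)
  also have "\<dots> \<le> ?K * (A + n\<^sup>2 + x\<^sup>2)"
  proof (rule weighted_sum_le[OF assms(8) zero_le_power2 zero_le_power2])
    have "0 \<le> \<bar>\<delta>\<bar>" "0 \<le> \<bar>\<delta>\<bar> * C" "0 \<le> 2 / T" using assms(2,3) by auto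
    then show "2 / T + 2 * T \<le> ?K" "2 * \<bar>\<delta>\<bar> + 2 * \<bar>\<delta>\<bar> * C \<le> ?K" "2 * \<bar>\<delta>\<bar> + 2 * \<bar>\<delta>\<bar> * C + 1 \<le> ?K"
      using assms(3) by auto
  qed
  also have "\<dots> \<le> ?K * ((A + n\<^sup>2 + I) + energy_rate \<alpha> \<beta> \<gamma> \<delta> C T * (A + n\<^sup>2 + I))"
    using X assms(2,3,9) by (intro mult_left_mono) auto
  also have "\<dots> = growth_rate \<alpha> \<beta> \<gamma> \<delta> C T * (A + n\<^sup>2 + I)"
  proof -
    have "k * (y + r * y) = k * (1 + r) * y" for k r y :: real by (simp add: algebra_simps)
    then show ?thesis unfolding growth_rate_def .
  qed
  finally show ?thesis .
qed

context mtc_method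
begin

text \<open>Cauchy-Schwarz with respect to the nonnegative weights, followed by exactness of the quadrature.\<close>

lemma node_bound:
  assumes v: "v \<in> V" and w: "w \<in> V" and a: "\<And>m. \<bar>a m\<bar> \<le> K"
  shows "\<bar>\<Sum>m<2 * p. W m * (a m * (v (nd m) * w (nd m)))\<bar> \<le> K * L2_norm lborel v * L2_norm lborel w"
proof -
  have K: "0 \<le> K" using a[of 0] by simp
  let ?x = "\<lambda>m. sqrt (W m) * \<bar>v (nd m)\<bar>" and ?y = "\<lambda>m. sqrt (W m) * \<bar>w (nd m)\<bar>"
  have "\<bar>\<Sum>m<2 * p. W m * (a m * (v (nd m) * w (nd m)))\<bar> \<le> (\<Sum>m<2 * p. K * (?x m * ?y m))"
  proof (rule order_trans[OF sum_abs], rule sum_mono)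
    fix m
    have "?x m * ?y m = W m * (\<bar>v (nd m)\<bar> * \<bar>w (nd m)\<bar>)"
    proof -
      have "?x m * ?y m = (sqrt (W m) * sqrt (W m)) * (\<bar>v (nd m)\<bar> * \<bar>w (nd m)\<bar>)" by (simp only: ac_simps)
      then show ?thesis using W_nonneg[of m] by simp
    qed
    then have "K * (?x m * ?y m) = W m * (K * (\<bar>v (nd m)\<bar> * \<bar>w (nd m)\<bar>))" by (simp add: mult.left_commute)
    moreover have "\<bar>a m\<bar> * (\<bar>v (nd m)\<bar> * \<bar>w (nd m)\<bar>) \<le> K * (\<bar>v (nd m)\<bar> * \<bar>w (nd m)\<bar>)"
      using a by (intro mult_right_mono) auto
    then have "W m * (\<bar>a m\<bar> * (\<bar>v (nd m)\<bar> * \<bar>w (nd m)\<bar>)) \<le> W m * (K * (\<bar>v (nd m)\<bar> * \<bar>w (nd m)\<bar>))"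
      by (rule mult_left_mono[OF _ W_nonneg])
    moreover have "\<bar>W m * (a m * (v (nd m) * w (nd m)))\<bar> = W m * (\<bar>a m\<bar> * (\<bar>v (nd m)\<bar> * \<bar>w (nd m)\<bar>))"
      using W_nonneg[of m] by (simp only: abs_mult abs_of_nonneg)
    ultimately show "\<bar>W m * (a m * (v (nd m) * w (nd m)))\<bar> \<le> K * (?x m * ?y m)" by linarith
  qed
  also have "\<dots> = K * (\<Sum>m<2 * p. ?x m * ?y m)" by (simp only: sum_distrib_left)
  also have "(\<Sum>m<2 * p. ?x m * ?y m) \<le> L2_norm lborel v * L2_norm lborel w"
  proof (rule power2_le_imp_le)
    have "(\<Sum>m<2 * p. (sqrt (W m) * \<bar>f (nd m)\<bar>)\<^sup>2) = (L2_norm lborel f)\<^sup>2" if "f \<in> V" for f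
      unfolding L2_inner_self[symmetric] inner_nodes[OF that that]
      by (intro sum.cong refl)
         (simp only: power_mult_distrib real_sqrt_pow2[OF W_nonneg] power2_abs, simp only: power2_eq_square)
    then show "(\<Sum>m<2 * p. ?x m * ?y m)\<^sup>2 \<le> (L2_norm lborel v * L2_norm lborel w)\<^sup>2"
      using Cauchy_Schwarz_ineq_sum[of ?x ?y "{..<2 * p}"] v w by (simp add: power_mult_distrib)
  qed (simp add: L2_norm_nonneg)
  finally show ?thesis using K by (simp add: mult_left_mono mult.assoc)
qed

lemma continuous_curve_slab:
  assumes c: "\<And>t. t \<in> {0..T} \<Longrightarrow> c t \<in> V"
    and k: "\<And>k. k < 2 * p \<Longrightarrow> continuous_on {0..T} (\<lambda>t. cf (c t) k)"
  shows "L2_fun (slab T) (\<lambda>(t, x). c t x)"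
proof (rule slab_L2I)
  have "continuous_on ({0..T} \<times> UNIV) (\<lambda>(t, x). \<Sum>k<2 * p. cf (c t) k * mtc l k x)"
    by (rule mtc_sum_jointly_continuous[OF k])
  then have "continuous_on ({0..T} \<times> UNIV) (\<lambda>(t, x). c t x)"
    by (rule continuous_on_eq) (auto simp: V_at[OF c])
  then show "(\<lambda>(t, x). c t x) \<in> borel_measurable (slab T)" by (rule slab_measurable_continuous)
  have "continuous_on {0..T} (\<lambda>t. sqrt (\<Sum>k<2 * p. cf (c t) k * cf (c t) k))"
    by (intro continuous_intros k) auto
  then show "continuous_on {0..T} (\<lambda>t. L2_norm lborel (c t))"
  proof (rule continuous_on_eq)
    fix t assume "t \<in> {0..T}"
    then show "sqrt (\<Sum>k<2 * p. cf (c t) k * cf (c t) k) = L2_norm lborel (c t)"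
      using L2_inner_self[of "c t"] by (simp add: inner_V[OF c c] L2_norm_nonneg)
  qed
qed (use c V_L2 in auto)

lemma curve_inner_continuous:
  assumes c: "curve_deriv c c' S" and w: "w \<in> V"
  shows "continuous_on S (\<lambda>t. L2_inner (c t) w)"
proof -
  have "continuous_on S (\<lambda>t. cf (c t) k)" if "k < 2 * p" for k
    using curve_derivD(3)[OF c _ that] by (meson DERIV_continuous continuous_on_eq_continuous_within)
  then have "continuous_on S (\<lambda>t. \<Sum>k<2 * p. cf (c t) k * cf w k)"
    by (intro continuous_intros) auto
  then show ?thesis
    by (rule continuous_on_eq) (simp add: inner_V[OF curve_derivD(1)[OF c] w])
qed

end

context error_evolution
begin

abbreviation enorm :: "real \<Rightarrow> real" where "enorm t \<equiv> L2_norm lborel (e t)"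

abbreviation Jnorm :: "real \<Rightarrow> real" where "Jnorm t \<equiv> L2_norm lborel (J (e t))"

definition N :: "real \<Rightarrow> real" where "N t = L2_inner (e t) (e t)"

text \<open>The energy of the error without the pairing with the consistency error. It is differentiable in
  the classical sense; the remaining pairing is treated in integrated form.\<close>

definition S :: "real \<Rightarrow> real" where
  "S t = Q \<alpha> \<beta> \<gamma> (e t) (e t) / 2 - \<delta> / 3 * (\<Sum>m<2 * p. W m * e t (nd m) ^ 3)
     + \<delta> * (\<Sum>m<2 * p. W m * (up t (nd m) * (e t (nd m))\<^sup>2))"

definition dS :: "real \<Rightarrow> real" where
  "dS t = - L2_inner (e' t) (gD t) + \<delta> * (\<Sum>m<2 * p. W m * (dt up t (nd m) * (e t (nd m) * e t (nd m))))"

lemma N_eq: "N t = (enorm t)\<^sup>2"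
  by (simp add: N_def L2_inner_self)

lemma up_deriv:
  assumes "t \<in> {0..T}"
  shows "((\<lambda>s. up s x) has_real_derivative dt up t x) (at t within {0..T})"
  by (rule has_field_derivative_subset[OF up_dt]) (use assms in auto)

text \<open>The energy gradient annihilates the velocity \<open>e' = J (gr t)\<close> by skewness. So only the explicit time
  dependence of the projected solution contributes, and the omitted pairing with the consistency error
  appears with a minus sign.\<close>

lemma S_deriv:
  assumes t: "t \<in> {0..T}"
  shows "(S has_real_derivative dS t) (at t within {0..T})"
proof -
  note et = e_in[OF t] and e't = J_V_in[OF gr_in[OF t]]
  have cube: "((\<lambda>s. e s x ^ 3) has_real_derivative 3 * (e t x)\<^sup>2 * e' t x) (at t within {0..T})" for x
    using gr(2)[OF t, of x] by (auto intro!: derivative_eq_intros simp: power2_eq_square)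
  have mixed: "((\<lambda>s. up s x * (e s x)\<^sup>2) has_real_derivative
      dt up t x * (e t x * e t x) + up t x * (2 * (e t x * e' t x))) (at t within {0..T})" for x
    using gr(2)[OF t, of x] up_deriv[OF t, of x]
    by (auto intro!: derivative_eq_intros simp: power2_eq_square)
  have "(S has_real_derivative Q \<alpha> \<beta> \<gamma> (e t) (e' t)
     - \<delta> / 3 * (\<Sum>m<2 * p. W m * (3 * (e t (nd m))\<^sup>2 * e' t (nd m)))
     + \<delta> * (\<Sum>m<2 * p. W m * (dt up t (nd m) * (e t (nd m) * e t (nd m)) + up t (nd m) * (2 * (e t (nd m) * e' t (nd m)))))) (at t within {0..T})"
    unfolding S_def[abs_def]
    by (intro DERIV_add DERIV_diff DERIV_cmult DERIV_sum cube mixed curve_deriv_Q[OF e_curve t])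
  moreover have "Q \<alpha> \<beta> \<gamma> (e t) (e' t)
     - \<delta> / 3 * (\<Sum>m<2 * p. W m * (3 * (e t (nd m))\<^sup>2 * e' t (nd m)))
     + \<delta> * (\<Sum>m<2 * p. W m * (dt up t (nd m) * (e t (nd m) * e t (nd m)) + up t (nd m) * (2 * (e t (nd m) * e' t (nd m)))))
     = dF t (e' t) + dS t"
    by (simp add: dF_def dS_def sum_distrib_left sum.distrib algebra_simps)
  moreover have "dF t (e' t) = 0"
    using gr_inner[OF t e't] J_skew[OF gr_in[OF t] gr_in[OF t]] by (simp add: L2_inner_commute)
  ultimately show ?thesis by simp
qed

lemma pointwise_continuous:
  "continuous_on {0..T} (\<lambda>t. e t x)" "continuous_on {0..T} (\<lambda>t. up t x)"
  using gr(2) up_deriv by (meson DERIV_continuous continuous_on_eq_continuous_within)+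

lemma cf_e'_continuous:
  assumes k: "k < 2 * p"
  shows "continuous_on {0..T} (\<lambda>t. cf (e' t) k)"
proof -
  have "continuous_on {0..T} (\<lambda>t. dF t (mtc l j))" if j: "j < 2 * p" for j
  proof -
    have m: "mtc l j \<in> V" using mtc_in_space[of j "2 * p - 1"] j by (simp add: le_dim)
    show ?thesis
      unfolding dF_def Q_def
      by (intro continuous_intros pointwise_continuous gD_pairing_continuous[OF mtc_L2]
          curve_inner_continuous[OF e_curve] curve_inner_continuous[OF curve_deriv_J[OF e_curve]]
          J_V_in H_in m)
  qed
  then have "continuous_on {0..T} (\<lambda>t. \<Sum>j<2 * p. dF t (mtc l j) * cf (J (mtc l j)) k)"
    by (intro continuous_intros) auto
  then show ?thesis
  proof (rule continuous_on_eq)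
    fix t assume t: "t \<in> {0..T}"
    have "cf (gr t) j = dF t (mtc l j)" if "j < 2 * p" for j
      using gr_inner[OF t mtc_in_space] that by (simp add: cf_def le_dim)
    then show "(\<Sum>j<2 * p. dF t (mtc l j) * cf (J (mtc l j)) k) = cf (e' t) k"
      by (simp add: cf_J_sum[OF gr_in[OF t] k])
  qed
qed

lemma cf_e_continuous: "k < 2 * p \<Longrightarrow> continuous_on {0..T} (\<lambda>t. cf (e t) k)"
  using curve_derivD(3)[OF e_curve] by (meson DERIV_continuous continuous_on_eq_continuous_within)

lemma e_slab: "L2_fun (slab T) (\<lambda>(t, x). e t x)"
  by (rule continuous_curve_slab[OF e_in cf_e_continuous])

lemma e'_slab: "L2_fun (slab T) (\<lambda>(t, x). e' t x)"
  by (rule continuous_curve_slab[OF J_V_in[OF gr_in] cf_e'_continuous])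

end

context error_evolution
begin

lemma N_deriv:
  assumes t: "t \<in> {0..T}"
  shows "(N has_real_derivative 2 * L2_inner (e t) (e' t)) (at t within {0..T})"
  using curve_deriv_inner[OF e_curve e_curve t] unfolding N_def
  by (simp add: L2_inner_commute[of "e' t"])

lemma N_continuous: "continuous_on {0..T} N"
  using N_deriv by (meson DERIV_continuous continuous_on_eq_continuous_within)

lemma N_nonneg: "0 \<le> N t"
  by (simp add: N_eq)

lemma dS_continuous: "continuous_on {0..T} dS"
proof -
  have "continuous_on {0..T} (\<lambda>t. \<Sum>k<2 * p. L2_inner (mtc l k) (gD t) * cf (e' t) k)"
    by (intro continuous_intros gD_pairing_continuous mtc_L2 cf_e'_continuous) auto
  then have 1: "continuous_on {0..T} (\<lambda>t. L2_inner (e' t) (gD t))"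
  proof (rule continuous_on_eq)
    fix t assume t: "t \<in> {0..T}"
    show "(\<Sum>k<2 * p. L2_inner (mtc l k) (gD t) * cf (e' t) k) = L2_inner (e' t) (gD t)"
      using parseval[OF gD_at(1)[OF t] J_V_in[OF gr_in[OF t]]] unfolding atMost_dim
      by (simp add: cf_def[of "gD t"] L2_inner_commute[of "gD t"])
  qed
  have 2: "continuous_on {0..T} (\<lambda>t. dt up t x)" for x
  proof -
    have "continuous_on {0..T} (\<lambda>t. \<Sum>k<2 * p. cf (dt u t) k * mtc l k x)"
      unfolding cf_def
      by (intro continuous_intros continuous_on_subset[OF C_L2_pairing_continuous[OF u_C(3) mtc_L2]]) auto
    then show ?thesis
      by (rule continuous_on_eq) (auto simp: u_proj_time_derivative(2)[OF u_C])
  qed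
  show ?thesis
    unfolding dS_def[abs_def] by (intro continuous_intros 1 2 pointwise_continuous)
qed

text \<open>The pairing with the consistency error is only known to be an integral in time. Its increment
  contains the pairing with the velocity, which cancels the corresponding term in the derivative
  of \<open>S\<close>, so that only explicit time derivatives are left.\<close>

lemma energy_increment:
  assumes b: "b \<in> {0..T}"
  shows "\<bar>F b (e b) - F 0 (e 0)\<bar> \<le> (\<bar>\<delta>\<bar> * C + 1 / 2) * integral {0..b} N + 1 / 2 * data_sq"
proof -
  have z: "0 \<in> {0..T}" using T_pos by simp
  let ?f' = "\<lambda>t x. e' t x * gD t x + dt gD t x * e t x"
  have I: "integrable (slab T) (\<lambda>(t, x). ?f' t x)"
    using Bochner_Integration.integrable_add[OF L2_integrable_mult[OF e'_slab gD_slab]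
      L2_integrable_mult[OF dgD_slab e_slab]]
    by (rule back_subst[of "integrable (slab T)"]) auto
  have D: "L2_inner (e b) (gD b) - L2_inner (e 0) (gD 0) = (LINT t:{0..b}|lborel. (LINT x|lborel. ?f' t x))"
    unfolding L2_inner_def
  proof (rule slab_FTC[OF b _ I])
    show "((\<lambda>s. e s x * gD s x) has_real_derivative ?f' t x) (at t within {0..T})" if "t \<in> {0..T}" for t x
      using DERIV_mult[OF gr(2)[OF that] gD_deriv[OF that]] by simp
  qed (use b z in \<open>auto intro!: L2_integrable_mult V_L2 e_in gD_at(1)\<close>)
  have idS: "integrable lborel (\<lambda>t. indicat_real {0..T} t * dS t)"
    using borel_integrable_compact[OF compact_Icc dS_continuous] by simp
  have S: "(LINT t:{0..b}|lborel. dS t) = S b - S 0"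
    using b by (intro integral_derivative_eq[where S = "{0..T}" and g = S] S_deriv idS) auto
  have FS: "F t (e t) = S t + L2_inner (e t) (gD t)" if "t \<in> {0..T}" for t
    by (simp add: F_V[OF that e_in[OF that]] S_def)
  let ?c = "\<lambda>t. indicat_real {0..b} t" and ?Z = "\<lambda>t. LINT x|lborel. ?f' t x"
  let ?Y = "\<lambda>t. indicat_real {0..T} t * (LINT x|lborel. (dt gD t x)\<^sup>2)"
  let ?k = "\<bar>\<delta>\<bar> * C + 1 / 2"
  have iS: "integrable lborel (\<lambda>t. ?c t * dS t)"
    using borel_integrable_compact[OF compact_Icc continuous_on_subset[OF dS_continuous], of 0 b] b by simp
  have iN: "integrable lborel (\<lambda>t. ?c t * N t)"
    using borel_integrable_compact[OF compact_Icc continuous_on_subset[OF N_continuous], of 0 b] b by simp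
  have iZ: "integrable lborel (\<lambda>t. ?c t * ?Z t)"
    using slab_integrable_sections(5)[OF slab_integrable_restrict[OF I, of b]] b by simp
  have sq: "(\<lambda>(t, x). (dt gD t x)\<^sup>2) = (\<lambda>z. ((\<lambda>(t, x). dt gD t x) z)\<^sup>2)" by auto
  have Isq: "integrable (slab T) (\<lambda>(t, x). (dt gD t x)\<^sup>2)"
    unfolding sq by (rule L2_funD(2)[OF dgD_slab])
  have iY: "integrable lborel ?Y" by (rule slab_integrable_sections(5)[OF Isq])
  have vY: "(LINT t|lborel. ?Y t) \<le> data_sq"
    unfolding slab_integrable_sections(6)[OF Isq] sq using data_bounds(4) by (simp only: L2_norm_sq)
  have vN: "(LINT t|lborel. ?c t * N t) = integral {0..b} N"
    using set_borel_integral_eq_integral(2)[of "{0..b}" N] iN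
    by (simp add: set_integrable_def set_lebesgue_integral_def)
  have "F b (e b) - F 0 (e 0) = (LINT t|lborel. ?c t * dS t) + (LINT t|lborel. ?c t * ?Z t)"
    unfolding FS[OF b] FS[OF z] using S D by (simp add: set_lebesgue_integral_def)
  also have "\<dots> = (LINT t|lborel. ?c t * dS t + ?c t * ?Z t)"
    by (rule Bochner_Integration.integral_add[OF iS iZ, symmetric])
  finally have "\<bar>F b (e b) - F 0 (e 0)\<bar> = \<bar>LINT t|lborel. ?c t * dS t + ?c t * ?Z t\<bar>" by (rule arg_cong)
  also have "\<dots> \<le> (LINT t|lborel. ?k * (?c t * N t) + 1 / 2 * ?Y t)"
  proof (rule order_trans[OF integral_abs_bound], rule integral_mono_AE)
    show "integrable lborel (\<lambda>t. \<bar>?c t * dS t + ?c t * ?Z t\<bar>)"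
      by (intro integrable_abs Bochner_Integration.integrable_add iS iZ)
    show "integrable lborel (\<lambda>t. ?k * (?c t * N t) + 1 / 2 * ?Y t)"
      by (intro Bochner_Integration.integrable_add integrable_mult_right iN iY)
    show "AE t in lborel. \<bar>?c t * dS t + ?c t * ?Z t\<bar> \<le> ?k * (?c t * N t) + 1 / 2 * ?Y t"
      using slab_integrable_sections(2)[OF Isq]
    proof eventually_elim
      fix t assume ae: "t \<in> {0..T} \<longrightarrow> integrable lborel (\<lambda>x. (dt gD t x)\<^sup>2)"
      show "\<bar>?c t * dS t + ?c t * ?Z t\<bar> \<le> ?k * (?c t * N t) + 1 / 2 * ?Y t"
      proof (cases "t \<in> {0..b}")
        case True
        then have t: "t \<in> {0..T}" using b by auto
        have L: "L2_fun lborel (dt gD t)"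
          using ae t slab_measurable_section[OF L2_funD(1)[OF dgD_slab] t] by (simp add: L2_fun_def)
        note et = V_L2[OF e_in[OF t]] and e't = V_L2[OF J_V_in[OF gr_in[OF t]]]
        have Z: "?Z t = L2_inner (e' t) (gD t) + L2_inner (dt gD t) (e t)"
          unfolding L2_inner_def
          by (rule Bochner_Integration.integral_add[OF L2_integrable_mult[OF e't gD_at(1)[OF t]] L2_integrable_mult[OF L et]])
        let ?s = "\<Sum>m<2 * p. W m * (dt up t (nd m) * (e t (nd m) * e t (nd m)))"
        have "\<bar>?s\<bar> \<le> C * enorm t * enorm t"
          by (rule node_bound[OF e_in[OF t] e_in[OF t] dup_bound[OF t]])
        then have 1: "\<bar>\<delta> * ?s\<bar> \<le> \<bar>\<delta>\<bar> * (C * enorm t * enorm t)"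
          by (simp add: abs_mult mult_left_mono)
        have "L2_norm lborel (dt gD t) * enorm t \<le> 1 / 2 * (L2_norm lborel (dt gD t))\<^sup>2 + (enorm t)\<^sup>2 / (4 * (1 / 2))"
          by (rule young) simp
        then have 2: "\<bar>L2_inner (dt gD t) (e t)\<bar> \<le> 1 / 2 * (L2_norm lborel (dt gD t))\<^sup>2 + 1 / 2 * (enorm t)\<^sup>2"
          using L2_inner_bound[OF L et] by simp
        have "dS t + ?Z t = \<delta> * ?s + L2_inner (dt gD t) (e t)" by (simp add: dS_def Z)
        then have "\<bar>dS t + ?Z t\<bar> \<le> \<bar>\<delta> * ?s\<bar> + \<bar>L2_inner (dt gD t) (e t)\<bar>"
          by (simp only: abs_triangle_ineq)
        also have "\<dots> \<le> \<bar>\<delta>\<bar> * (C * enorm t * enorm t) + (1 / 2 * (L2_norm lborel (dt gD t))\<^sup>2 + 1 / 2 * (enorm t)\<^sup>2)"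
          by (rule add_mono[OF 1 2])
        also have "\<dots> = ?k * N t + 1 / 2 * (LINT x|lborel. (dt gD t x)\<^sup>2)"
          unfolding N_eq by (simp add: L2_norm_sq[of _ "dt gD t"] power2_eq_square[of "enorm t"] distrib_right)
        finally show ?thesis using True t by simp
      next
        case False
        then show ?thesis by (simp add: integral_nonneg_AE)
      qed
    qed
  qed
  also have "\<dots> = ?k * (LINT t|lborel. ?c t * N t) + 1 / 2 * (LINT t|lborel. ?Y t)"
  proof -
    have 1: "integrable lborel (\<lambda>t. ?k * (?c t * N t))" by (rule integrable_mult_right) (rule iN)
    have 2: "integrable lborel (\<lambda>t. 1 / 2 * ?Y t)" by (rule integrable_mult_right) (rule iY)
    show ?thesis
      unfolding Bochner_Integration.integral_add[OF 1 2] integral_mult_right_zero ..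
  qed
  also have "\<dots> \<le> ?k * integral {0..b} N + 1 / 2 * data_sq"
    unfolding vN using vY by (intro add_left_mono mult_left_mono) auto
  finally show ?thesis .
qed

lemma energy_bound:
  assumes t: "t \<in> {0..T}"
  shows "\<bar>F t (e t)\<bar> \<le> 3 / 2 * data_sq + (\<bar>\<delta>\<bar> * C + 1 / 2) * integral {0..t} N"
proof -
  have "\<bar>F 0 (e 0)\<bar> \<le> \<bar>G_fun l p \<alpha> \<beta> \<gamma> \<delta> (\<lambda>x. - e 0 x)\<bar> + \<bar>E_fun l p \<delta> u (e 0) 0\<bar> + \<bar>D_fun l p \<alpha> \<beta> \<gamma> \<delta> u (e 0) 0\<bar>"
    unfolding F_def by (rule order_trans[OF abs_triangle_ineq add_right_mono[OF abs_triangle_ineq]])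
  then have "\<bar>F 0 (e 0)\<bar> \<le> data_sq" using data_bounds(2) by linarith
  then show ?thesis using energy_increment[OF t] by (simp add: abs_le_iff)
qed

text \<open>The derivative of \<open>N\<close> is minus twice the directional derivative of the energy along \<open>J e\<close>. The
  smallness condition enters only through \<open>mn\<close>: it makes the product of the maximum and the norm of
  \<open>e\<close> no larger than the norms of \<open>e\<close> and \<open>J e\<close>.\<close>

lemma derivative_bound:
  assumes t: "t \<in> {0..T}" and small: "sqrt (1 + real p) * N t \<le> 1"
  shows "\<bar>2 * L2_inner (e t) (e' t)\<bar> \<le> growth_rate \<alpha> \<beta> \<gamma> \<delta> C T * (data_sq + N t + integral {0..t} N)"
proof -
  let ?n = "enorm t" and ?x = "Jnorm t" and ?g = "L2_norm lborel (gD t)" and ?I = "integral {0..t} N"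
  define m where "m = sqrt (sqrt (1 + real p) * (?n\<^sup>2 + ?x\<^sup>2))"
  note et = e_in[OF t] and Jet = J_V_in[OF e_in[OF t]]
  have nn: "0 \<le> ?n" "0 \<le> ?x" "0 \<le> ?g" "0 \<le> m" by (auto simp: L2_norm_nonneg m_def)
  have I: "0 \<le> ?I"
  proof (rule integral_nonneg)
    show "N integrable_on {0..t}"
      by (rule integrable_continuous_real[OF continuous_on_subset[OF N_continuous]]) (use t in auto)
  qed (rule N_nonneg)
  have m: "\<bar>e t y\<bar> \<le> m" for y
    using pointwise_bound[OF et, of y] unfolding m_def by (intro real_le_rsqrt) simp
  have mn: "(m * ?n)\<^sup>2 \<le> ?n\<^sup>2 + ?x\<^sup>2"
  proof -
    have "(m * ?n)\<^sup>2 = (sqrt (1 + real p) * N t) * (?n\<^sup>2 + ?x\<^sup>2)"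
      unfolding power_mult_distrib m_def N_eq by simp
    also have "\<dots> \<le> 1 * (?n\<^sup>2 + ?x\<^sup>2)" by (rule mult_right_mono[OF small]) simp
    finally show ?thesis by simp
  qed
  let ?c3 = "\<Sum>i<2 * p. W i * e t (nd i) ^ 3"
    and ?c2 = "\<Sum>i<2 * p. W i * (up t (nd i) * (e t (nd i))\<^sup>2)"
    and ?h = "L2_inner (e t) (hilbert (J (e t)))"
  have c3: "\<bar>?c3\<bar> \<le> m * ?n * ?n"
    using node_bound[OF et et m, of nd] by (simp add: power3_eq_cube mult.assoc)
  have c2: "\<bar>?c2\<bar> \<le> C * ?n * ?n"
    using node_bound[OF et et up_bound[OF t], of nd] by (simp add: power2_eq_square)
  have h: "\<bar>?h\<bar> \<le> ?n * ?x"
    using L2_inner_bound[OF V_L2[OF et] V_L2[OF H_in[OF Jet]]] by (simp add: H_isometry[OF Jet])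
  have d: "\<bar>L2_inner (e t) (gD t)\<bar> \<le> ?n * ?g"
    by (rule L2_inner_bound[OF V_L2[OF et] gD_at(1)[OF t]])
  have split: "\<gamma> / 2 * ?x\<^sup>2 = F t (e t) - \<alpha> / 2 * ?n\<^sup>2 - \<beta> / 2 * ?h + \<delta> / 3 * ?c3 - \<delta> * ?c2 - L2_inner (e t) (gD t)"
    by (simp add: F_V[OF t et] Q_def L2_inner_self algebra_simps add_divide_distrib)
  have "\<bar>\<gamma> / 2 * ?x\<^sup>2\<bar> \<le> \<bar>F t (e t)\<bar> + \<bar>\<alpha> / 2 * ?n\<^sup>2\<bar> + \<bar>\<beta> / 2 * ?h\<bar> + \<bar>\<delta> / 3 * ?c3\<bar> + \<bar>\<delta> * ?c2\<bar> + \<bar>L2_inner (e t) (gD t)\<bar>"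
  proof -
    have "\<bar>E - a - b + c - d - f\<bar> \<le> \<bar>E\<bar> + \<bar>a\<bar> + \<bar>b\<bar> + \<bar>c\<bar> + \<bar>d\<bar> + \<bar>f\<bar>" for E a b c d f :: real by arith
    then show ?thesis unfolding split .
  qed
  then have "\<bar>\<gamma>\<bar> / 2 * ?x\<^sup>2 \<le> \<bar>F t (e t)\<bar> + \<bar>\<alpha>\<bar> / 2 * ?n\<^sup>2 + \<bar>\<beta>\<bar> / 2 * \<bar>?h\<bar> + \<bar>\<delta>\<bar> / 3 * \<bar>?c3\<bar> + \<bar>\<delta>\<bar> * \<bar>?c2\<bar> + \<bar>L2_inner (e t) (gD t)\<bar>"
    by (simp add: abs_mult)
  also have "\<dots> \<le> \<bar>F t (e t)\<bar> + \<bar>\<alpha>\<bar> / 2 * ?n\<^sup>2 + \<bar>\<beta>\<bar> / 2 * (?n * ?x) + \<bar>\<delta>\<bar> / 3 * (m * ?n * ?n) + \<bar>\<delta>\<bar> * (C * ?n * ?n) + ?n * ?g"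
    using c3 c2 h d by (intro add_mono mult_left_mono order_refl) auto
  finally have E: "\<bar>\<gamma>\<bar> / 2 * ?x\<^sup>2 \<le> \<dots>" .
  have X: "?x\<^sup>2 \<le> energy_rate \<alpha> \<beta> \<gamma> \<delta> C T * (data_sq + ?n\<^sup>2 + ?I)"
    by (rule energy_controls_derivative[OF gamma C_pos T_pos nn data_sq_nonneg I mn gD_at(2)[OF t] energy_bound[OF t] E])
  have "L2_inner (e t) (e' t) = - dF t (J (e t))"
    using J_skew[OF et gr_in[OF t]] gr_inner[OF t Jet] by (simp add: L2_inner_commute)
  also have "dF t (J (e t)) = - (\<delta> * (\<Sum>i<2 * p. W i * ((e t (nd i))\<^sup>2 * J (e t) (nd i))))
     + 2 * \<delta> * (\<Sum>i<2 * p. W i * (up t (nd i) * (e t (nd i) * J (e t) (nd i)))) + L2_inner (J (e t)) (gD t)"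
    (is "_ = - (\<delta> * ?d3) + 2 * \<delta> * ?d2 + ?d1")
    by (simp add: dF_def Q_J[OF et])
  finally have eq: "L2_inner (e t) (e' t) = - (- (\<delta> * ?d3) + 2 * \<delta> * ?d2 + ?d1)" .
  have d3: "\<bar>?d3\<bar> \<le> m * ?n * ?x"
    using node_bound[OF et Jet m, of nd] by (simp add: power2_eq_square mult.assoc)
  have d2: "\<bar>?d2\<bar> \<le> C * ?n * ?x"
    using node_bound[OF et Jet up_bound[OF t], of nd] by simp
  have d1: "\<bar>?d1\<bar> \<le> ?x * ?g"
    by (rule L2_inner_bound[OF V_L2[OF Jet] gD_at(1)[OF t]])
  have "\<bar>2 * L2_inner (e t) (e' t)\<bar> \<le> 2 * (\<bar>\<delta> * ?d3\<bar> + \<bar>2 * \<delta> * ?d2\<bar> + \<bar>?d1\<bar>)"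
  proof -
    have "\<bar>- (- a + b + c)\<bar> \<le> \<bar>a\<bar> + \<bar>b\<bar> + \<bar>c\<bar>" for a b c :: real by arith
    then have "\<bar>L2_inner (e t) (e' t)\<bar> \<le> \<bar>\<delta> * ?d3\<bar> + \<bar>2 * \<delta> * ?d2\<bar> + \<bar>?d1\<bar>" unfolding eq .
    then show ?thesis unfolding abs_mult[of 2] by (intro mult_mono) auto
  qed
  also have "\<dots> = 2 * (\<bar>\<delta>\<bar> * \<bar>?d3\<bar> + 2 * \<bar>\<delta>\<bar> * \<bar>?d2\<bar> + \<bar>?d1\<bar>)" by (simp add: abs_mult)
  also have "\<dots> \<le> 2 * (\<bar>\<delta>\<bar> * (m * ?n * ?x) + 2 * \<bar>\<delta>\<bar> * (C * ?n * ?x) + ?x * ?g)"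
    using d3 d2 d1 by (intro add_mono mult_left_mono) auto
  finally have "\<bar>2 * L2_inner (e t) (e' t)\<bar> \<le> growth_rate \<alpha> \<beta> \<gamma> \<delta> C T * (data_sq + ?n\<^sup>2 + ?I)"
    by (rule growth_bound[OF gamma C_pos T_pos nn data_sq_nonneg I mn gD_at(2)[OF t] X])
  then show ?thesis by (simp add: N_eq)
qed

lemma data_nonneg: "0 \<le> data_size l p \<alpha> \<beta> \<gamma> \<delta> T u0 u"
  by (simp add: data_size_def Let_def L2_norm_nonneg)

lemma error_bound:
  assumes small: "sqrt (1 + real p) * (2 * data_sq * exp ((growth_rate \<alpha> \<beta> \<gamma> \<delta> C T + 1) * T)) < 1"
    and t: "t \<in> {0..T}"
  shows "enorm t \<le> sqrt (2 * exp ((growth_rate \<alpha> \<beta> \<gamma> \<delta> C T + 1) * T)) * data_size l p \<alpha> \<beta> \<gamma> \<delta> T u0 u"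
proof -
  have "N t \<le> 2 * data_sq * exp ((growth_rate \<alpha> \<beta> \<gamma> \<delta> C T + 1) * T)"
  proof (rule bootstrap_gronwall[OF N_deriv N_nonneg growth_rate_nonneg data_sq_nonneg _ _ derivative_bound small t])
    show "N 0 \<le> data_sq" using data_bounds(1) by (simp add: N_eq)
  qed (use T_pos C_pos in auto)
  then have "sqrt ((enorm t)\<^sup>2) \<le> sqrt (2 * exp ((growth_rate \<alpha> \<beta> \<gamma> \<delta> C T + 1) * T) * (data_size l p \<alpha> \<beta> \<gamma> \<delta> T u0 u)\<^sup>2)"
    unfolding N_eq data_sq_def by (intro real_sqrt_le_mono) (simp add: mult.commute mult.left_commute)
  then show ?thesis using data_nonneg by (simp add: real_sqrt_mult L2_norm_nonneg)
qed

end

section \<open>The error estimate\<close>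

text \<open>Squaring the decay rate gives the power \<open>- 1 / 2 - \<epsilon> / 2\<close> of the resolution. The first half
  compensates the factor \<open>sqrt (1 + p)\<close>, the second tends to zero.\<close>

lemma resolution_decay:
  fixes l \<epsilon> \<kappa> E :: real
  assumes "l > 0" "\<epsilon> > 0" "E > 0"
  shows "\<forall>\<^sub>F p in sequentially.
    sqrt (1 + real p) * (2 * (\<kappa> * (l * real (2 * p - 1) / 2) powr (- (1 + \<epsilon>) / 4))\<^sup>2 * E) < 1"
proof -
  let ?K = "sqrt (2 / l) * (2 * \<kappa>\<^sup>2 * E)"
  have lim: "((\<lambda>p. ?K * (l * real p / 2) powr (- \<epsilon> / 2)) \<longlongrightarrow> ?K * 0) sequentially"
  proof (intro tendsto_mult tendsto_const tendsto_neg_powr)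
    show "- \<epsilon> / 2 < 0" using assms by simp
    show "filterlim (\<lambda>p. l * real p / 2) at_top sequentially"
      using assms(1) by real_asymp
  qed
  then have "\<forall>\<^sub>F p in sequentially. ?K * (l * real p / 2) powr (- \<epsilon> / 2) < 1"
    by (intro order_tendstoD(2)) auto
  then show ?thesis
    using eventually_ge_at_top[of 2]
  proof eventually_elim
    fix p :: nat
    assume lt: "?K * (l * real p / 2) powr (- \<epsilon> / 2) < 1" and p: "2 \<le> p"
    let ?a = "l * real (2 * p - 1) / 2" and ?b = "l * real p / 2"
    have b: "0 < ?b" using assms(1) p by simp
    have "real (2 * p - 1) = 2 * real p - 1" using p by simp
    then have r: "1 + real p \<le> real (2 * p - 1)" "real p \<le> real (2 * p - 1)" using p by linarith+
    then have ba: "?b \<le> ?a" using assms(1) by simp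
    then have a: "0 < ?a" using b by linarith
    have "(?a powr (- (1 + \<epsilon>) / 4))\<^sup>2 = ?a powr (- (1 + \<epsilon>) / 4 + - (1 + \<epsilon>) / 4)"
      unfolding power2_eq_square by (rule powr_add[symmetric])
    also have "- (1 + \<epsilon>) / 4 + - (1 + \<epsilon>) / 4 = - (1 / 2) + (- \<epsilon> / 2)" by (simp add: field_simps)
    also have "?a powr (- (1 / 2) + (- \<epsilon> / 2)) = ?a powr (- (1 / 2)) * ?a powr (- \<epsilon> / 2)" by (rule powr_add)
    also have "?a powr (- (1 / 2)) = 1 / sqrt ?a"
      by (simp only: powr_minus_divide powr_half_sqrt[OF less_imp_le[OF a]])
    finally have sq: "(?a powr (- (1 + \<epsilon>) / 4))\<^sup>2 = 1 / sqrt ?a * ?a powr (- \<epsilon> / 2)" .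
    have "sqrt (1 + real p) * (2 * (\<kappa> * ?a powr (- (1 + \<epsilon>) / 4))\<^sup>2 * E)
        = (sqrt (1 + real p) * (1 / sqrt ?a)) * ((2 * \<kappa>\<^sup>2 * E) * ?a powr (- \<epsilon> / 2))"
      unfolding power_mult_distrib sq by (simp only: ac_simps)
    also have "sqrt (1 + real p) * (1 / sqrt ?a) = sqrt ((1 + real p) / ?a)" by (simp only: real_sqrt_divide times_divide_eq_right mult_1_right)
    also have "sqrt ((1 + real p) / ?a) * ((2 * \<kappa>\<^sup>2 * E) * ?a powr (- \<epsilon> / 2))
        \<le> sqrt (2 / l) * ((2 * \<kappa>\<^sup>2 * E) * ?b powr (- \<epsilon> / 2))"
    proof (intro mult_mono mult_left_mono)
      show "sqrt ((1 + real p) / ?a) \<le> sqrt (2 / l)"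
      proof (rule real_sqrt_le_mono)
        have "(1 + real p) / ?a \<le> real (2 * p - 1) / ?a" using r(1) a by (intro divide_right_mono) auto
        also have "real (2 * p - 1) / ?a = 2 / l"
        proof -
          have "X / (l * X / 2) = 2 / l" if "X \<noteq> 0" for X :: real
            using that assms(1) by (simp add: divide_simps)
          moreover have "real (2 * p - 1) \<noteq> 0" using r p by linarith
          ultimately show ?thesis by blast
        qed
        finally show "(1 + real p) / ?a \<le> 2 / l" .
      qed
      show "?a powr (- \<epsilon> / 2) \<le> ?b powr (- \<epsilon> / 2)"
        by (rule powr_mono2') (use assms b ba in auto)
    qed (use assms in auto)
    also have "sqrt (2 / l) * ((2 * \<kappa>\<^sup>2 * E) * ?b powr (- \<epsilon> / 2)) = ?K * ?b powr (- \<epsilon> / 2)"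
      by (simp only: mult.assoc)
    also note lt
    finally show "sqrt (1 + real p) * (2 * (\<kappa> * ?a powr (- (1 + \<epsilon>) / 4))\<^sup>2 * E) < 1" .
  qed
qed

theorem theorem4p5:
  fixes \<alpha> \<beta> \<gamma> \<delta> C T :: real
  assumes "\<gamma> \<noteq> 0" and "C > 0" and "T > 0"
  shows "\<exists>c>0. \<forall>l>0. \<forall>\<epsilon>>0. \<forall>(u0 :: real \<Rightarrow> real) (u :: real \<Rightarrow> real \<Rightarrow> real)
      (e :: nat \<Rightarrow> real \<Rightarrow> real \<Rightarrow> real).
    benjamin_solution \<alpha> \<beta> \<gamma> \<delta> u0 u \<longrightarrow>
    (\<forall>\<^sub>F p in sequentially. error_solution l p \<alpha> \<beta> \<gamma> \<delta> T u0 u (e p)) \<longrightarrow>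
    (\<forall>\<^sub>F p in sequentially.
       max (Linf_norm (slab T) (\<lambda>(t, x). u_proj l p u t x))
           (Linf_norm (slab T) (\<lambda>(t, x). dt (u_proj l p u) t x)) < ereal C) \<longrightarrow>
    (\<forall>\<^sub>F p in sequentially.
       L2_fun (slab T) (\<lambda>(t, x). grad_D l p \<alpha> \<beta> \<gamma> \<delta> u t x) \<and>
       L2_fun (slab T) (\<lambda>(t, x). dt (grad_D l p \<alpha> \<beta> \<gamma> \<delta> u) t x)) \<longrightarrow>
    (\<lambda>p. data_size l p \<alpha> \<beta> \<gamma> \<delta> T u0 u)
       \<in> O(\<lambda>p. (l * real (2 * p - 1) / 2) powr (- (1 + \<epsilon>) / 4)) \<longrightarrow>
    (\<forall>\<^sub>F p in sequentially.
       (SUP t\<in>{0..T}. L2_norm lborel (e p t)) \<le> c * data_size l p \<alpha> \<beta> \<gamma> \<delta> T u0 u)"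
proof -
  define E where "E = exp ((growth_rate \<alpha> \<beta> \<gamma> \<delta> C T + 1) * T)"
  have E: "E > 0" by (simp add: E_def)
  show ?thesis
  proof (intro exI[of _ "sqrt (2 * E)"] conjI allI impI)
    show "sqrt (2 * E) > 0" using E by simp
    fix l \<epsilon> :: real and u0 :: "real \<Rightarrow> real" and u :: "real \<Rightarrow> real \<Rightarrow> real" and e :: "nat \<Rightarrow> real \<Rightarrow> real \<Rightarrow> real"
    let ?d = "\<lambda>p. data_size l p \<alpha> \<beta> \<gamma> \<delta> T u0 u"
    assume l: "l > 0" and \<epsilon>: "\<epsilon> > 0" and u: "benjamin_solution \<alpha> \<beta> \<gamma> \<delta> u0 u"
      and sol: "\<forall>\<^sub>F p in sequentially. error_solution l p \<alpha> \<beta> \<gamma> \<delta> T u0 u (e p)"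
      and Linf: "\<forall>\<^sub>F p in sequentially.
         max (Linf_norm (slab T) (\<lambda>(t, x). u_proj l p u t x))
             (Linf_norm (slab T) (\<lambda>(t, x). dt (u_proj l p u) t x)) < ereal C"
      and L2: "\<forall>\<^sub>F p in sequentially.
         L2_fun (slab T) (\<lambda>(t, x). grad_D l p \<alpha> \<beta> \<gamma> \<delta> u t x) \<and>
         L2_fun (slab T) (\<lambda>(t, x). dt (grad_D l p \<alpha> \<beta> \<gamma> \<delta> u) t x)"
      and data: "?d \<in> O(\<lambda>p. (l * real (2 * p - 1) / 2) powr (- (1 + \<epsilon>) / 4))"
    obtain \<kappa> where "\<forall>\<^sub>F p in sequentially.
        norm (?d p) \<le> \<kappa> * norm ((l * real (2 * p - 1) / 2) powr (- (1 + \<epsilon>) / 4))"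
      using data by (elim landau_o.bigE)
    then show "\<forall>\<^sub>F p in sequentially. (SUP t\<in>{0..T}. L2_norm lborel (e p t)) \<le> sqrt (2 * E) * ?d p"
      using resolution_decay[OF l \<epsilon> E, of \<kappa>] sol Linf L2 eventually_gt_at_top[of 0]
    proof eventually_elim
      fix p :: nat
      let ?w = "(l * real (2 * p - 1) / 2) powr (- (1 + \<epsilon>) / 4)"
      assume d: "norm (?d p) \<le> \<kappa> * norm ?w"
        and small: "sqrt (1 + real p) * (2 * (\<kappa> * ?w)\<^sup>2 * E) < 1"
        and sol: "error_solution l p \<alpha> \<beta> \<gamma> \<delta> T u0 u (e p)"
        and Linf: "max (Linf_norm (slab T) (\<lambda>(t, x). u_proj l p u t x))
             (Linf_norm (slab T) (\<lambda>(t, x). dt (u_proj l p u) t x)) < ereal C"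
        and L2: "L2_fun (slab T) (\<lambda>(t, x). grad_D l p \<alpha> \<beta> \<gamma> \<delta> u t x) \<and>
         L2_fun (slab T) (\<lambda>(t, x). dt (grad_D l p \<alpha> \<beta> \<gamma> \<delta> u) t x)"
        and p: "0 < p"
      interpret error_evolution l p \<alpha> \<beta> \<gamma> \<delta> C T u0 u "e p"
        by unfold_locales (use assms l p u sol Linf L2 in \<open>auto simp: benjamin_solution_def\<close>)
      have "\<bar>?d p\<bar> \<le> \<kappa> * ?w" using d by simp
      then have "data_sq \<le> (\<kappa> * ?w)\<^sup>2"
        unfolding data_sq_def using power_mono[of "\<bar>?d p\<bar>" "\<kappa> * ?w" 2] by simp
      then have "sqrt (1 + real p) * (2 * data_sq * E) \<le> sqrt (1 + real p) * (2 * (\<kappa> * ?w)\<^sup>2 * E)"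
        using E by (intro mult_left_mono mult_right_mono) auto
      then have "sqrt (1 + real p) * (2 * data_sq * E) < 1" using small by linarith
      then have "L2_norm lborel (e p t) \<le> sqrt (2 * E) * ?d p" if "t \<in> {0..T}" for t
        using error_bound[OF _ that] unfolding E_def by blast
      then show "(SUP t\<in>{0..T}. L2_norm lborel (e p t)) \<le> sqrt (2 * E) * ?d p"
        by (intro cSUP_least) (use assms(3) in auto)
    qed
  qed
qed

end
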